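(* For $(a,b)\in\mathbb{R}^2$ let $R(z)=z^5-\tfrac12z^3-\tfrac a3z^2+\tfrac{1-2b}8z$ and, for $c\in\mathbb{R}$, let $P_5(z)=R(z)-\bigl(\tfrac c5-\tfrac a6\bigr)$. Let $f_5$ denote the density of $(p_3(U),p_4(U))$, where $U$ is uniformly distributed on $\Omega_5$. Let $(a,b)$ be such that $R'$ has four simple real zeros $w_1<w_2<w_3<w_4$ (local maximum, minimum, maximum, minimum of $R$ respectively), with values $v_j=R(w_j)$ satisfying $\max(v_2,v_4)<\min(v_1,v_3)$, and suppose that the numbers $5(v_j+a/6)$, $j=1,\dots,4$, are pairwise distinct; let $r_1<r_2<r_3<r_4$ be these numbers in increasing order. Then $(a,b)$ is an interior point of the support of $(p_3(U),p_4(U))$; $\mathrm{Disc}(P_5)=5\prod_{j=1}^4(c-r_j)$; the fibre, i.e. the set of $c$ for which all five roots of $P_5$ are real, is $[r_2,r_3]$; and $$f_5(a,b)=\frac{2\,\boldsymbol{K}(m)}{\pi^2\{(r_3-r_1)(r_4-r_2)\}^{1/2}},\qquad m=\frac{(r_3-r_2)(r_4-r_1)}{(r_3-r_1)(r_4-r_2)} .$$ If $R'$ has fewer than four real zeros (counted with multiplicity), or if $\max(v_2,v_4)>\min(v_1,v_3)$, then $(a,b)$ lies outside the support and $f_5(a,b)=0$; equality $\max(v_2,v_4)=\min(v_1,v_3)$ describes the support boundary, which is a null set. The density of $(S_5,K_5)$ is $h_5(s,k)=5^{-3/2}f_5(s/\sqrt5,\;k/5)$.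
   Context: For $u\in\mathbb{R}^5$ write $p_r(u)=\sum_{i=1}^5u_i^r$; $\Omega_5=\{u\in\mathbb{R}^5:\ p_1(u)=0,\ p_2(u)=1\}$. $P_5$ is the monic quintic whose roots have power sums $(p_1,\dots,p_5)=(0,1,a,b,c)$. $\mathrm{Disc}$ denotes the discriminant of a monic polynomial, $\prod_{i<j}(u_i-u_j)^2$ over its roots. $\boldsymbol{K}(m)=\int_0^{\pi/2}(1-m\sin^2\phi)^{-1/2}\,d\phi$ is the complete elliptic integral of the first kind with parameter $m$. $S_5$ and $K_5$ are the sample skewness and kurtosis of five independent $N(\mu,\sigma^2)$ observations ($\sigma>0$): with $m_r=\frac15\sum_i(X_i-\bar X)^r$, $S_5=m_3/m_2^{3/2}$, $K_5=m_4/m_2^2$; they satisfy $(S_5,K_5)=(\sqrt5\,p_3(U),5\,p_4(U))$ with $U$ uniform on $\Omega_5$. *)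

theory Defs
  imports
    "HOL-Probability.Probability"
    "HOL-Computational_Algebra.Fundamental_Theorem_Algebra"
begin

subsection \<open>The uniform distribution on the sphere of standardised samples\<close>

definition psum :: "nat \<Rightarrow> real^5 \<Rightarrow> real" where
  "psum r u = (\<Sum>i\<in>UNIV. u $ i ^ r)"

definition Omega5 :: "(real^5) set" where
  "Omega5 = {u. psum 1 u = 0 \<and> psum 2 u = 1}"

definition mean5 :: "real^5 \<Rightarrow> real" where
  "mean5 x = (\<Sum>i\<in>UNIV. x $ i) / 5"

definition centred :: "real^5 \<Rightarrow> real^5" where
  "centred x = (\<chi> i. x $ i - mean5 x)"

definition cylinder5 :: "(real^5) set" where
  "cylinder5 = {x. norm (centred x) \<le> 1 \<and> \<bar>mean5 x\<bar> \<le> 1}"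

text \<open>
  \<open>Omega5\<close> is the unit sphere of the four-dimensional subspace \<open>psum 1 x = 0\<close>, onto which
  \<open>centred\<close> is the orthogonal projection. The normalised surface measure of \<open>A \<subseteq> Omega5\<close> is the
  normalised four-dimensional volume of the cone \<open>{t *\<^sub>R u | t u. 0 < t \<le> 1 \<and> u \<in> A}\<close>. To use
  Lebesgue measure on \<open>real^5\<close>, the cone is replaced by the right prism over it, whose axis is
  the orthogonal complement of the subspace; up to a null set, this prism is the preimage of
  \<open>A\<close> in \<open>cylinder5\<close> under \<open>x \<mapsto> sgn (centred x)\<close>, where \<open>sgn y = y /\<^sub>R norm y\<close>.
\<close>
definition uniform_Omega5 :: "(real^5) measure" where
  "uniform_Omega5 = distr (uniform_measure lborel cylinder5) borel (\<lambda>x. sgn (centred x))"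

definition law_p34 :: "(real \<times> real) measure" where
  "law_p34 = distr uniform_Omega5 borel (\<lambda>u. (psum 3 u, psum 4 u))"

definition msupport :: "'a::topological_space measure \<Rightarrow> 'a set" where
  "msupport M = {x. \<forall>V. open V \<and> x \<in> V \<longrightarrow> emeasure M V > 0}"


subsection \<open>Sample skewness and kurtosis\<close>

definition sample_moment :: "nat \<Rightarrow> real^5 \<Rightarrow> real" where
  "sample_moment r x = (\<Sum>i\<in>UNIV. (x $ i - mean5 x) ^ r) / 5"

definition skewness5 :: "real^5 \<Rightarrow> real" where
  "skewness5 x = sample_moment 3 x / sample_moment 2 x powr (3/2)"

definition kurtosis5 :: "real^5 \<Rightarrow> real" where
  "kurtosis5 x = sample_moment 4 x / (sample_moment 2 x)\<^sup>2"


subsection \<open>The quintic, its discriminant, and the elliptic integral\<close>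

definition Rpoly :: "real \<Rightarrow> real \<Rightarrow> real poly" where
  "Rpoly a b = [:0, (1 - 2*b) / 8, - a / 3, - 1 / 2, 0, 1:]"

definition P5 :: "real \<Rightarrow> real \<Rightarrow> real \<Rightarrow> real poly" where
  "P5 a b c = Rpoly a b - [:c / 5 - a / 6:]"

text \<open>
  Discriminant of a monic complex polynomial. The product does not depend on the chosen
  enumeration of the roots (listed with multiplicity).
\<close>
definition disc :: "complex poly \<Rightarrow> complex" where
  "disc p = (let us = (SOME us. mset us = proots p)
             in \<Prod>j<length us. \<Prod>i<j. (us ! i - us ! j)\<^sup>2)"

text \<open>The argument is the parameter \<open>m\<close>, not the modulus \<open>sqrt m\<close>.\<close>
definition ellipticK :: "real \<Rightarrow> real" where
  "ellipticK m = integral {0..pi/2} (\<lambda>\<phi>. (1 - m * (sin \<phi>)\<^sup>2) powr (- 1/2))"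


subsection \<open>Consistency of the definitions\<close>

lemma mean5_inner: "mean5 x = (x \<bullet> 1) / 5"
  by (simp add: mean5_def inner_vec_def)

lemma centred_eq: "centred x = x - mean5 x *\<^sub>R 1"
  by (simp add: centred_def vec_eq_iff)

lemma linear_mean5: "linear mean5"
  by (simp add: mean5_inner[abs_def] linear_iff inner_add_left add_divide_distrib)

lemma linear_centred: "linear centred"
  using linear_mean5 by (simp add: centred_eq[abs_def] linear_iff algebra_simps)

lemma continuous_on_mean5 [continuous_intros]: "continuous_on S mean5"
  by (simp add: linear_mean5 linear_continuous_on linear_linear)

lemma continuous_on_centred [continuous_intros]: "continuous_on S centred"
  by (simp add: linear_centred linear_continuous_on linear_linear)

lemma borel_measurable_centred [measurable]: "centred \<in> borel_measurable borel"
  by (rule borel_measurable_continuous_onI) (rule continuous_on_centred)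

lemma borel_measurable_sgn_centred [measurable]:
  "(\<lambda>x. sgn (centred x)) \<in> borel_measurable borel"
  unfolding sgn_div_norm by measurable

lemma compact_cylinder5: "compact cylinder5"
proof -
  have "closed cylinder5"
    unfolding cylinder5_def
    by (intro closed_Collect_conj closed_Collect_le continuous_intros)
  moreover have "norm x \<le> 1 + norm (1 :: real^5)" if "x \<in> cylinder5" for x
  proof -
    have "x = centred x + mean5 x *\<^sub>R 1" by (simp add: centred_eq)
    hence "norm x \<le> norm (centred x) + norm (mean5 x *\<^sub>R (1::real^5))"
      by (metis norm_triangle_ineq)
    also have "\<dots> \<le> 1 + 1 * norm (1::real^5)"
      unfolding norm_scaleR
      using that by (intro add_mono mult_right_mono) (auto simp: cylinder5_def)
    finally show ?thesis by simp
  qed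
  ultimately show ?thesis
    by (meson bounded_iff compact_eq_bounded_closed)
qed

lemma cylinder5_sets [measurable]: "cylinder5 \<in> sets borel"
  by (simp add: borel_compact compact_cylinder5)

lemma emeasure_cylinder5_finite: "emeasure lborel cylinder5 \<noteq> \<infinity>"
  using emeasure_compact_finite[OF compact_cylinder5] by auto

lemma emeasure_cylinder5_pos: "emeasure lborel cylinder5 \<noteq> 0"
proof
  assume 0: "emeasure lborel cylinder5 = 0"
  define V where "V = {x. norm (centred x) < 1 \<and> \<bar>mean5 x\<bar> < 1}"
  have "open V"
    unfolding V_def by (intro open_Collect_conj open_Collect_less continuous_intros)
  moreover have "0 \<in> V"
    using linear_0[OF linear_centred] linear_0[OF linear_mean5] by (simp add: V_def)
  moreover have "V \<subseteq> cylinder5" by (auto simp: V_def cylinder5_def)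
  hence "negligible V"
    using 0 by (intro negligible_subset[of cylinder5 V])
      (auto simp: negligible_iff_null_sets intro: null_sets_completionI)
  ultimately show False
    using open_not_negligible by blast
qed

lemma prob_space_uniform_cylinder5: "prob_space (uniform_measure lborel cylinder5)"
  using emeasure_cylinder5_pos emeasure_cylinder5_finite by (rule prob_space_uniform_measure)

lemma prob_space_uniform_Omega5: "prob_space uniform_Omega5"
  unfolding uniform_Omega5_def
  by (rule prob_space.prob_space_distr[OF prob_space_uniform_cylinder5]) simp

lemma sets_uniform_Omega5 [simp, measurable_cong]: "sets uniform_Omega5 = sets borel"
  by (simp add: uniform_Omega5_def)

lemma space_uniform_Omega5 [simp]: "space uniform_Omega5 = UNIV"
  by (simp add: uniform_Omega5_def)

lemma psum_1: "psum 1 u = 5 * mean5 u"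
  by (simp add: psum_def mean5_def)

lemma psum_2: "psum 2 u = (norm u)\<^sup>2"
  unfolding power2_norm_eq_inner by (simp add: psum_def inner_vec_def power2_eq_square)

lemma mean5_1: "mean5 1 = 1"
  by (simp add: mean5_def)

lemma mean5_centred: "mean5 (centred x) = 0"
proof -
  have "mean5 (x - mean5 x *\<^sub>R 1) = mean5 x - mean5 x * mean5 1"
    using linear_mean5 by (simp add: linear_diff linear_cmul)
  thus ?thesis by (simp add: centred_eq mean5_1)
qed

lemma sgn_centred_in_Omega5:
  assumes "centred x \<noteq> 0"
  shows "sgn (centred x) \<in> Omega5"
proof -
  have "mean5 (sgn (centred x)) = 0"
    by (simp add: sgn_div_norm linear_cmul[OF linear_mean5] mean5_centred)
  thus ?thesis
    using assms unfolding Omega5_def by (simp only: mem_Collect_eq psum_1 psum_2) (simp add: norm_sgn)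
qed

lemma AE_centred_nonzero: "AE x in lborel. centred x \<noteq> 0"
proof -
  have "negligible (range (\<lambda>t::real. t *\<^sub>R (1::real^5)))"
  proof (rule negligible_lowdim)
    have "range (\<lambda>t::real. t *\<^sub>R (1::real^5)) = span {1}"
      by (rule span_singleton[symmetric])
    thus "dim (range (\<lambda>t::real. t *\<^sub>R (1::real^5))) < DIM(real^5)"
      using dim_le_card'[of "{1::real^5}"] by (simp add: dim_span)
  qed
  moreover have "{x. centred x = 0} \<subseteq> range (\<lambda>t::real. t *\<^sub>R (1::real^5))"
    by (auto simp: centred_eq)
  ultimately have "negligible {x. centred x = 0}"
    by (rule negligible_subset)
  hence "{x. centred x = 0} \<in> null_sets lebesgue"
    by (simp add: negligible_iff_null_sets)
  moreover have "{x. centred x = 0} \<in> sets lborel"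
    using closed_Collect_eq[OF continuous_on_centred continuous_on_const] by simp
  ultimately have "{x. centred x = 0} \<in> null_sets lborel"
    by (simp add: null_sets_def)
  thus ?thesis
    by (rule AE_I') auto
qed

lemma Omega5_sets [measurable]: "Omega5 \<in> sets borel"
proof -
  have "closed Omega5"
    unfolding Omega5_def psum_def
    by (intro closed_Collect_conj closed_Collect_eq continuous_intros)
  thus ?thesis by simp
qed

lemma AE_uniform_Omega5: "AE u in uniform_Omega5. u \<in> Omega5"
  unfolding uniform_Omega5_def
proof (subst AE_distr_iff)
  show "AE x in uniform_measure lborel cylinder5. sgn (centred x) \<in> Omega5"
    using AE_centred_nonzero
    by (intro AE_uniform_measureI) (auto elim!: eventually_mono intro: sgn_centred_in_Omega5)
qed (auto intro: Omega5_sets)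

lemma uniform_Omega5_invariant:
  assumes T: "orthogonal_transformation T" and T1: "T 1 = 1"
  shows "distr uniform_Omega5 borel T = uniform_Omega5"
proof -
  have lin: "linear T" by (rule orthogonal_transformation_linear[OF T])
  have meas [measurable]: "T \<in> borel_measurable borel"
    using lin by (intro borel_measurable_continuous_onI linear_continuous_on) (simp add: linear_linear)
  have mT: "mean5 (T x) = mean5 x" for x
    using T T1 unfolding mean5_inner orthogonal_transformation_def by metis
  have cT: "centred (T x) = T (centred x)" for x
    unfolding centred_eq mT using lin T1 by (simp add: linear_diff linear_cmul)
  have nT: "norm (T x) = norm x" for x
    by (rule orthogonal_transformation_norm[OF T])
  have sT: "sgn (centred (T x)) = T (sgn (centred x))" for x
    unfolding sgn_div_norm cT nT using lin by (simp add: linear_cmul)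
  have cylT: "T x \<in> cylinder5 \<longleftrightarrow> x \<in> cylinder5" for x
    by (simp add: cylinder5_def cT nT mT)
  have vol: "emeasure lborel (T -` S) = emeasure lborel S"
    if S: "S \<in> sets borel" "S \<subseteq> cylinder5" for S
  proof -
    have b: "bounded S"
      using S(2) compact_cylinder5 bounded_subset compact_imp_bounded by blast
    have SL: "S \<in> lmeasurable"
      using S(1) b by (simp add: bounded_set_imp_lmeasurable)
    have TS: "T -` S \<in> sets borel"
      using measurable_sets[OF meas S(1)] by simp
    have bij: "bij T" by (rule orthogonal_transformation_bij[OF T])
    have inv: "orthogonal_transformation (inv T)"
      by (rule orthogonal_transformation_inv[OF T])
    have im: "inv T ` S = T -` S"
      by (rule bij_vimage_eq_inv_image[OF bij, symmetric])
    have "T -` S \<in> lmeasurable" "measure lebesgue (T -` S) = measure lebesgue S"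
      using measurable_orthogonal_image[OF inv SL] measure_orthogonal_image[OF inv SL]
      unfolding im by auto
    hence "emeasure lebesgue (T -` S) = emeasure lebesgue S"
      using SL by (simp add: emeasure_eq_measure2)
    thus ?thesis using TS S(1) by simp
  qed
  show ?thesis
  proof (rule measure_eqI)
    fix A :: "(real^5) set" assume "A \<in> sets (distr uniform_Omega5 borel T)"
    hence A [measurable]: "A \<in> sets borel" by simp
    define D where "D = (\<lambda>x. sgn (centred x))"
    have D [measurable]: "D \<in> borel_measurable borel" by (simp add: D_def)
    have DA: "D -` B \<in> sets borel" if "B \<in> sets borel" for B
      using measurable_sets[OF D that] by simp
    have TA: "T -` A \<in> sets borel"
      using measurable_sets[OF meas A] by simp
    have eq: "cylinder5 \<inter> D -` (T -` A) = T -` (cylinder5 \<inter> D -` A)"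
      by (auto simp: D_def sT cylT)
    have "emeasure (distr uniform_Omega5 borel T) A
        = emeasure lborel (cylinder5 \<inter> D -` (T -` A)) / emeasure lborel cylinder5"
      using TA DA[OF TA]
      by (simp add: emeasure_distr uniform_Omega5_def D_def[symmetric])
    also have "\<dots> = emeasure lborel (cylinder5 \<inter> D -` A) / emeasure lborel cylinder5"
      unfolding eq using DA[OF A] by (subst vol) auto
    also have "\<dots> = emeasure uniform_Omega5 A"
      using DA[OF A] by (simp add: emeasure_distr uniform_Omega5_def D_def[symmetric])
    finally show "emeasure (distr uniform_Omega5 borel T) A = emeasure uniform_Omega5 A" .
  qed simp
qed

text \<open>By Newton's identities, \<open>P5 a b c\<close> is the monic quintic with power sums \<open>0, 1, a, b, c\<close>.\<close>

lemma P5_power_sums: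
  fixes u1 u2 u3 u4 u5 :: complex
  assumes "map_poly of_real (P5 a b c) = [:-u1,1:] * [:-u2,1:] * [:-u3,1:] * [:-u4,1:] * [:-u5,1:]"
  shows "u1 + u2 + u3 + u4 + u5 = 0" "u1^2 + u2^2 + u3^2 + u4^2 + u5^2 = 1"
    "u1^3 + u2^3 + u3^3 + u4^3 + u5^3 = of_real a" "u1^4 + u2^4 + u3^4 + u4^4 + u5^4 = of_real b"
    "u1^5 + u2^5 + u3^5 + u4^5 + u5^5 = of_real c"
proof -
  have P: "map_poly complex_of_real (P5 a b c) =
      [:- (of_real c / 5 - of_real a / 6), (1 - 2 * of_real b) / 8, - of_real a / 3, - 1/2, 0, 1:]"
    by (simp add: P5_def Rpoly_def map_poly_pCons)
  define e1 where "e1 = u1 + u2 + u3 + u4 + u5"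
  define e2 where "e2 = u1*u2 + u1*u3 + u1*u4 + u1*u5 + u2*u3 + u2*u4 + u2*u5 + u3*u4 + u3*u5 + u4*u5"
  define e3 where "e3 = u1*u2*u3 + u1*u2*u4 + u1*u2*u5 + u1*u3*u4 + u1*u3*u5 + u1*u4*u5
    + u2*u3*u4 + u2*u3*u5 + u2*u4*u5 + u3*u4*u5"
  define e4 where "e4 = u1*u2*u3*u4 + u1*u2*u3*u5 + u1*u2*u4*u5 + u1*u3*u4*u5 + u2*u3*u4*u5"
  define e5 where "e5 = u1*u2*u3*u4*u5"
  have Q: "[:-u1,1:] * [:-u2,1:] * [:-u3,1:] * [:-u4,1:] * [:-u5,1:] = [:- e5, e4, - e3, e2, - e1, 1:]"
    by (simp add: e1_def e2_def e3_def e4_def e5_def algebra_simps)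
  have "- e1 = 0" "e2 = - 1/2" "- e3 = - of_real a / 3" "e4 = (1 - 2 * of_real b) / 8"
      "- e5 = - (of_real c / 5 - of_real a / 6)"
    using assms unfolding P Q pCons_eq_iff by metis+
  hence e: "e1 = 0" "e2 = - 1/2" "e3 = of_real a / 3" "e4 = (1 - 2 * of_real b) / 8"
      "e5 = of_real c / 5 - of_real a / 6"
    by (metis neg_equal_0_iff_equal neg_equal_iff_equal minus_divide_left)+
  show "u1 + u2 + u3 + u4 + u5 = 0"
    using e(1) by (simp add: e1_def)
  have "u1^2 + u2^2 + u3^2 + u4^2 + u5^2 = e1^2 - 2 * e2"
    unfolding e1_def e2_def by algebra
  thus "u1^2 + u2^2 + u3^2 + u4^2 + u5^2 = 1" by (simp add: e)
  have "u1^3 + u2^3 + u3^3 + u4^3 + u5^3 = e1^3 - 3*e1*e2 + 3*e3"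
    unfolding e1_def e2_def e3_def by algebra
  thus "u1^3 + u2^3 + u3^3 + u4^3 + u5^3 = of_real a" by (simp add: e)
  have "u1^4 + u2^4 + u3^4 + u4^4 + u5^4 = e1^4 - 4*e1^2*e2 + 2*e2^2 + 4*e1*e3 - 4*e4"
    unfolding e1_def e2_def e3_def e4_def by algebra
  thus "u1^4 + u2^4 + u3^4 + u4^4 + u5^4 = of_real b" by (simp add: e power2_eq_square field_simps)
  have "u1^5 + u2^5 + u3^5 + u4^5 + u5^5
      = e1^5 - 5*e1^3*e2 + 5*e1*e2^2 + 5*e1^2*e3 - 5*e2*e3 - 5*e1*e4 + 5*e5"
    unfolding e1_def e2_def e3_def e4_def e5_def by algebra
  thus "u1^5 + u2^5 + u3^5 + u4^5 + u5^5 = of_real c" by (simp add: e field_simps)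
qed

end

theory Submission
  imports Defs
begin

text \<open>
  On strictly increasing vectors the power sum map is injective with Jacobian
  \<open>120 * \<Prod>\<^bsub>i<j\<^esub> (x\<^sub>j - x\<^sub>i)\<close>, and the 120 orderings contribute equally. In the coordinates mean, squared norm
  and standardised power sums \<open>a, b, c\<close>, any density depending on mean and norm alone therefore
  factorises, and \<open>(a, b)\<close> has a density proportional to \<open>\<integral> dc / sqrt (Disc P5)\<close> over the \<open>c\<close> for which all
  roots are real. Evaluating the discriminant as \<open>5^5 * \<Prod>\<^sub>j P5(w\<^sub>j)\<close> over the critical points turns this into a
  complete elliptic integral. Uniform law on the cylinder and normal samples are two instances of the
  same factorisation.

  Rolle's theorem with multiplicities shows that \<open>P5\<close> is real-rooted exactly if \<open>R'\<close> is and the level lies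
  between the local minima and the local maxima, which describes fibre and support.
\<close>

subsection \<open>Real-rooted quintics and their critical points\<close>

text \<open>The claims concern values of a density at single points, whereas a density is determined
  only almost everywhere. The fibre integral is therefore kept as an explicit function
  \<open>Jdens\<close> of \<open>(a, b)\<close>, and every pointwise statement is checked on it.

  The number 120 arises twice: as the product of the exponents 1, ..., 5 in the Jacobian and as the
  number of orderings. The two cancel. In standardised coordinates the squared norm \<open>q\<close>
  enters as \<open>q^6\<close> through the substitution and as \<open>1 / q^5\<close> through the
  ten root differences; the remaining \<open>5 * q\<close> is free of the shape coordinates, which
  is why the integral factorises. The total mass of the fibre integrals is
  \<open>pi^2 / sqrt 5\<close>, and its \<open>sqrt 5\<close> cancels against the leading factor 5
  of the discriminant.

  The support is a topological notion, so its boundary needs an argument of its own: equality of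
  extreme critical values does not by itself exclude an interior point. A perturbation of
  \<open>b\<close> alone leaves the region. Boundary quintics have multiple roots or multiple
  critical points, hence root counts are made with multiplicity throughout.\<close>

definition linprod :: "'a::comm_ring_1 list \<Rightarrow> 'a poly" where
  "linprod us = (\<Prod>u\<leftarrow>us. [:- u, 1:])"

lemma linprod_Nil [simp]: "linprod [] = 1"
  and linprod_Cons: "linprod (u # us) = [:- u, 1:] * linprod us"
  by (simp_all add: linprod_def)

lemma poly_linprod_Cons [simp]: "poly (linprod (u # us)) z = (z - u) * poly (linprod us) z"
  by (simp add: linprod_Cons algebra_simps)

lemma degree_linprod [simp]: "degree (linprod us :: 'a::idom poly) = length us"
  and linprod_nonzero: "linprod us \<noteq> (0 :: 'a::idom poly)"
  and lead_coeff_linprod [simp]: "lead_coeff (linprod us :: 'a::idom poly) = 1"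
proof (induction us)
  case (Cons u us)
  { case 1 show ?case using Cons by (simp add: linprod_Cons degree_mult_eq del: mult_pCons_left) }
  { case 2 show ?case using Cons by (simp add: linprod_Cons del: mult_pCons_left) }
  { case 3 show ?case unfolding linprod_Cons lead_coeff_mult using Cons by simp }
qed auto

lemma proots_linprod [simp]: "proots (linprod us :: 'a::idom poly) = mset us"
proof (induction us)
  case (Cons u us)
  then show ?case
    using linprod_nonzero[of us] by (simp add: linprod_Cons proots_mult del: mult_pCons_left)
qed auto

lemma linprod_dvd:
  fixes p :: "'a::idom poly"
  assumes "p \<noteq> 0" "mset us \<subseteq># proots p"
  shows "linprod us dvd p"
  using assms
proof (induction us arbitrary: p)
  case (Cons u us)
  have "u \<in># proots p" using Cons.prems by (auto dest: mset_subset_eqD)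
  hence "poly p u = 0" using Cons.prems by simp
  then obtain q where q: "p = [:- u, 1:] * q" by (auto simp: poly_eq_0_iff_dvd)
  have q0: "q \<noteq> 0" using q Cons.prems by auto
  have "proots p = {#u#} + proots q"
    unfolding q using q0 by (subst proots_mult) auto
  hence "mset us \<subseteq># proots q" using Cons.prems by simp
  from Cons.IH[OF q0 this] show ?case unfolding q linprod_Cons by (rule mult_dvd_mono[OF dvd_refl])
qed auto

text \<open>Enough zeros, counted with multiplicity, exhaust the degree. Every factorisation below
  is reduced to a multiset inclusion in this way.\<close>

lemma linprod_eqI:
  fixes p :: "'a::idom poly"
  assumes "p \<noteq> 0" "mset us \<subseteq># proots p" "length us = degree p"
  shows "p = smult (lead_coeff p) (linprod us)"
proof -
  obtain q where q: "p = linprod us * q" using linprod_dvd[OF assms(1,2)] by auto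
  have "degree q = 0"
    using assms(1,3) q by (auto simp: degree_mult_eq)
  then obtain c where "q = [:c:]" by (metis degree_eq_zeroE)
  thus ?thesis using q lead_coeff_linprod[of us] by (simp add: mult.commute)
qed

text \<open>In the degenerate alternative \<open>w\<close> is only the common point; that it is a
  zero of the derivative, and of which order, comes later from \<open>order_pderiv\<close>.\<close>

lemma rolle_or_double:
  fixes p :: "real poly"
  assumes "x \<le> y" "poly p x = 0" "poly p y = 0"
  shows "\<exists>w. x = y \<and> w = x \<or> x < w \<and> w < y \<and> poly (pderiv p) w = 0"
proof (cases "x = y")
  case False
  hence "x < y" using assms by simp
  from poly_MVT[OF this, of p] assms show ?thesis by auto
qed auto

text \<open>One candidate is taken per gap between neighbouring roots. At a root of \<open>p\<close>
  the derivative loses exactly one multiplicity, and so do the candidates at least; elsewhere the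
  candidates lie in disjoint open gaps and are distinct. Four zeros then fill degree 4.\<close>

lemma rolle_quintic:
  fixes u1 :: real
  assumes u: "u1 \<le> u2" "u2 \<le> u3" "u3 \<le> u4" "u4 \<le> u5"
  defines "p \<equiv> linprod [u1, u2, u3, u4, u5]"
  obtains w1 w2 w3 w4 where "u1 \<le> w1" "w1 \<le> u2" "u2 \<le> w2" "w2 \<le> u3" "u3 \<le> w3" "w3 \<le> u4" "u4 \<le> w4" "w4 \<le> u5"
    "pderiv p = smult 5 (linprod [w1, w2, w3, w4])"
proof -
  define d where "d = pderiv p"
  have pz: "poly p x = 0 \<longleftrightarrow> x \<in> {u1, u2, u3, u4, u5}" for x
    unfolding p_def by auto
  have p0: "p \<noteq> 0" unfolding p_def by (rule linprod_nonzero)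
  have deg: "degree p = 5" unfolding p_def by (simp only: degree_linprod) simp
  have lcp: "lead_coeff p = 1" unfolding p_def by (rule lead_coeff_linprod)
  have degd: "degree d = 4" unfolding d_def by (simp add: degree_pderiv deg)
  hence d0: "d \<noteq> 0" by auto
  have lcd: "lead_coeff d = 5"
    using lcp deg by (simp add: degd) (simp add: d_def coeff_pderiv eval_nat_numeral)
  have cp: "order x p = count (mset [u1, u2, u3, u4, u5]) x" for x
    by (metis count_proots p0 p_def proots_linprod)
  have od: "order x p = Suc (order x d)" if "poly p x = 0" for x
    unfolding d_def by (rule order_pderiv[OF p0 that])
  have od1: "order x d \<ge> 1" if "poly d x = 0" for x
    using that d0 by (simp add: order_root Suc_leI)
  obtain w1 where w1: "u1 = u2 \<and> w1 = u1 \<or> u1 < w1 \<and> w1 < u2 \<and> poly d w1 = 0"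
    using rolle_or_double[OF u(1), of p] pz by (auto simp: d_def)
  obtain w2 where w2: "u2 = u3 \<and> w2 = u2 \<or> u2 < w2 \<and> w2 < u3 \<and> poly d w2 = 0"
    using rolle_or_double[OF u(2), of p] pz by (auto simp: d_def)
  obtain w3 where w3: "u3 = u4 \<and> w3 = u3 \<or> u3 < w3 \<and> w3 < u4 \<and> poly d w3 = 0"
    using rolle_or_double[OF u(3), of p] pz by (auto simp: d_def)
  obtain w4 where w4: "u4 = u5 \<and> w4 = u4 \<or> u4 < w4 \<and> w4 < u5 \<and> poly d w4 = 0"
    using rolle_or_double[OF u(4), of p] pz by (auto simp: d_def)
  have "count (mset [w1, w2, w3, w4]) x \<le> count (proots d) x" for x
  proof (cases "poly p x = 0")
    case True
    \<comment> \<open>A candidate equal to a root \<open>x\<close> requires both neighbouring roots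
      to equal \<open>x\<close>, since proper Rolle points lie strictly between roots. So
      \<open>k\<close> candidates at \<open>x\<close> need \<open>k + 1\<close> consecutive roots
      there.\<close>
    have "count (mset [w1, w2, w3, w4]) x + 1 \<le> count (mset [u1, u2, u3, u4, u5]) x"
    proof -
      have "x = u1 \<or> x = u2 \<or> x = u3 \<or> x = u4 \<or> x = u5" using True pz by simp
      moreover have "w1 = x \<Longrightarrow> u1 = x \<and> u2 = x" "w2 = x \<Longrightarrow> u2 = x \<and> u3 = x"
        "w3 = x \<Longrightarrow> u3 = x \<and> u4 = x" "w4 = x \<Longrightarrow> u4 = x \<and> u5 = x"
        using calculation u w1 w2 w3 w4 by linarith+
      ultimately show ?thesis
        by (cases "w1 = x"; cases "w2 = x"; cases "w3 = x"; cases "w4 = x") auto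
    qed
    thus ?thesis using cp[of x] od[OF True] d0 by simp
  next
    case False
    have *: "x \<noteq> u1" "x \<noteq> u2" "x \<noteq> u3" "x \<noteq> u4" using False pz by auto
    have "w1 = x \<Longrightarrow> u1 < x \<and> x < u2 \<and> poly d x = 0" "w2 = x \<Longrightarrow> u2 < x \<and> x < u3 \<and> poly d x = 0"
        "w3 = x \<Longrightarrow> u3 < x \<and> x < u4 \<and> poly d x = 0" "w4 = x \<Longrightarrow> u4 < x \<and> x < u5 \<and> poly d x = 0"
      using * w1 w2 w3 w4 by blast+
    note ** = this
    have "count (mset [w1, w2, w3, w4]) x \<le> 1"
      using ** u by (cases "w1 = x"; cases "w2 = x"; cases "w3 = x"; cases "w4 = x") auto
    moreover have "poly d x = 0" if "x \<in># mset [w1, w2, w3, w4]"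
      using ** that by auto
    ultimately have "x \<in># mset [w1, w2, w3, w4] \<Longrightarrow> count (mset [w1, w2, w3, w4]) x \<le> order x d"
      using od1[of x] le_trans by blast
    thus ?thesis using d0 by (metis count_proots not_in_iff zero_le)
  qed
  hence sub: "mset [w1, w2, w3, w4] \<subseteq># proots d" by (rule mset_subset_eqI)
  have "d = smult 5 (linprod [w1, w2, w3, w4])"
    using linprod_eqI[OF d0 sub] degd lcd by simp
  with w1 w2 w3 w4 show ?thesis
    by (intro that[of w1 w2 w3 w4]) (auto simp: d_def)
qed

lemma monic_quintic_unbounded:
  fixes p :: "real poly"
  assumes "degree p = 5" "lead_coeff p = 1"
  shows "\<exists>x\<le>w. poly p x < 0" "\<exists>x\<ge>w. poly p x > 0"
proof -
  obtain n where n: "\<forall>x\<ge>n. poly p x \<ge> lead_coeff p"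
    using poly_pinfty_gt_lc[of p] assms by auto
  show "\<exists>x\<ge>w. poly p x > 0"
    using n assms by (intro exI[of _ "max n w"]) (auto intro: less_le_trans[of 0 1])
  \<comment> \<open>Reflection and change of sign: odd degree makes \<open>q\<close> monic again, so
    behaviour at minus infinity follows from that at plus infinity.\<close>
  define q where "q = - pcompose p [:0, -1:]"
  have "lead_coeff q = 1"
    unfolding q_def lead_coeff_minus using assms by (subst lead_coeff_comp) auto
  then obtain m where m: "\<forall>x\<ge>m. poly q x \<ge> 1"
    using poly_pinfty_gt_lc[of q] by auto
  show "\<exists>x\<le>w. poly p x < 0"
    using m[rule_format, of "max m (-w)"]
    by (intro exI[of _ "- max m (-w)"]) (auto simp: q_def poly_pcompose)
qed

lemma poly_IVT_weak:
  fixes p :: "real poly"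
  assumes "x \<le> y" "poly p x * poly p y \<le> 0"
  shows "\<exists>u. x \<le> u \<and> u \<le> y \<and> poly p u = 0"
proof -
  have c: "continuous_on {x..y} (poly p)"
    by (intro continuous_at_imp_continuous_on ballI poly_isCont)
  show ?thesis
  proof (cases "poly p x \<le> 0 \<and> 0 \<le> poly p y")
    case True
    thus ?thesis using IVT'[of "poly p" x 0 y] assms c by auto
  next
    case False
    hence "poly p y \<le> 0 \<and> 0 \<le> poly p x" using assms by (auto simp: mult_le_0_iff)
    thus ?thesis using IVT2'[of "poly p" y 0 x] assms c by auto
  qed
qed

text \<open>Converse of \<open>rolle_quintic\<close>: the intermediate value theorem supplies one
  root in each of the five intervals cut out by the critical points. Weak inequalities allow
  coincidences, so the five points must still be shown to be roots with the right
  multiplicity.\<close>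

lemma quintic_of_critical_values:
  fixes p :: "real poly"
  assumes p: "degree p = 5" "lead_coeff p = 1"
    and d: "pderiv p = smult 5 (linprod [w1, w2, w3, w4])"
    and w: "w1 \<le> w2" "w2 \<le> w3" "w3 \<le> w4"
    and v: "poly p w1 \<ge> 0" "poly p w2 \<le> 0" "poly p w3 \<ge> 0" "poly p w4 \<le> 0"
  obtains u1 u2 u3 u4 u5 where "u1 \<le> w1" "w1 \<le> u2" "u2 \<le> w2" "w2 \<le> u3" "u3 \<le> w3" "w3 \<le> u4" "u4 \<le> w4" "w4 \<le> u5"
    "p = linprod [u1, u2, u3, u4, u5]"
proof -
  obtain x where x: "x \<le> w1" "poly p x < 0" using monic_quintic_unbounded(1)[OF p] by blast
  obtain y where y: "y \<ge> w4" "poly p y > 0" using monic_quintic_unbounded(2)[OF p] by blast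
  obtain u1 where u1: "u1 \<le> w1" "poly p u1 = 0"
    using poly_IVT_weak[of x w1 p] x v by (auto simp: mult_le_0_iff)
  obtain u2 where u2: "w1 \<le> u2" "u2 \<le> w2" "poly p u2 = 0"
    using poly_IVT_weak[of w1 w2 p] w v by (auto simp: mult_le_0_iff)
  obtain u3 where u3: "w2 \<le> u3" "u3 \<le> w3" "poly p u3 = 0"
    using poly_IVT_weak[of w2 w3 p] w v by (auto simp: mult_le_0_iff)
  obtain u4 where u4: "w3 \<le> u4" "u4 \<le> w4" "poly p u4 = 0"
    using poly_IVT_weak[of w3 w4 p] w v by (auto simp: mult_le_0_iff)
  obtain u5 where u5: "w4 \<le> u5" "poly p u5 = 0"
    using poly_IVT_weak[of w4 y p] y v by (auto simp: mult_le_0_iff)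
  have p0: "p \<noteq> 0" using p by auto
  have cd: "order x (pderiv p) = count (mset [w1, w2, w3, w4]) x" for x
  proof -
    have "proots (pderiv p) = mset [w1, w2, w3, w4]"
      unfolding d by (metis proots_linprod proots_smult zero_neq_numeral)
    moreover have "pderiv p \<noteq> 0" using p by (simp add: pderiv_eq_0_iff)
    ultimately show ?thesis by (metis count_proots)
  qed
  have "count (mset [u1, u2, u3, u4, u5]) x \<le> count (proots p) x" for x
  proof (cases "x \<in> {u1, u2, u3, u4, u5}")
    case True
    hence "poly p x = 0" using u1 u2 u3 u4 u5 by auto
    hence "order x p = Suc (count (mset [w1, w2, w3, w4]) x)"
      using order_pderiv[OF p0] cd by simp
    \<comment> \<open>Interlacing: two neighbouring \<open>u\<close> equal to \<open>x\<close>
      squeeze the critical point between them to \<open>x\<close>.\<close>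
    moreover have "count (mset [u1, u2, u3, u4, u5]) x \<le> Suc (count (mset [w1, w2, w3, w4]) x)"
      using u1 u2 u3 u4 u5 by auto
    ultimately show ?thesis using p0 by simp
  next
    case False
    thus ?thesis by auto
  qed
  hence "mset [u1, u2, u3, u4, u5] \<subseteq># proots p" by (rule mset_subset_eqI)
  from linprod_eqI[OF p0 this] p have "p = linprod [u1, u2, u3, u4, u5]" by simp
  thus ?thesis using that u1 u2 u3 u4 u5 by blast
qed

section \<open>Newton's identities between coefficients and power sums\<close>

lemma linprod_quintic_coeffs:
  fixes u1 u2 u3 u4 u5 :: "'a::comm_ring_1"
  shows "linprod [u1, u2, u3, u4, u5] =
    [:- (u1*u2*u3*u4*u5),
      u1*u2*u3*u4 + u1*u2*u3*u5 + u1*u2*u4*u5 + u1*u3*u4*u5 + u2*u3*u4*u5,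
      - (u1*u2*u3 + u1*u2*u4 + u1*u2*u5 + u1*u3*u4 + u1*u3*u5 + u1*u4*u5
        + u2*u3*u4 + u2*u3*u5 + u2*u4*u5 + u3*u4*u5),
      u1*u2 + u1*u3 + u1*u4 + u1*u5 + u2*u3 + u2*u4 + u2*u5 + u3*u4 + u3*u5 + u4*u5,
      - (u1 + u2 + u3 + u4 + u5), 1:]"
  by (simp add: linprod_Cons algebra_simps)

lemma P5_eq: "P5 a b c = [:- (c / 5 - a / 6), (1 - 2 * b) / 8, - a / 3, - 1/2, 0, 1:]"
  by (simp add: P5_def Rpoly_def)

lemma newton_linprod:
  fixes u1 u2 u3 u4 u5 :: real
  assumes "linprod [u1, u2, u3, u4, u5] = [:c0, c1, c2, c3, c4, 1:]"
  shows "u1^1 + u2^1 + u3^1 + u4^1 + u5^1 = - c4"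
    "u1^2 + u2^2 + u3^2 + u4^2 + u5^2 = c4^2 - 2 * c3"
    "u1^3 + u2^3 + u3^3 + u4^3 + u5^3 = - (c4^3) + 3 * c4 * c3 - 3 * c2"
    "u1^4 + u2^4 + u3^4 + u4^4 + u5^4 = c4^4 - 4 * c4^2 * c3 + 2 * c3^2 + 4 * c4 * c2 - 4 * c1"
    "u1^5 + u2^5 + u3^5 + u4^5 + u5^5 =
      - (c4^5) + 5 * c4^3 * c3 - 5 * c4 * c3^2 - 5 * c4^2 * c2 + 5 * c3 * c2 + 5 * c4 * c1 - 5 * c0"
proof -
  have c4: "c4 = - (u1 + u2 + u3 + u4 + u5)"
    and c3: "c3 = u1*u2 + u1*u3 + u1*u4 + u1*u5 + u2*u3 + u2*u4 + u2*u5 + u3*u4 + u3*u5 + u4*u5"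
    and c2: "c2 = - (u1*u2*u3 + u1*u2*u4 + u1*u2*u5 + u1*u3*u4 + u1*u3*u5 + u1*u4*u5
        + u2*u3*u4 + u2*u3*u5 + u2*u4*u5 + u3*u4*u5)"
    and c1: "c1 = u1*u2*u3*u4 + u1*u2*u3*u5 + u1*u2*u4*u5 + u1*u3*u4*u5 + u2*u3*u4*u5"
    and c0: "c0 = - (u1*u2*u3*u4*u5)"
    using assms unfolding linprod_quintic_coeffs pCons_eq_iff by (elim conjE; simp only:)+
  show "u1^1 + u2^1 + u3^1 + u4^1 + u5^1 = - c4" by (simp add: c4)
  show "u1^2 + u2^2 + u3^2 + u4^2 + u5^2 = c4^2 - 2 * c3" unfolding c4 c3 by algebra
  show "u1^3 + u2^3 + u3^3 + u4^3 + u5^3 = - (c4^3) + 3 * c4 * c3 - 3 * c2"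
    unfolding c4 c3 c2 by algebra
  show "u1^4 + u2^4 + u3^4 + u4^4 + u5^4 = c4^4 - 4 * c4^2 * c3 + 2 * c3^2 + 4 * c4 * c2 - 4 * c1"
    unfolding c4 c3 c2 c1 by algebra
  show "u1^5 + u2^5 + u3^5 + u4^5 + u5^5 =
      - (c4^5) + 5 * c4^3 * c3 - 5 * c4 * c3^2 - 5 * c4^2 * c2 + 5 * c3 * c2 + 5 * c4 * c1 - 5 * c0"
    unfolding c4 c3 c2 c1 c0 by algebra
qed

text \<open>Newton's identities are triangular: once \<open>c4\<close> and \<open>c3\<close> have
  their prescribed values, each further power sum is affine in one new coefficient and can be solved
  for it.\<close>

lemma P5_eq_linprod_iff:
  fixes u1 u2 u3 u4 u5 :: real
  shows "P5 a b c = linprod [u1, u2, u3, u4, u5] \<longleftrightarrow>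
    u1 + u2 + u3 + u4 + u5 = 0 \<and> u1^2 + u2^2 + u3^2 + u4^2 + u5^2 = 1 \<and>
    u1^3 + u2^3 + u3^3 + u4^3 + u5^3 = a \<and> u1^4 + u2^4 + u3^4 + u4^4 + u5^4 = b \<and>
    u1^5 + u2^5 + u3^5 + u4^5 + u5^5 = c"
proof -
  obtain c0 c1 c2 c3 c4 where Q: "linprod [u1, u2, u3, u4, u5] = [:c0, c1, c2, c3, c4, 1:]"
    using linprod_quintic_coeffs by blast
  note newton = newton_linprod[OF Q, unfolded power_one_right]
  have "P5 a b c = linprod [u1, u2, u3, u4, u5] \<longleftrightarrow>
    c4 = 0 \<and> c3 = - 1/2 \<and> c2 = - a / 3 \<and> c1 = (1 - 2 * b) / 8 \<and> c0 = - (c / 5 - a / 6)"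
    unfolding P5_eq Q by auto
  also have "\<dots> \<longleftrightarrow> - c4 = 0 \<and> c4^2 - 2 * c3 = 1 \<and> - (c4^3) + 3 * c4 * c3 - 3 * c2 = a \<and>
      c4^4 - 4 * c4^2 * c3 + 2 * c3^2 + 4 * c4 * c2 - 4 * c1 = b \<and>
      - (c4^5) + 5 * c4^3 * c3 - 5 * c4 * c3^2 - 5 * c4^2 * c2 + 5 * c3 * c2 + 5 * c4 * c1 - 5 * c0 = c"
  proof (cases "c4 = 0 \<and> c3 = - 1/2")
    case True
    hence c: "c4 = 0" "c3 = - 1/2" by auto
    show ?thesis unfolding c by (auto simp: power2_eq_square field_simps)
  qed auto
  finally show ?thesis unfolding newton .
qed

text \<open>Both sides equal \<open>\<Prod>\<^sub>i P'(u\<^sub>i)\<close>, the resultant of \<open>P\<close> and \<open>P'\<close>.\<close>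

lemma discriminant_critical_values:
  fixes u1 u2 u3 u4 u5 w1 w2 w3 w4 :: "'a::{idom, semiring_char_0}"
  assumes P: "P = linprod [u1, u2, u3, u4, u5]"
    and d: "pderiv P = smult 5 (linprod [w1, w2, w3, w4])"
  shows "(u1 - u2)^2 * (u1 - u3)^2 * (u1 - u4)^2 * (u1 - u5)^2 * (u2 - u3)^2 * (u2 - u4)^2 *
      (u2 - u5)^2 * (u3 - u4)^2 * (u3 - u5)^2 * (u4 - u5)^2
    = 5^5 * (poly P w1 * poly P w2 * poly P w3 * poly P w4)"
proof -
  have d': "poly (pderiv P) z = 5 * ((z - w1) * (z - w2) * (z - w3) * (z - w4))" for z
    unfolding d by (simp add: mult.assoc)
  have P': "poly P z = (z - u1) * (z - u2) * (z - u3) * (z - u4) * (z - u5)" for z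
    unfolding P by (simp add: mult.assoc)
  have "poly (pderiv P) z = (z - u2) * (z - u3) * (z - u4) * (z - u5) +
     (z - u1) * (z - u3) * (z - u4) * (z - u5) + (z - u1) * (z - u2) * (z - u4) * (z - u5) +
     (z - u1) * (z - u2) * (z - u3) * (z - u5) + (z - u1) * (z - u2) * (z - u3) * (z - u4)" for z
    unfolding P linprod_Cons pderiv_mult by (simp add: pderiv_pCons algebra_simps)
  note * = this[unfolded d']
  have 1: "5 * ((u1 - w1) * (u1 - w2) * (u1 - w3) * (u1 - w4)) = (u1 - u2) * (u1 - u3) * (u1 - u4) * (u1 - u5)"
    unfolding * by simp
  have 2: "5 * ((u2 - w1) * (u2 - w2) * (u2 - w3) * (u2 - w4)) = (u2 - u1) * (u2 - u3) * (u2 - u4) * (u2 - u5)"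
    unfolding * by simp
  have 3: "5 * ((u3 - w1) * (u3 - w2) * (u3 - w3) * (u3 - w4)) = (u3 - u1) * (u3 - u2) * (u3 - u4) * (u3 - u5)"
    unfolding * by simp
  have 4: "5 * ((u4 - w1) * (u4 - w2) * (u4 - w3) * (u4 - w4)) = (u4 - u1) * (u4 - u2) * (u4 - u3) * (u4 - u5)"
    unfolding * by simp
  have 5: "5 * ((u5 - w1) * (u5 - w2) * (u5 - w3) * (u5 - w4)) = (u5 - u1) * (u5 - u2) * (u5 - u3) * (u5 - u4)"
    unfolding * by simp
  have sw: "poly P w = - ((u1 - w) * (u2 - w) * (u3 - w) * (u4 - w) * (u5 - w))" for w
    unfolding P' by algebra
  \<comment> \<open>The ten pairs contribute ten signs and the four critical values contribute four
    through \<open>sw\<close>; both numbers are even.\<close>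
  have sq: "(x - y)^2 = - ((x - y) * (y - x))" for x y :: 'a
    by (simp add: power2_eq_square algebra_simps)
  have five: "(5::'a)^5 = 5 * 5 * 5 * 5 * 5" by simp
  have "5^5 * (poly P w1 * poly P w2 * poly P w3 * poly P w4) =
    (5 * ((u1 - w1) * (u1 - w2) * (u1 - w3) * (u1 - w4))) * (5 * ((u2 - w1) * (u2 - w2) * (u2 - w3) * (u2 - w4))) *
    (5 * ((u3 - w1) * (u3 - w2) * (u3 - w3) * (u3 - w4))) * (5 * ((u4 - w1) * (u4 - w2) * (u4 - w3) * (u4 - w4))) *
    (5 * ((u5 - w1) * (u5 - w2) * (u5 - w3) * (u5 - w4)))"
    unfolding sw five minus_mult_minus
    by (simp only: mult.left_commute mult.commute mult.assoc mult_minus_left mult_minus_right minus_minus)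
  also have "\<dots> = (u1 - u2)^2 * (u1 - u3)^2 * (u1 - u4)^2 * (u1 - u5)^2 * (u2 - u3)^2 * (u2 - u4)^2 *
      (u2 - u5)^2 * (u3 - u4)^2 * (u3 - u5)^2 * (u4 - u5)^2"
    unfolding 1 2 3 4 5 sq
    by (simp only: mult.left_commute mult.commute mult.assoc mult_minus_left mult_minus_right minus_minus)
  finally show ?thesis by simp
qed

subsection \<open>Change of variables\<close>

text \<open>The formula for finite measures is applied on bounded pieces where the Jacobian is
  bounded as well; monotone convergence removes both bounds.\<close>

lemma emeasure_inj_differentiable_image:
  fixes g :: "real^'n::{finite,wellorder} \<Rightarrow> real^'n::_"
  assumes T [measurable]: "T \<in> sets borel"
    and der: "\<And>x. x \<in> T \<Longrightarrow> (g has_derivative g' x) (at x)"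
    and J [measurable]: "J \<in> borel_measurable borel"
    and J': "\<And>x. x \<in> T \<Longrightarrow> J x = \<bar>det (matrix (g' x))\<bar>"
    and inj: "inj_on g T"
  shows "emeasure lebesgue (g ` T) = (\<integral>\<^sup>+x. ennreal (J x) * indicator T x \<partial>lborel)"
proof -
  define U where "U n = T \<inter> {x. \<bar>J x\<bar> \<le> real n} \<inter> ball 0 (real n)" for n
  have U [measurable]: "U n \<in> sets borel" for n
    unfolding U_def by measurable
  have UT: "U n \<subseteq> T" for n by (auto simp: U_def)
  have *: "g ` U n \<in> lmeasurable \<and>
    emeasure lebesgue (g ` U n) = (\<integral>\<^sup>+x. ennreal (J x) * indicator (U n) x \<partial>lborel)" for n
  proof -
    have Jn: "J x \<ge> 0" if "x \<in> U n" for x using J' UT that by fastforce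
    have "(\<integral>\<^sup>+x. ennreal (J x * indicator (U n) x) \<partial>lborel) \<le>
      (\<integral>\<^sup>+x. ennreal (real n) * indicator (ball (0::real^'n::{finite,wellorder}) (real n)) x \<partial>lborel)"
      by (intro nn_integral_mono) (auto simp: U_def indicator_def intro!: ennreal_leI)
    also have "\<dots> < \<infinity>"
      using emeasure_bounded_finite[OF bounded_ball[of "0::real^'n::{finite,wellorder}" "real n"]]
      by (simp add: nn_integral_cmult_indicator ennreal_mult_less_top)
    finally obtain I where I: "I \<ge> 0" "(\<integral>\<^sup>+x. ennreal (J x * indicator (U n) x) \<partial>lborel) = ennreal I"
      by (metis ennreal_cases infinity_ennreal_def less_irrefl)
    have "((\<lambda>x. J x * indicator (U n) x) has_integral I) UNIV"
      using I Jn by (intro nn_integral_has_integral) (auto simp: indicator_def)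
    moreover have "(\<lambda>x. J x * indicator (U n) x) = (\<lambda>x. if x \<in> U n then \<bar>det (matrix (g' x))\<bar> else 0)"
      using J' UT by (auto simp: fun_eq_iff indicator_def)
    ultimately have "((\<lambda>x. \<bar>det (matrix (g' x))\<bar>) has_integral I) (U n)"
      by (simp add: has_integral_restrict_UNIV)
    hence "g ` U n \<in> lmeasurable \<and> measure lebesgue (g ` U n) = I"
      using has_measure_differentiable_image[of "U n" g g' I] UT der inj_on_subset[OF inj UT]
      by (metis U has_derivative_at_withinI sets_completionI_sets sets_lborel subsetD)
    moreover have "(\<integral>\<^sup>+x. ennreal (J x) * indicator (U n) x \<partial>lborel) = ennreal I"
      unfolding I(2)[symmetric] by (intro nn_integral_cong) (auto simp: indicator_def)
    ultimately show ?thesis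
      by (simp add: emeasure_eq_measure2)
  qed
  have inc: "incseq U"
    by (auto simp: incseq_def U_def)
  have un: "(\<Union>n. U n) = T"
  proof -
    have "x \<in> (\<Union>n. U n)" if "x \<in> T" for x
    proof -
      obtain n where "real n > max \<bar>J x\<bar> (norm x)" using reals_Archimedean2 by blast
      thus ?thesis using that by (intro UN_I[of n]) (auto simp: U_def)
    qed
    thus ?thesis using UT by auto
  qed
  have "emeasure lebesgue (g ` T) = (SUP n. emeasure lebesgue (g ` U n))"
  proof -
    have "(SUP n. emeasure lebesgue (g ` U n)) = emeasure lebesgue (\<Union>n. g ` U n)"
    proof (rule SUP_emeasure_incseq)
      show "range (\<lambda>n. g ` U n) \<subseteq> sets lebesgue" using * by (auto dest: fmeasurableD)
      show "incseq (\<lambda>n. g ` U n)" using inc unfolding incseq_def by (blast intro: image_mono)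
    qed
    thus ?thesis by (simp add: un[symmetric] image_UN)
  qed
  also have "\<dots> = (SUP n. emeasure (density lborel J) (U n))"
    using * by (simp add: emeasure_density)
  also have "\<dots> = emeasure (density lborel J) (\<Union>n. U n)"
    using inc by (intro SUP_emeasure_incseq) auto
  finally show ?thesis by (simp add: un emeasure_density)
qed

text \<open>Pushing the measure with density \<open>J\<close> on \<open>S\<close> forward along
  \<open>g\<close> gives Lebesgue measure on the image. On a Borel set \<open>B\<close> this is the
  volume formula for the part of \<open>S\<close> mapped into \<open>B\<close>; integrating
  \<open>F\<close> against both measures gives the claim.\<close>

lemma nn_integral_inj_change_of_variables:
  fixes g :: "real^'n::{finite,wellorder} \<Rightarrow> real^'n::_"
  assumes S [measurable]: "S \<in> sets borel" and gS [measurable]: "g ` S \<in> sets borel"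
    and g [measurable]: "g \<in> borel_measurable borel"
    and der: "\<And>x. x \<in> S \<Longrightarrow> (g has_derivative g' x) (at x)"
    and J [measurable]: "J \<in> borel_measurable borel"
    and J': "\<And>x. x \<in> S \<Longrightarrow> J x = \<bar>det (matrix (g' x))\<bar>"
    and inj: "inj_on g S"
    and F: "F \<in> borel_measurable borel"
  shows "(\<integral>\<^sup>+x. F (g x) * ennreal (J x) * indicator S x \<partial>lborel) = (\<integral>\<^sup>+y. F y * indicator (g ` S) y \<partial>lborel)"
proof -
  have eq: "distr (density lborel (\<lambda>x. ennreal (J x) * indicator S x)) borel g
    = density lborel (indicator (g ` S))" (is "?M = ?N")
  proof (rule measure_eqI)
    fix B assume "B \<in> sets ?M"
    hence B [measurable]: "B \<in> sets borel" by simp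
    define T where "T = S \<inter> g -` B"
    have gB: "g -` B \<in> sets borel" using measurable_sets[OF g B] by simp
    have T: "T \<in> sets borel" unfolding T_def using S gB by (rule sets.Int)
    have "emeasure ?M B = emeasure (density lborel (\<lambda>x. ennreal (J x) * indicator S x)) (g -` B)"
      by (simp add: emeasure_distr)
    also have "\<dots> = (\<integral>\<^sup>+x. ennreal (J x) * indicator S x * indicator (g -` B) x \<partial>lborel)"
      using gB by (subst emeasure_density) auto
    also have "\<dots> = (\<integral>\<^sup>+x. ennreal (J x) * indicator T x \<partial>lborel)"
      by (intro nn_integral_cong) (auto simp: indicator_def T_def)
    also have "\<dots> = emeasure lebesgue (g ` T)"
      using T der J' inj_on_subset[OF inj] by (subst emeasure_inj_differentiable_image[where g'=g']) (auto simp: T_def)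
    also have "g ` T = g ` S \<inter> B" by (auto simp: T_def)
    also have "emeasure lebesgue \<dots> = emeasure lborel (g ` S \<inter> B)"
      by (simp add: sets.Int)
    also have "\<dots> = emeasure ?N B"
      by (simp add: emeasure_density indicator_inter_arith[symmetric])
    finally show "emeasure ?M B = emeasure ?N B" .
  qed simp
  have "(\<integral>\<^sup>+x. F (g x) * ennreal (J x) * indicator S x \<partial>lborel) = (\<integral>\<^sup>+y. F y \<partial>?M)"
    using F by (simp add: nn_integral_distr nn_integral_density mult_ac)
  also have "\<dots> = (\<integral>\<^sup>+y. F y * indicator (g ` S) y \<partial>lborel)"
    unfolding eq using F by (simp add: nn_integral_density mult_ac)
  finally show ?thesis .
qed

subsection \<open>Vectors indexed by the type 5\<close>

lemma exhaust_5: "x = 0 \<or> x = 1 \<or> x = 2 \<or> x = 3 \<or> x = 4" for x :: 5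
proof (induct x)
  case (of_int z)
  then have "z = 0 \<or> z = 1 \<or> z = 2 \<or> z = 3 \<or> z = 4" by fastforce
  then show ?case by auto
qed

lemma UNIV_5: "UNIV = {0, 1, 2, 3, 4 :: 5}"
  using exhaust_5 by auto

lemma forall_5: "(\<forall>i::5. P i) \<longleftrightarrow> P 0 \<and> P 1 \<and> P 2 \<and> P 3 \<and> P 4"
  by (metis exhaust_5)

lemma sum_5: "sum f (UNIV :: 5 set) = f 0 + f 1 + f 2 + f 3 + f 4"
  unfolding UNIV_5 by (simp add: ac_simps)

lemma prod_5: "prod f (UNIV :: 5 set) = f 0 * f 1 * f 2 * f 3 * f 4"
  unfolding UNIV_5 by (simp add: ac_simps)

text \<open>The order of the index type enters through the determinants of triangular
  matrices.\<close>

lemma less_5 [simp]: "(0::5) < 1" "(1::5) < 2" "(2::5) < 3" "(3::5) < 4"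
  "(0::5) < 2" "(0::5) < 3" "(0::5) < 4" "(1::5) < 3" "(1::5) < 4" "(2::5) < 4"
  by (simp_all add: less_bit1_def bit1.Rep_numeral bit1.Rep_0 bit1.Rep_1)

lemma not_less_5 [simp]: "\<not> (1::5) < 0" "\<not> (2::5) < 1" "\<not> (3::5) < 2" "\<not> (4::5) < 3"
  "\<not> (2::5) < 0" "\<not> (3::5) < 0" "\<not> (4::5) < 0" "\<not> (3::5) < 1" "\<not> (4::5) < 1" "\<not> (4::5) < 2"
  using less_5 less_asym by blast+

text \<open>Serves both as a position in a list and as the exponent left after differentiation:
  component \<open>i\<close> of the power sum map has exponent \<open>idx5 i + 1\<close>.\<close>

definition idx5 :: "5 \<Rightarrow> nat" where
  "idx5 i = nat (Rep_bit1 i)"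

lemma idx5_simps [simp]: "idx5 0 = 0" "idx5 1 = 1" "idx5 2 = 2" "idx5 3 = 3" "idx5 4 = 4"
  by (simp_all add: idx5_def bit1.Rep_numeral bit1.Rep_0 bit1.Rep_1)

definition vec5 :: "'a \<Rightarrow> 'a \<Rightarrow> 'a \<Rightarrow> 'a \<Rightarrow> 'a \<Rightarrow> 'a^5" where
  "vec5 a b c d e = (\<chi> i. [a, b, c, d, e] ! idx5 i)"

lemma vec5_simps [simp]:
  "vec5 a b c d e $ 0 = a" "vec5 a b c d e $ 1 = b" "vec5 a b c d e $ 2 = c"
  "vec5 a b c d e $ 3 = d" "vec5 a b c d e $ 4 = e"
  by (simp_all add: vec5_def)

subsection \<open>The power sum map\<close>

definition psums :: "real^5 \<Rightarrow> real^5" where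
  "psums x = vec5 (psum 1 x) (psum 2 x) (psum 3 x) (psum 4 x) (psum 5 x)"

definition chamber :: "(real^5) set" where
  "chamber = {x. x $ 0 < x $ 1 \<and> x $ 1 < x $ 2 \<and> x $ 2 < x $ 3 \<and> x $ 3 < x $ 4}"

definition vdm :: "real^5 \<Rightarrow> real" where
  "vdm x = (x$1 - x$0) * ((x$2 - x$0) * (x$2 - x$1)) * ((x$3 - x$0) * (x$3 - x$1) * (x$3 - x$2)) *
    ((x$4 - x$0) * (x$4 - x$1) * (x$4 - x$2) * (x$4 - x$3))"

definition dpsums :: "real^5 \<Rightarrow> real^5 \<Rightarrow> real^5" where
  "dpsums x h = (\<chi> i. \<Sum>j\<in>UNIV. real (Suc (idx5 i)) * x $ j ^ idx5 i * h $ j)"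

lemma psums_nth: "psums x $ i = psum (Suc (idx5 i)) x"
  using exhaust_5[of i] by (auto simp: psums_def eval_nat_numeral)

lemma psums_has_derivative: "(psums has_derivative dpsums x) (at x)"
proof -
  have "((\<lambda>x. psums x \<bullet> b) has_derivative (\<lambda>h. dpsums x h \<bullet> b)) (at x)" if b: "b \<in> Basis" for b
  proof -
    obtain i where i: "b = axis i 1" using b by (auto simp: Basis_vec_def)
    have "((\<lambda>x. \<Sum>j\<in>UNIV. x $ j ^ Suc n) has_derivative
        (\<lambda>h. \<Sum>j\<in>UNIV. real (Suc n) * x $ j ^ n * h $ j)) (at x)" for n
    proof (rule has_derivative_sum)
      fix j :: 5
      show "((\<lambda>x. x $ j ^ Suc n) has_derivative (\<lambda>h. real (Suc n) * x $ j ^ n * h $ j)) (at x)"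
        using has_derivative_power[OF bounded_linear.has_derivative[OF bounded_linear_vec_nth[of j] has_derivative_ident[of "at x"]],
          of "Suc n"]
        by (simp add: mult_ac del: of_nat_Suc power_Suc)
    qed
    thus ?thesis
      by (simp add: i inner_axis psums_nth[abs_def] dpsums_def psum_def)
  qed
  thus ?thesis by (subst has_derivative_componentwise_within) auto
qed

text \<open>Left multiplication by a triangular matrix turns the Jacobian into the upper triangular matrix
  with entries \<open>\<Prod>\<^bsub>l<r\<^esub> (x\<^sub>j - x\<^sub>l)\<close>.\<close>

lemma det_dpsums: "det (matrix (dpsums x)) = 120 * vdm x"
proof -
  define M where "M = matrix (dpsums x)"
  have M: "M $ i $ j = real (Suc (idx5 i)) * x $ j ^ idx5 i" for i j
  proof -
    have "M $ i $ j = (\<Sum>k\<in>UNIV. real (Suc (idx5 i)) * x $ k ^ idx5 i * (if j = k then 1 else 0))"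
      by (simp add: M_def matrix_def dpsums_def axis_def eq_commute)
    thus ?thesis by (simp add: if_distrib cong: if_cong)
  qed
  \<comment> \<open>Row \<open>r\<close> holds the coefficients of the product of the first
    \<open>r\<close> factors \<open>z - x$l\<close>; column \<open>k\<close> is divided by
    \<open>k + 1\<close>, the factor that differentiation put into row \<open>k\<close> of
    \<open>M\<close>. Hence the diagonal 1, 1/2, ..., 1/5.\<close>
  define N :: "real^5^5" where "N = vec5
    (vec5 1 0 0 0 0)
    (vec5 (- x$0) (1/2) 0 0 0)
    (vec5 (x$0 * x$1) (- (x$0 + x$1) / 2) (1/3) 0 0)
    (vec5 (- (x$0 * x$1 * x$2)) ((x$0 * x$1 + x$0 * x$2 + x$1 * x$2) / 2) (- (x$0 + x$1 + x$2) / 3) (1/4) 0)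
    (vec5 (x$0 * x$1 * x$2 * x$3)
      (- (x$0 * x$1 * x$2 + x$0 * x$1 * x$3 + x$0 * x$2 * x$3 + x$1 * x$2 * x$3) / 2)
      ((x$0 * x$1 + x$0 * x$2 + x$0 * x$3 + x$1 * x$2 + x$1 * x$3 + x$2 * x$3) / 3)
      (- (x$0 + x$1 + x$2 + x$3) / 4) (1/5))"
  define U :: "real^5^5" where "U = vec5 (\<chi> j. 1) (\<chi> j. x$j - x$0) (\<chi> j. (x$j - x$0) * (x$j - x$1))
    (\<chi> j. (x$j - x$0) * (x$j - x$1) * (x$j - x$2))
    (\<chi> j. (x$j - x$0) * (x$j - x$1) * (x$j - x$2) * (x$j - x$3))"
  have "(N ** M) $ i $ j = U $ i $ j" for i j
    using exhaust_5[of i]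
    by (elim disjE) (simp_all add: matrix_matrix_mult_def sum_5 M N_def U_def field_simps power_numeral_reduce)
  hence NM: "N ** M = U" by (simp add: vec_eq_iff)
  have "det N = N$0$0 * N$1$1 * N$2$2 * N$3$3 * N$4$4"
    unfolding prod_5[of "\<lambda>i. N $ i $ i", symmetric]
  proof (rule det_lowerdiagonal)
    fix i j :: 5 assume "i < j"
    thus "N $ i $ j = 0"
      using exhaust_5[of i] exhaust_5[of j] by (elim disjE) (simp_all add: N_def)
  qed
  hence N: "det N = 1 / 120" by (simp add: N_def)
  have "det U = U$0$0 * U$1$1 * U$2$2 * U$3$3 * U$4$4"
    unfolding prod_5[of "\<lambda>i. U $ i $ i", symmetric]
  proof (rule det_upperdiagonal)
    fix i j :: 5 assume "j < i"
    thus "U $ i $ j = 0"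
      using exhaust_5[of i] exhaust_5[of j] by (elim disjE) (simp_all add: U_def)
  qed
  hence "det U = vdm x" by (simp add: U_def vdm_def)
  moreover have "det U = det N * det M" unfolding NM[symmetric] by (rule det_mul)
  ultimately show ?thesis using N by (simp add: M_def)
qed

lemma open_chamber: "open chamber"
  unfolding chamber_def by (intro open_Collect_conj open_Collect_less continuous_intros)

lemma vdm_pos: "x \<in> chamber \<Longrightarrow> vdm x > 0"
  unfolding chamber_def vdm_def by (auto intro!: mult_pos_pos)

lemma continuous_on_psums: "continuous_on A psums"
  using psums_has_derivative by (meson continuous_at_imp_continuous_on has_derivative_continuous)

lemma continuous_on_vdm: "continuous_on A vdm"
  unfolding vdm_def by (intro continuous_intros)

lemma psum_5: "psum r x = x$0^r + x$1^r + x$2^r + x$3^r + x$4^r"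
  by (simp add: psum_def sum_5)

lemma psums_eq_vec5_iff:
  "psums x = vec5 s1 s2 s3 s4 s5 \<longleftrightarrow>
    psum 1 x = s1 \<and> psum 2 x = s2 \<and> psum 3 x = s3 \<and> psum 4 x = s4 \<and> psum 5 x = s5"
  by (simp add: psums_def vec_eq_iff forall_5)

text \<open>Newton's identities are solved from the top coefficient downwards, each power sum fixing
  the next coefficient.\<close>

lemma linprod_eq_of_psums_eq:
  assumes "psums x = psums y"
  shows "linprod [x$0, x$1, x$2, x$3, x$4] = linprod [y$0, y$1, y$2, y$3, y$4]"
proof -
  define e where "e z k = coeff (linprod [z$0, z$1, z$2, z$3, z$4]) k" for k and z :: "real^5"
  have p: "psum r x = psum r y" if "r \<in> {1,2,3,4,5}" for r
    using assms that unfolding psums_def[of y] psums_eq_vec5_iff by blast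
  have e: "linprod [z$0, z$1, z$2, z$3, z$4] = [:e z 0, e z 1, e z 2, e z 3, e z 4, 1:]" for z
    unfolding e_def linprod_quintic_coeffs by (simp add: eval_nat_numeral)
  note newton = newton_linprod[OF e, folded psum_5]
  have e4: "e x 4 = e y 4" using p[of 1] newton(1) by simp
  have e3: "e x 3 = e y 3" using p[of 2] e4 newton(2) by simp
  have e2: "e x 2 = e y 2" using p[of 3] e4 e3 newton(3) by simp
  have e1: "e x 1 = e y 1" using p[of 4] e4 e3 e2 newton(4) by simp
  have e0: "e x 0 = e y 0" using p[of 5] e4 e3 e2 e1 newton(5) by simp
  show ?thesis
    using e0 e1 e2 e3 e4 unfolding e by simp
qed

lemma inj_on_psums: "inj_on psums chamber"
proof (rule inj_onI)
  fix x y assume x: "x \<in> chamber" and y: "y \<in> chamber" and eq: "psums x = psums y"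
  have "mset [x$0, x$1, x$2, x$3, x$4] = mset [y$0, y$1, y$2, y$3, y$4]"
    using linprod_eq_of_psums_eq[OF eq] by (metis proots_linprod)
  moreover have "sorted [x$0, x$1, x$2, x$3, x$4]" "sorted [y$0, y$1, y$2, y$3, y$4]"
    using x y by (simp_all add: chamber_def)
  ultimately have "[x$0, x$1, x$2, x$3, x$4] = [y$0, y$1, y$2, y$3, y$4]"
    by (metis properties_for_sort)
  thus "x = y" by (simp add: vec_eq_iff forall_5)
qed

text \<open>A total inverse of the power sum map. The image of the chamber is open and the inverse
  continuous there, so a constant default elsewhere yields a Borel function.\<close>

definition rootvec :: "real^5 \<Rightarrow> real^5" where
  "rootvec p = (if p \<in> psums ` chamber then inv_into chamber psums p else 0)"

text \<open>The reciprocal square root of the discriminant on power sums of five distinct reals.\<close>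

definition rdens :: "real^5 \<Rightarrow> ennreal" where
  "rdens p = indicator (psums ` chamber) p * ennreal (1 / vdm (rootvec p))"

lemma open_psums_chamber: "open (psums ` chamber)"
  using open_chamber continuous_on_psums inj_on_psums by (intro invariance_of_domain)

lemma psums_chamber_borel [measurable]: "psums ` chamber \<in> sets borel"
  using open_psums_chamber by simp

lemma rootvec_psums: "x \<in> chamber \<Longrightarrow> rootvec (psums x) = x"
  using inj_on_psums by (simp add: rootvec_def)

lemma rootvec_borel [measurable]: "rootvec \<in> borel_measurable borel"
proof -
  have "continuous_on (psums ` chamber) (inv_into chamber psums)"
    using open_chamber continuous_on_psums inj_on_psums by (intro continuous_on_inverse_open) auto
  hence "(\<lambda>p. indicator (psums ` chamber) p *\<^sub>R inv_into chamber psums p) \<in> borel_measurable borel"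
    by (intro borel_measurable_continuous_on_indicator) auto
  also have "(\<lambda>p. indicator (psums ` chamber) p *\<^sub>R inv_into chamber psums p) = rootvec"
    by (auto simp: rootvec_def indicator_def fun_eq_iff)
  finally show ?thesis .
qed

lemma vdm_borel [measurable]: "vdm \<in> borel_measurable borel"
  by (rule borel_measurable_continuous_onI[OF continuous_on_vdm])

lemma psums_borel [measurable]: "psums \<in> borel_measurable borel"
  by (rule borel_measurable_continuous_onI[OF continuous_on_psums])

lemma rdens_borel [measurable]: "rdens \<in> borel_measurable borel"
  unfolding rdens_def by measurable

lemma chamber_borel [measurable]: "chamber \<in> sets borel"
  using open_chamber by simp

text \<open>The Jacobian \<open>120 * vdm\<close> meets the weight \<open>1 / vdm\<close> hidden in
  \<open>rdens\<close>. The surviving 120 stands on the left, where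
  \<open>nn_integral_symmetric\<close> absorbs it.\<close>

lemma nn_integral_chamber:
  assumes [measurable]: "\<Psi> \<in> borel_measurable borel"
  shows "120 * (\<integral>\<^sup>+x. \<Psi> x * indicator chamber x \<partial>lborel) = (\<integral>\<^sup>+p. \<Psi> (rootvec p) * rdens p \<partial>lborel)"
proof -
  have "(\<integral>\<^sup>+p. \<Psi> (rootvec p) * rdens p \<partial>lborel)
      = (\<integral>\<^sup>+p. (\<Psi> (rootvec p) * ennreal (1 / vdm (rootvec p))) * indicator (psums ` chamber) p \<partial>lborel)"
    by (intro nn_integral_cong) (auto simp: rdens_def mult_ac)
  also have "\<dots> = (\<integral>\<^sup>+x. (\<Psi> (rootvec (psums x)) * ennreal (1 / vdm (rootvec (psums x)))) *
      ennreal \<bar>120 * vdm x\<bar> * indicator chamber x \<partial>lborel)"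
    by (intro nn_integral_inj_change_of_variables[symmetric, where g' = dpsums])
      (auto simp: psums_has_derivative det_dpsums inj_on_psums)
  also have "\<dots> = (\<integral>\<^sup>+x. 120 * (\<Psi> x * indicator chamber x) \<partial>lborel)"
  proof (intro nn_integral_cong)
    fix x
    show "\<Psi> (rootvec (psums x)) * ennreal (1 / vdm (rootvec (psums x))) * ennreal \<bar>120 * vdm x\<bar> * indicator chamber x =
      120 * (\<Psi> x * indicator chamber x)"
    proof (cases "x \<in> chamber")
      case True
      have "ennreal (1 / vdm x) * ennreal \<bar>120 * vdm x\<bar> = ennreal (1 / vdm x * \<bar>120 * vdm x\<bar>)"
        using vdm_pos[OF True] by (subst ennreal_mult) auto
      also have "1 / vdm x * \<bar>120 * vdm x\<bar> = 120"
        using vdm_pos[OF True] by simp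
      finally show ?thesis
        using True by (simp add: rootvec_psums mult_ac)
    qed auto
  qed
  also have "\<dots> = 120 * (\<integral>\<^sup>+x. \<Psi> x * indicator chamber x \<partial>lborel)"
    by (intro nn_integral_cmult) auto
  finally show ?thesis by simp
qed

subsection \<open>Symmetric integrands\<close>

definition perm5 :: "(5 \<Rightarrow> 5) \<Rightarrow> real^5 \<Rightarrow> real^5" where
  "perm5 p x = (\<chi> i. x $ p i)"

lemma perm5_borel [measurable]: "perm5 p \<in> borel_measurable borel"
  unfolding perm5_def by (intro borel_measurable_continuous_onI continuous_intros)

lemma distr_lborel_perm5:
  assumes p: "p permutes UNIV"
  shows "distr lborel borel (perm5 p) = lborel"
proof (rule lborel_eqI[symmetric])
  fix l u :: "real^5" assume le: "\<And>b. b \<in> Basis \<Longrightarrow> l \<bullet> b \<le> u \<bullet> b"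
  have le': "l $ i \<le> u $ i" for i using le[of "axis i 1"] by (simp add: inner_axis)
  define q where "q = inv p"
  have pq: "p (q i) = i" "q (p i) = i" for i
    unfolding q_def using p by (auto simp: permutes_inverses)
  have q: "bij q" unfolding q_def using p by (simp add: permutes_bij bij_imp_bij_inv)
  have "perm5 p -` box l u = box (perm5 q l) (perm5 q u)"
    unfolding perm5_def by (auto simp: mem_box_cart) (metis pq)+
  hence "emeasure (distr lborel borel (perm5 p)) (box l u) = emeasure lborel (box (perm5 q l) (perm5 q u))"
    by (simp add: emeasure_distr)
  also have "\<dots> = (\<Prod>b\<in>Basis. (perm5 q u - perm5 q l) \<bullet> b)"
    using le' by (intro emeasure_lborel_box) (auto simp: perm5_def inner_axis Basis_vec_def)
  also have "(\<Prod>b\<in>Basis. (z :: real^5) \<bullet> b) = (\<Prod>i\<in>UNIV. z $ i)" for z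
    by (simp add: Basis_vec_def UNION_singleton_eq_range prod.reindex inj_on_def axis_eq_axis inner_axis)
  note this[of "perm5 q u - perm5 q l"]
  also have "(\<Prod>i\<in>UNIV. (perm5 q u - perm5 q l) $ i) = (\<Prod>i\<in>UNIV. (u - l) $ i)"
    using prod.reindex_bij_betw[OF q, of "\<lambda>i. (u - l) $ i"] by (simp add: perm5_def)
  also have "\<dots> = (\<Prod>b\<in>Basis. (u - l) \<bullet> b)"
    by (simp add: Basis_vec_def UNION_singleton_eq_range prod.reindex inj_on_def axis_eq_axis inner_axis)
  finally show "emeasure (distr lborel borel (perm5 p)) (box l u) = (\<Prod>b\<in>Basis. (u - l) \<bullet> b)" .
qed simp

lemma chamber_iff: "x \<in> chamber \<longleftrightarrow> sorted_wrt (<) (map (\<lambda>i. x $ i) [0, 1, 2, 3, 4])"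
  by (auto simp: chamber_def)

lemma chamber_less: "x \<in> chamber \<Longrightarrow> i < j \<Longrightarrow> x $ i < x $ j"
  using exhaust_5[of i] exhaust_5[of j] by (elim disjE) (simp_all add: chamber_def)

lemma sorting_permutation:
  fixes x :: "real^5"
  assumes inj: "inj (\<lambda>i. x $ i)"
  shows "\<exists>!p. p permutes UNIV \<and> perm5 p x \<in> chamber"
proof (rule ex_ex1I)
  define R where "R = range (\<lambda>i. x $ i)"
  define s where "s = sorted_list_of_set R"
  have "card R = 5" unfolding R_def using inj by (simp add: card_image)
  hence "length s = 5" unfolding s_def by simp
  then obtain a b c d e where abc: "s = [a, b, c, d, e]"
    by (auto simp: numeral_eq_Suc length_Suc_conv)
  have set_s: "set s = R" "sorted_wrt (<) s" unfolding s_def by (simp_all add: R_def)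
  hence "{a, b, c, d, e} \<subseteq> R" by (auto simp: abc)
  then obtain a' b' c' d' e' where abc': "a = x $ a'" "b = x $ b'" "c = x $ c'" "d = x $ d'" "e = x $ e'"
    unfolding R_def by auto
  \<comment> \<open>The permutation is tabulated as a vector of indices, whose entry
    \<open>i\<close> says where the value of rank \<open>i\<close> sits in \<open>x\<close>.\<close>
  define p where "p i = (vec5 a' b' c' d' e' :: 5^5) $ i" for i
  have ch: "perm5 p x \<in> chamber"
    using set_s(2) unfolding abc by (simp add: chamber_def perm5_def p_def abc')
  have "inj p"
  proof (rule injI)
    fix i j assume "p i = p j"
    hence "perm5 p x $ i = perm5 p x $ j" by (simp add: perm5_def)
    thus "i = j" using chamber_less[OF ch, of i j] chamber_less[OF ch, of j i] by (cases i j rule: linorder_cases) auto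
  qed
  hence "bij p" by (simp add: finite_UNIV_inj_surj bij_def)
  hence "p permutes UNIV" by (intro bij_imp_permutes) auto
  with ch show "\<exists>p. p permutes UNIV \<and> perm5 p x \<in> chamber" by blast
next
  fix p q assume p: "p permutes UNIV \<and> perm5 p x \<in> chamber" and q: "q permutes UNIV \<and> perm5 q x \<in> chamber"
  define l where "l r = map (\<lambda>i. perm5 r x $ i) [0, 1, 2, 3, 4]" for r
  have s: "set (l r) = range (\<lambda>i. x $ i)" if "r permutes UNIV" for r
  proof -
    have "set (l r) = (\<lambda>i. x $ r i) ` UNIV" unfolding UNIV_5 l_def by (simp add: perm5_def)
    also have "\<dots> = (\<lambda>i. x $ i) ` range r" by auto
    finally show ?thesis using permutes_surj[OF that] by simp
  qed
  have "sorted_wrt (<) (l p)" "sorted_wrt (<) (l q)"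
    using p q unfolding chamber_iff l_def by blast+
  moreover have "set (l q) = set (l p)" using p q s by blast
  ultimately have "l p = l q" by (rule strict_sorted_equal[symmetric])
  hence "x $ p i = x $ q i" for i
    using exhaust_5[of i] by (elim disjE) (simp_all add: l_def perm5_def)
  hence "p i = q i" for i using inj by (auto dest: injD)
  thus "p = q" by auto
qed

lemma AE_distinct_coordinates: "AE x in lborel. inj (\<lambda>i. (x :: real^5) $ i)"
proof -
  have "AE x in lborel. (x :: real^5) $ i \<noteq> x $ j" if "i \<noteq> j" for i j
  proof (rule AE_I')
    have ne: "axis i (1::real) - axis j 1 \<noteq> (0 :: real^5)" using that by (simp add: axis_eq_axis)
    have "{x :: real^5. x $ i = x $ j} = {x. (axis i 1 - axis j 1) \<bullet> x = 0}"
      by (auto simp: inner_diff_left inner_axis' )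
    hence "negligible {x :: real^5. x $ i = x $ j}"
      using negligible_hyperplane[of "axis i 1 - axis j 1" 0] ne by simp
    moreover have "closed {x :: real^5. x $ i = x $ j}"
      by (intro closed_Collect_eq continuous_intros)
    ultimately show "{x :: real^5. x $ i = x $ j} \<in> null_sets lborel"
      by (simp add: negligible_iff_null_sets null_sets_def)
  qed auto
  hence "AE x in lborel. \<forall>(i, j) \<in> {(i, j). i \<noteq> j}. (x :: real^5) $ i \<noteq> x $ j"
    by (intro AE_finite_allI) auto
  thus ?thesis by (rule AE_mp) (auto intro!: AE_I2 injI)
qed

lemma CARD_5: "CARD(5) = 5" by simp

lemma fact_5: "fact 5 = (120 :: nat)" by (simp add: fact_numeral)

text \<open>Almost every \<open>x\<close> has distinct coordinates and is brought into the chamber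
  by exactly one permutation, so the integrand is a sum over permutations with one nonzero
  indicator. Invariance of Lebesgue measure makes all summands integrate to the same value.\<close>

lemma nn_integral_symmetric:
  assumes [measurable]: "\<Psi> \<in> borel_measurable borel"
    and sym: "\<And>p x. p permutes UNIV \<Longrightarrow> \<Psi> (perm5 p x) = \<Psi> x"
  shows "(\<integral>\<^sup>+x. \<Psi> x \<partial>lborel) = 120 * (\<integral>\<^sup>+x. \<Psi> x * indicator chamber x \<partial>lborel)"
proof -
  let ?P = "{p :: 5 \<Rightarrow> 5. p permutes UNIV}"
  have fin: "finite ?P" by (simp add: finite_permutations)
  have "(\<integral>\<^sup>+x. \<Psi> x \<partial>lborel) = (\<integral>\<^sup>+x. (\<Sum>p\<in>?P. \<Psi> (perm5 p x) * indicator chamber (perm5 p x)) \<partial>lborel)"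
  proof (intro nn_integral_cong_AE)
    show "AE x in lborel. \<Psi> x = (\<Sum>p\<in>?P. \<Psi> (perm5 p x) * indicator chamber (perm5 p x))"
      using AE_distinct_coordinates
    proof eventually_elim
      fix x :: "real^5" assume "inj (\<lambda>i. x $ i)"
      then obtain p where "p permutes UNIV \<and> perm5 p x \<in> chamber"
        and "\<forall>q. q permutes UNIV \<and> perm5 q x \<in> chamber \<longrightarrow> q = p"
        by (elim ex1E[OF sorting_permutation]) blast
      note p = this
      have ind: "indicator chamber (perm5 q x) = (if q = p then 1 else (0::ennreal))"
          if "q permutes UNIV" for q
        using that p by (metis indicator_simps)
      have "(\<Sum>q\<in>?P. \<Psi> (perm5 q x) * indicator chamber (perm5 q x)) = (\<Sum>q\<in>?P. if q = p then \<Psi> x else 0)"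
      proof (rule sum.cong[OF refl])
        fix q assume "q \<in> ?P"
        hence "q permutes UNIV" by blast
        thus "\<Psi> (perm5 q x) * indicator chamber (perm5 q x) = (if q = p then \<Psi> x else 0)"
          by (cases "q = p") (simp_all only: sym ind mult_1_right mult_zero_right if_True if_False simp_thms)
      qed
      also have "\<dots> = \<Psi> x"
        using p(1) by (subst sum.delta[OF fin]) (simp only: mem_Collect_eq if_True simp_thms)
      finally show "\<Psi> x = (\<Sum>p\<in>?P. \<Psi> (perm5 p x) * indicator chamber (perm5 p x))" ..
    qed
  qed
  also have "\<dots> = (\<Sum>p\<in>?P. \<integral>\<^sup>+x. \<Psi> (perm5 p x) * indicator chamber (perm5 p x) \<partial>lborel)"
    by (intro nn_integral_sum) auto
  also have "\<dots> = (\<Sum>p\<in>?P. \<integral>\<^sup>+x. \<Psi> x * indicator chamber x \<partial>lborel)"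
  proof (intro sum.cong refl)
    fix p :: "5 \<Rightarrow> 5" assume "p \<in> ?P"
    hence p: "p permutes UNIV" by simp
    have "(\<integral>\<^sup>+x. \<Psi> x * indicator chamber x \<partial>lborel) = (\<integral>\<^sup>+x. \<Psi> x * indicator chamber x \<partial>distr lborel borel (perm5 p))"
      by (simp add: distr_lborel_perm5[OF p])
    also have "\<dots> = (\<integral>\<^sup>+x. \<Psi> (perm5 p x) * indicator chamber (perm5 p x) \<partial>lborel)"
      by (subst nn_integral_distr) auto
    finally show "(\<integral>\<^sup>+x. \<Psi> (perm5 p x) * indicator chamber (perm5 p x) \<partial>lborel) = (\<integral>\<^sup>+x. \<Psi> x * indicator chamber x \<partial>lborel)"
      by simp
  qed
  also have "\<dots> = of_nat (card ?P) * (\<integral>\<^sup>+x. \<Psi> x * indicator chamber x \<partial>lborel)" by simp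
  also have "card ?P = 120"
    using card_permutations[of "UNIV :: 5 set" 5, OF _ finite_class.finite_UNIV]
    by (simp only: CARD_5 fact_5)
  finally show ?thesis by simp
qed

subsection \<open>Integration in standardised coordinates\<close>

lemma continuous_on_vec5 [continuous_intros]:
  assumes "continuous_on S f1" "continuous_on S f2" "continuous_on S f3" "continuous_on S f4" "continuous_on S f5"
  shows "continuous_on S (\<lambda>x. vec5 (f1 x) (f2 x) (f3 x) (f4 x) (f5 x))"
  unfolding vec5_def
proof (rule continuous_on_vec_lambda)
  fix i :: 5
  show "continuous_on S (\<lambda>x. [f1 x, f2 x, f3 x, f4 x, f5 x] ! idx5 i)"
    using exhaust_5[of i] assms by (elim disjE) simp_all
qed

lemma borel_measurable_vec5 [measurable (raw)]:
  fixes f1 :: "'a \<Rightarrow> real"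
  assumes [measurable]: "f1 \<in> borel_measurable M" "f2 \<in> borel_measurable M" "f3 \<in> borel_measurable M"
    "f4 \<in> borel_measurable M" "f5 \<in> borel_measurable M"
  shows "(\<lambda>x. vec5 (f1 x) (f2 x) (f3 x) (f4 x) (f5 x)) \<in> borel_measurable M"
proof -
  have "(\<lambda>z::real\<times>real\<times>real\<times>real\<times>real. vec5 (fst z) (fst (snd z)) (fst (snd (snd z)))
      (fst (snd (snd (snd z)))) (snd (snd (snd (snd z))))) \<in> borel_measurable borel"
    by (intro borel_measurable_continuous_onI continuous_intros)
  from measurable_compose[OF _ this, of "\<lambda>x. (f1 x, f2 x, f3 x, f4 x, f5 x)" M]
  show ?thesis by (simp add: borel_prod[symmetric])
qed

lemma nn_integral_lborel_pair:
  fixes f :: "'a::euclidean_space \<times> 'b::euclidean_space \<Rightarrow> ennreal"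
  assumes "f \<in> borel_measurable borel"
  shows "(\<integral>\<^sup>+z. f z \<partial>lborel) = (\<integral>\<^sup>+x. \<integral>\<^sup>+y. f (x, y) \<partial>lborel \<partial>lborel)"
  using lborel.nn_integral_fst[of f lborel] assms by (simp add: lborel_prod)

lemma distr_lborel_vec5:
  "distr lborel borel (\<lambda>(a, b, c, d, e). vec5 a b c d e) = (lborel :: (real^5) measure)"
proof (rule lborel_eqI[symmetric])
  let ?f = "\<lambda>(a, b, c, d, e). vec5 a b c d e :: real^5"
  have f [measurable]: "?f \<in> borel_measurable borel"
    by (auto simp: borel_prod[symmetric] split_beta)
  fix l u :: "real^5" assume le: "\<And>b. b \<in> Basis \<Longrightarrow> l \<bullet> b \<le> u \<bullet> b"
  have le': "l $ i \<le> u $ i" for i using le[of "axis i 1"] by (simp add: inner_axis)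
  have vim: "?f -` box l u = {l$0<..<u$0} \<times> {l$1<..<u$1} \<times> {l$2<..<u$2} \<times> {l$3<..<u$3} \<times> {l$4<..<u$4}"
    by (auto simp: mem_box_cart forall_5)
  have tm: "emeasure lborel (A \<times> B) = emeasure lborel A * emeasure lborel B"
    if "A \<in> sets borel" "B \<in> sets borel" for A :: "'a::euclidean_space set" and B :: "'b::euclidean_space set"
    using that lborel.emeasure_pair_measure_Times[of A lborel B] by (simp add: lborel_prod)
  have bs: "{l$i<..<u$i} \<times> {l$j<..<u$j} \<in> sets borel" for i j
    by (metis borel_open open_Times open_greaterThanLessThan)
  have "emeasure (distr lborel borel ?f) (box l u) = emeasure lborel (?f -` box l u)"
    by (simp add: emeasure_distr)
  also have "\<dots> = ennreal (u$0 - l$0) * (ennreal (u$1 - l$1) * (ennreal (u$2 - l$2) * (ennreal (u$3 - l$3) * ennreal (u$4 - l$4))))"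
    unfolding vim by (subst tm, simp, (intro borel_open open_Times open_greaterThanLessThan)[1])+
      (simp add: le')
  also have "\<dots> = ennreal ((u$0 - l$0) * (u$1 - l$1) * (u$2 - l$2) * (u$3 - l$3) * (u$4 - l$4))"
    using le' by (simp add: ennreal_mult'[symmetric] mult_ac)
  also have "(u$0 - l$0) * (u$1 - l$1) * (u$2 - l$2) * (u$3 - l$3) * (u$4 - l$4) = (\<Prod>b\<in>Basis. (u - l) \<bullet> b)"
    using prod_5[of "\<lambda>i. (u - l) $ i"]
    by (simp add: Basis_vec_def UNION_singleton_eq_range prod.reindex inj_on_def axis_eq_axis inner_axis)
  finally show "emeasure (distr lborel borel ?f) (box l u) = (\<Prod>b\<in>Basis. (u - l) \<bullet> b)" .
qed simp

lemma nn_integral_vec5: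
  assumes [measurable]: "F \<in> borel_measurable borel"
  shows "(\<integral>\<^sup>+x. F x \<partial>lborel) =
    (\<integral>\<^sup>+a. \<integral>\<^sup>+b. \<integral>\<^sup>+c. \<integral>\<^sup>+d. \<integral>\<^sup>+e. F (vec5 a b c d e :: real^5) \<partial>lborel \<partial>lborel \<partial>lborel \<partial>lborel \<partial>lborel)"
proof -
  have f [measurable]: "(\<lambda>(a, b, c, d, e). vec5 a b c d e :: real^5) \<in> borel_measurable borel"
    by (auto simp: borel_prod[symmetric] split_beta)
  have "(\<integral>\<^sup>+x. F x \<partial>lborel) = (\<integral>\<^sup>+x. F x \<partial>distr lborel borel (\<lambda>(a, b, c, d, e). vec5 a b c d e))"
    by (simp add: distr_lborel_vec5)
  also have "\<dots> = (\<integral>\<^sup>+(a, b, c, d, e). F (vec5 a b c d e) \<partial>lborel)"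
    by (subst nn_integral_distr) (auto intro!: nn_integral_cong simp: split_beta)
  also have "\<dots> = (\<integral>\<^sup>+a. \<integral>\<^sup>+(b, c, d, e). F (vec5 a b c d e) \<partial>lborel \<partial>lborel)"
    by (subst nn_integral_lborel_pair) (auto intro!: nn_integral_cong simp: borel_prod[symmetric] split_beta)
  also have "\<dots> = (\<integral>\<^sup>+a. \<integral>\<^sup>+b. \<integral>\<^sup>+(c, d, e). F (vec5 a b c d e) \<partial>lborel \<partial>lborel \<partial>lborel)"
    by (subst nn_integral_lborel_pair) (auto intro!: nn_integral_cong simp: borel_prod[symmetric] split_beta)
  also have "\<dots> = (\<integral>\<^sup>+a. \<integral>\<^sup>+b. \<integral>\<^sup>+c. \<integral>\<^sup>+(d, e). F (vec5 a b c d e) \<partial>lborel \<partial>lborel \<partial>lborel \<partial>lborel)"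
    by (subst nn_integral_lborel_pair) (auto intro!: nn_integral_cong simp: borel_prod[symmetric] split_beta)
  also have "\<dots> = (\<integral>\<^sup>+a. \<integral>\<^sup>+b. \<integral>\<^sup>+c. \<integral>\<^sup>+d. \<integral>\<^sup>+e. F (vec5 a b c d e) \<partial>lborel \<partial>lborel \<partial>lborel \<partial>lborel \<partial>lborel)"
    by (subst nn_integral_lborel_pair) (auto intro!: nn_integral_cong simp: borel_prod[symmetric] split_beta)
  finally show ?thesis .
qed

text \<open>The power sums of \<open>t *\<^sub>R 1 + sqrt q *\<^sub>R u\<close>, where \<open>u\<close> has power sums \<open>0, 1, a, b, c\<close>.\<close>

definition affine_psums :: "real \<Rightarrow> real \<Rightarrow> real \<Rightarrow> real \<Rightarrow> real \<Rightarrow> real^5" where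
  "affine_psums t q a b c = vec5 (5 * t) (q + 5 * t^2)
     (3 * t * q + 5 * t^3 + sqrt q ^ 3 * a)
     (4 * t * sqrt q ^ 3 * a + 6 * t^2 * q + 5 * t^4 + sqrt q ^ 4 * b)
     (5 * t * sqrt q ^ 4 * b + 10 * t^2 * sqrt q ^ 3 * a + 10 * t^3 * q + 5 * t^5 + sqrt q ^ 5 * c)"

lemma borel_measurable_affine_psums [measurable (raw)]:
  assumes [measurable]: "f1 \<in> borel_measurable M" "f2 \<in> borel_measurable M" "f3 \<in> borel_measurable M"
    "f4 \<in> borel_measurable M" "f5 \<in> borel_measurable M"
  shows "(\<lambda>x. affine_psums (f1 x) (f2 x) (f3 x) (f4 x) (f5 x)) \<in> borel_measurable M"
  unfolding affine_psums_def by measurable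

lemma psums_affine:
  assumes q: "q \<ge> 0" and x: "psums x = vec5 0 1 a b c"
  shows "psums (t *\<^sub>R 1 + sqrt q *\<^sub>R x) = affine_psums t q a b c"
proof -
  define s where "s = sqrt q"
  have q': "q = s^2" using q by (simp add: s_def)
  define x0 x1 x2 x3 x4 where xs: "x0 = x$0" "x1 = x$1" "x2 = x$2" "x3 = x$3" "x4 = x$4"
  have p: "x0 + x1 + x2 + x3 + x4 = 0" "x0^2 + x1^2 + x2^2 + x3^2 + x4^2 = 1"
    "x0^3 + x1^3 + x2^3 + x3^3 + x4^3 = a" "x0^4 + x1^4 + x2^4 + x3^4 + x4^4 = b"
    "x0^5 + x1^5 + x2^5 + x3^5 + x4^5 = c"
    using x unfolding psums_eq_vec5_iff psum_5 xs by simp_all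
  have "(t + s*x0) + (t + s*x1) + (t + s*x2) + (t + s*x3) + (t + s*x4) = 5 * t"
    using p(1) by algebra
  moreover have "(t + s*x0)^2 + (t + s*x1)^2 + (t + s*x2)^2 + (t + s*x3)^2 + (t + s*x4)^2 = s^2 + 5 * t^2"
    using p(1,2) by algebra
  moreover have "(t + s*x0)^3 + (t + s*x1)^3 + (t + s*x2)^3 + (t + s*x3)^3 + (t + s*x4)^3
      = 3 * t * s^2 + 5 * t^3 + s ^ 3 * a"
    using p(1-3) by algebra
  moreover have "(t + s*x0)^4 + (t + s*x1)^4 + (t + s*x2)^4 + (t + s*x3)^4 + (t + s*x4)^4
      = 4 * t * s ^ 3 * a + 6 * t^2 * s^2 + 5 * t^4 + s ^ 4 * b"
    using p(1-4) by algebra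
  moreover have "(t + s*x0)^5 + (t + s*x1)^5 + (t + s*x2)^5 + (t + s*x3)^5 + (t + s*x4)^5
      = 5 * t * s ^ 4 * b + 10 * t^2 * s ^ 3 * a + 10 * t^3 * s^2 + 5 * t^5 + s ^ 5 * c"
    using p(1-5) by algebra
  ultimately show ?thesis
    using q unfolding psums_def affine_psums_def psum_5 s_def[symmetric] by (simp add: vec_eq_iff forall_5 xs q'[symmetric] algebra_simps)
qed

text \<open>The substitution is triangular: each power sum is affine in its own new variable when
  the earlier ones are fixed. With \<open>s = sqrt q\<close> the slopes are 5, 1,
  \<open>s^3\<close>, \<open>s^4\<close>, \<open>s^5\<close>, of product \<open>5 * q^6\<close>. The
  assumption \<open>zero\<close> discards the points that would have \<open>q\<close>
  nonpositive.\<close>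

lemma nn_integral_affine_psums:
  assumes [measurable]: "F \<in> borel_measurable borel"
    and zero: "\<And>p. p $ 1 \<le> p $ 0 ^ 2 / 5 \<Longrightarrow> F p = 0"
  shows "(\<integral>\<^sup>+p. F p \<partial>lborel) = (\<integral>\<^sup>+t. \<integral>\<^sup>+q. ennreal (5 * q^6) * indicator {0<..} q *
    (\<integral>\<^sup>+a. \<integral>\<^sup>+b. \<integral>\<^sup>+c. F (affine_psums t q a b c) \<partial>lborel \<partial>lborel \<partial>lborel) \<partial>lborel \<partial>lborel)"
proof -
  define G where "G p1 p2 = (\<integral>\<^sup>+p3. \<integral>\<^sup>+p4. \<integral>\<^sup>+p5. F (vec5 p1 p2 p3 p4 p5) \<partial>lborel \<partial>lborel \<partial>lborel)" for p1 p2
  have [measurable]: "(\<lambda>x. G (f x) (g x)) \<in> borel_measurable M"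
    if [measurable]: "f \<in> borel_measurable M" "g \<in> borel_measurable M" for f g and M :: "'z measure"
    unfolding G_def by measurable
  have G: "G (5 * t) (q + 5 * t^2) = ennreal (q^6) * indicator {0<..} q *
      (\<integral>\<^sup>+a. \<integral>\<^sup>+b. \<integral>\<^sup>+c. F (affine_psums t q a b c) \<partial>lborel \<partial>lborel \<partial>lborel)" for t q
  proof (cases "q > 0")
    case False
    have "F (vec5 (5 * t) (q + 5 * t^2) p3 p4 p5) = 0" for p3 p4 p5
      using False by (intro zero) (simp add: power2_eq_square)
    thus ?thesis using False by (simp add: G_def)
  next
    case True
    define s where "s = sqrt q"
    have s: "s > 0" using True by (simp add: s_def)
    have 4: "(\<integral>\<^sup>+p4. \<integral>\<^sup>+p5. F (vec5 (5 * t) (q + 5 * t^2) (3 * t * q + 5 * t^3 + s ^ 3 * a) p4 p5) \<partial>lborel \<partial>lborel)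
        = s^4 * (\<integral>\<^sup>+b. \<integral>\<^sup>+p5. F (vec5 (5 * t) (q + 5 * t^2)
        (3 * t * q + 5 * t^3 + s ^ 3 * a) (4 * t * s ^ 3 * a + 6 * t^2 * q + 5 * t^4 + s ^ 4 * b) p5)
        \<partial>lborel \<partial>lborel)" for a
      using s by (subst nn_integral_real_affine[where c = "s^4" and t = "4 * t * s ^ 3 * a + 6 * t^2 * q + 5 * t^4"]) auto
    have 5: "(\<integral>\<^sup>+p5. F (vec5 (5 * t) (q + 5 * t^2)
        (3 * t * q + 5 * t^3 + s ^ 3 * a) (4 * t * s ^ 3 * a + 6 * t^2 * q + 5 * t^4 + s ^ 4 * b) p5) \<partial>lborel)
      = s^5 * (\<integral>\<^sup>+c. F (affine_psums t q a b c) \<partial>lborel)" for a b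
      unfolding affine_psums_def s_def[symmetric]
      using s by (subst nn_integral_real_affine[where c = "s^5" and
        t = "5 * t * s ^ 4 * b + 10 * t^2 * s ^ 3 * a + 10 * t^3 * q + 5 * t^5"]) auto
    have "G (5 * t) (q + 5 * t^2) = s^3 * (\<integral>\<^sup>+a. \<integral>\<^sup>+p4. \<integral>\<^sup>+p5. F (vec5 (5 * t) (q + 5 * t^2)
        (3 * t * q + 5 * t^3 + s ^ 3 * a) p4 p5) \<partial>lborel \<partial>lborel \<partial>lborel)"
      unfolding G_def using s by (subst nn_integral_real_affine[where c = "s^3" and t = "3 * t * q + 5 * t^3"]) auto
    also have "\<dots> = s^3 * (\<integral>\<^sup>+a. s^4 * (\<integral>\<^sup>+b. s^5 * (\<integral>\<^sup>+c. F (affine_psums t q a b c)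
        \<partial>lborel) \<partial>lborel) \<partial>lborel)"
      unfolding 4 5 ..
    also have "\<dots> = s^3 * (s^4 * (s^5 * (\<integral>\<^sup>+a. \<integral>\<^sup>+b. \<integral>\<^sup>+c. F (affine_psums t q a b c)
        \<partial>lborel \<partial>lborel \<partial>lborel)))"
      by (simp add: nn_integral_cmult)
    also have "\<dots> = ennreal (s^3 * (s^4 * s^5)) * (\<integral>\<^sup>+a. \<integral>\<^sup>+b. \<integral>\<^sup>+c. F (affine_psums t q a b c)
        \<partial>lborel \<partial>lborel \<partial>lborel)"
    proof -
      have "ennreal (s^3 * (s^4 * s^5)) = ennreal (s^3) * (ennreal (s^4) * ennreal (s^5))"
        using s by (metis ennreal_mult mult_nonneg_nonneg zero_le_power less_imp_le)
      thus ?thesis by (simp only: mult.assoc)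
    qed
    also have "s^3 * (s^4 * s^5) = (s^2)^6" by (simp add: power_add[symmetric] power_mult[symmetric])
    also have "s^2 = q" using True by (simp add: s_def)
    finally show ?thesis using True by simp
  qed
  have 2: "(\<integral>\<^sup>+p2. G (5 * t) p2 \<partial>lborel) = (\<integral>\<^sup>+q. G (5 * t) (q + 5 * t^2) \<partial>lborel)" for t
    by (subst nn_integral_real_affine[where c = 1 and t = "5 * t^2"]) (auto simp: add.commute)
  have "(\<integral>\<^sup>+p. F p \<partial>lborel) = (\<integral>\<^sup>+p1. \<integral>\<^sup>+p2. G p1 p2 \<partial>lborel \<partial>lborel)"
    unfolding G_def by (rule nn_integral_vec5) measurable
  also have "\<dots> = ennreal 5 * (\<integral>\<^sup>+t. \<integral>\<^sup>+p2. G (5 * t) p2 \<partial>lborel \<partial>lborel)"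
    by (subst nn_integral_real_affine[where c = 5 and t = 0]) auto
  also have "\<dots> = ennreal 5 * (\<integral>\<^sup>+t. \<integral>\<^sup>+q. G (5 * t) (q + 5 * t^2) \<partial>lborel \<partial>lborel)"
    unfolding 2 ..
  also have "\<dots> = (\<integral>\<^sup>+t. \<integral>\<^sup>+q. ennreal 5 * G (5 * t) (q + 5 * t^2) \<partial>lborel \<partial>lborel)"
    by (simp add: nn_integral_cmult)
  also have "\<dots> = (\<integral>\<^sup>+t. \<integral>\<^sup>+q. ennreal (5 * q^6) * indicator {0<..} q *
    (\<integral>\<^sup>+a. \<integral>\<^sup>+b. \<integral>\<^sup>+c. F (affine_psums t q a b c) \<partial>lborel \<partial>lborel \<partial>lborel) \<partial>lborel \<partial>lborel)"
    unfolding G by (intro nn_integral_cong) (simp add: ennreal_mult mult.assoc)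
  finally show ?thesis .
qed

lemma affine_psums_inject:
  assumes q: "q > 0" and eq: "affine_psums t q a b c = affine_psums t q a' b' c'"
  shows "a = a' \<and> b = b' \<and> c = c'"
proof -
  have s: "sqrt q \<noteq> 0" using q by simp
  have a: "a = a'"
    using arg_cong[OF eq, of "\<lambda>p. p $ 2"] s by (simp add: affine_psums_def)
  have b: "b = b'"
    using arg_cong[OF eq, of "\<lambda>p. p $ 3"] s by (simp add: affine_psums_def a)
  have c: "c = c'"
    using arg_cong[OF eq, of "\<lambda>p. p $ 4"] s by (simp add: affine_psums_def a b)
  show ?thesis using a b c by simp
qed

lemma affine_mem_chamber: "s > 0 \<Longrightarrow> t *\<^sub>R 1 + s *\<^sub>R x \<in> chamber \<longleftrightarrow> x \<in> chamber"
  by (simp add: chamber_def)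

lemma vdm_affine: "vdm (t *\<^sub>R 1 + s *\<^sub>R x) = s ^ 10 * vdm x"
proof -
  have "(t *\<^sub>R 1 + s *\<^sub>R x) $ i - (t *\<^sub>R 1 + s *\<^sub>R x) $ j = s * (x $ i - x $ j)" for i j
    by (simp add: algebra_simps)
  thus ?thesis unfolding vdm_def by (simp only: power_numeral_reduce) (simp add: power_numeral_reduce mult_ac)
qed

text \<open>The chamber is invariant under shifts and positive scalings. Conversely, undoing them on
  a preimage gives a vector whose first two power sums are forced to be 0 and 1; injectivity in
  \<open>a\<close>, \<open>b\<close>, \<open>c\<close> identifies the rest.\<close>

lemma affine_psums_mem_iff:
  assumes q: "q > 0"
  shows "affine_psums t q a b c \<in> psums ` chamber \<longleftrightarrow> vec5 0 1 a b c \<in> psums ` chamber"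
    and "vec5 0 1 a b c \<in> psums ` chamber \<Longrightarrow>
      rootvec (affine_psums t q a b c) = t *\<^sub>R 1 + sqrt q *\<^sub>R rootvec (vec5 0 1 a b c)"
proof -
  define s where "s = sqrt q"
  have s: "s > 0" "s^2 = q" using q by (auto simp: s_def)
  have *: "t *\<^sub>R 1 + s *\<^sub>R x \<in> chamber \<and> psums (t *\<^sub>R 1 + s *\<^sub>R x) = affine_psums t q a b c"
    if "x \<in> chamber" "psums x = vec5 0 1 a b c" for x
    using affine_mem_chamber[OF s(1)] psums_affine[of q x a b c t] that q by (simp add: s_def)
  show "rootvec (affine_psums t q a b c) = t *\<^sub>R 1 + sqrt q *\<^sub>R rootvec (vec5 0 1 a b c)"
    if "vec5 0 1 a b c \<in> psums ` chamber"
  proof -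
    obtain x where x: "x \<in> chamber" "psums x = vec5 0 1 a b c" using \<open>vec5 0 1 a b c \<in> psums ` chamber\<close> by auto
    have "rootvec (affine_psums t q a b c) = t *\<^sub>R 1 + s *\<^sub>R x"
      using *[OF x] rootvec_psums by metis
    moreover have "rootvec (vec5 0 1 a b c) = x" using x rootvec_psums by metis
    ultimately show ?thesis by (simp add: s_def)
  qed
  show "affine_psums t q a b c \<in> psums ` chamber \<longleftrightarrow> vec5 0 1 a b c \<in> psums ` chamber"
  proof
    assume "vec5 0 1 a b c \<in> psums ` chamber"
    then obtain x where "x \<in> chamber" "psums x = vec5 0 1 a b c" by auto
    from *[OF this] show "affine_psums t q a b c \<in> psums ` chamber"
      by (intro image_eqI[of _ _ "t *\<^sub>R 1 + s *\<^sub>R x"]) auto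
  next
    assume "affine_psums t q a b c \<in> psums ` chamber"
    then obtain y where y: "y \<in> chamber" "psums y = affine_psums t q a b c" by auto
    define x where "x = (1/s) *\<^sub>R (y - t *\<^sub>R 1)"
    have yx: "y = t *\<^sub>R 1 + s *\<^sub>R x" using s by (simp add: x_def)
    have 1: "psum 1 y = 5 * t" "psum 2 y = q + 5 * t^2"
      using y(2) unfolding affine_psums_def psums_eq_vec5_iff by blast+
    have "s * psum 1 x = psum 1 y - 5 * t" unfolding yx by (simp add: psum_5 algebra_simps)
    hence p1: "psum 1 x = 0" using 1 s by simp
    have "s^2 * psum 2 x + 2 * s * t * psum 1 x + 5 * t^2 = psum 2 y"
      unfolding yx by (simp add: psum_5 power2_eq_square algebra_simps)
    hence p2: "psum 2 x = 1" using 1 s p1 q by simp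
    have px: "psums x = vec5 0 1 (psum 3 x) (psum 4 x) (psum 5 x)"
      by (simp only: psums_def p1 p2)
    have "affine_psums t q a b c = affine_psums t q (psum 3 x) (psum 4 x) (psum 5 x)"
      using psums_affine[OF less_imp_le[OF q] px, of t] y(2) yx by (simp add: s_def)
    from affine_psums_inject[OF q this] px have "psums x = vec5 0 1 a b c" by simp
    moreover have "x \<in> chamber" using y(1) affine_mem_chamber[OF s(1)] yx by simp
    ultimately show "vec5 0 1 a b c \<in> psums ` chamber"
      by (intro image_eqI[of _ _ x]) auto
  qed
qed

text \<open>Each of the ten root differences scales by \<open>sqrt q\<close>, so their product
  scales by \<open>q^5\<close>.\<close>

lemma rdens_affine_psums:
  assumes q: "q > 0"
  shows "rdens (affine_psums t q a b c) = ennreal (1 / q ^ 5) * rdens (vec5 0 1 a b c)"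
proof (cases "vec5 0 1 a b c \<in> psums ` chamber")
  case True
  define x where "x = rootvec (vec5 0 1 a b c)"
  have x: "x \<in> chamber" using True rootvec_psums by (auto simp: x_def)
  have "sqrt q ^ 10 = (sqrt q ^ 2) ^ 5" by (simp only: power_mult[symmetric]) simp
  hence sq: "sqrt q ^ 10 = q ^ 5" using q by simp
  have "rdens (affine_psums t q a b c) = ennreal (1 / (q ^ 5 * vdm x))"
    using True affine_psums_mem_iff[OF q] by (simp add: rdens_def vdm_affine x_def sq)
  also have "1 / (q ^ 5 * vdm x) = 1 / q ^ 5 * (1 / vdm x)" by simp
  also have "ennreal \<dots> = ennreal (1 / q ^ 5) * ennreal (1 / vdm x)"
    using q vdm_pos[OF x] by (intro ennreal_mult) auto
  finally show ?thesis using True by (simp add: rdens_def x_def)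
next
  case False
  thus ?thesis using affine_psums_mem_iff(1)[OF q] by (simp add: rdens_def)
qed

section \<open>Mean, squared norm and shape as coordinates of a sample\<close>

lemma mean5_psum: "mean5 x = psum 1 x / 5"
  using psum_1[of x] by simp

lemma norm_psum: "(norm x)\<^sup>2 = psum 2 x"
  by (simp only: psum_2)

lemma Omega5_mean_norm:
  assumes "u \<in> Omega5"
  shows "mean5 u = 0" "norm u = 1"
proof -
  have p: "psum 1 u = 0" "psum 2 u = 1" using assms unfolding Omega5_def by blast+
  show "mean5 u = 0" unfolding mean5_psum p by simp
  show "norm u = 1" using p(2) norm_psum[of u] power2_eq_iff_nonneg[of "norm u" 1] by simp
qed

text \<open>Skewness and kurtosis up to the factors \<open>sqrt 5\<close> and 5. A constant sample
  gets the value \<open>(0, 0)\<close>, because \<open>sgn 0 = 0\<close>.\<close>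

definition shape :: "real^5 \<Rightarrow> real \<times> real" where
  "shape x = (psum 3 (sgn (centred x)), psum 4 (sgn (centred x)))"

lemma psum_borel [measurable]: "psum r \<in> borel_measurable borel"
  unfolding psum_def by (intro borel_measurable_continuous_onI continuous_intros)

lemma mean5_borel [measurable]: "mean5 \<in> borel_measurable borel"
  by (intro borel_measurable_continuous_onI continuous_intros)

lemma shape_borel [measurable]: "shape \<in> borel_measurable borel"
  unfolding shape_def[abs_def] borel_prod[symmetric] by measurable

lemma standardise_affine:
  assumes q: "q > 0" and x: "psums x = vec5 0 1 a b c"
  shows "mean5 (t *\<^sub>R 1 + sqrt q *\<^sub>R x) = t" "(norm (centred (t *\<^sub>R 1 + sqrt q *\<^sub>R x)))\<^sup>2 = q"
    "shape (t *\<^sub>R 1 + sqrt q *\<^sub>R x) = (a, b)"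
proof -
  let ?y = "t *\<^sub>R 1 + sqrt q *\<^sub>R x"
  have p: "psum 1 x = 0" "psum 2 x = 1" "psum 3 x = a" "psum 4 x = b"
    using x unfolding psums_eq_vec5_iff by blast+
  have "x \<in> Omega5" using p unfolding Omega5_def by blast
  note m = Omega5_mean_norm(1)[OF this] and n = Omega5_mean_norm(2)[OF this]
  show my: "mean5 ?y = t"
    using linear_mean5 m mean5_1 by (simp add: linear_add linear_cmul)
  have cy: "centred ?y = sqrt q *\<^sub>R x"
    unfolding centred_eq my by simp
  show "(norm (centred ?y))\<^sup>2 = q"
    using q n unfolding cy by simp
  have "sgn (centred ?y) = x"
    using q n unfolding cy by (simp add: sgn_div_norm)
  thus "shape ?y = (a, b)" by (simp add: shape_def p)
qed

lemma psum_perm5: "p permutes UNIV \<Longrightarrow> psum r (perm5 p x) = psum r x"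
  unfolding psum_def perm5_def using sum.permute[of p UNIV "\<lambda>i. x $ i ^ r"] by (simp add: o_def)

lemma symmetric_standardise:
  assumes p: "p permutes UNIV"
  shows "mean5 (perm5 p x) = mean5 x" "norm (centred (perm5 p x)) = norm (centred x)"
    "shape (perm5 p x) = shape x"
proof -
  show m: "mean5 (perm5 p x) = mean5 x" unfolding mean5_psum psum_perm5[OF p] ..
  have c: "centred (perm5 p x) = perm5 p (centred x)"
    unfolding centred_def m by (simp add: perm5_def)
  have n: "norm (perm5 p y) = norm y" for y
    using norm_psum[of "perm5 p y"] norm_psum[of y] psum_perm5[OF p, of 2 y]
      power2_eq_iff_nonneg[of "norm (perm5 p y)" "norm y"] by simp
  show "norm (centred (perm5 p x)) = norm (centred x)" unfolding c n ..
  have "sgn (perm5 p y) = perm5 p (sgn y)" for y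
    unfolding sgn_div_norm n by (simp add: perm5_def vec_eq_iff)
  thus "shape (perm5 p x) = shape x"
    by (simp only: shape_def c psum_perm5[OF p])
qed

definition Jdens :: "real \<times> real \<Rightarrow> ennreal" where
  "Jdens = (\<lambda>(a, b). \<integral>\<^sup>+c. rdens (vec5 0 1 a b c) \<partial>lborel)"

lemma Jdens_borel [measurable]: "Jdens \<in> borel_measurable borel"
  unfolding Jdens_def borel_prod[symmetric] by measurable

text \<open>The factor \<open>5 * q^6\<close> of the substitution times the factor
  \<open>1 / q^5\<close> of \<open>rdens\<close> is \<open>5 * q\<close>. What is left of the
  integrand is a function of \<open>t\<close> and \<open>q\<close> times a function of
  \<open>a\<close>, \<open>b\<close>, \<open>c\<close>, so the integral splits into a
  product.\<close>

lemma nn_integral_shape: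
  fixes \<phi> :: "real \<times> real \<Rightarrow> ennreal" and A :: "(real \<times> real) set"
  assumes phi: "\<phi> \<in> borel_measurable borel" and A: "A \<in> sets borel"
  shows "(\<integral>\<^sup>+x. \<phi> (mean5 x, (norm (centred x))\<^sup>2) * indicator A (shape x) \<partial>lborel) =
    (\<integral>\<^sup>+t. \<integral>\<^sup>+q. ennreal (5 * q) * indicator {0<..} q * \<phi> (t, q) \<partial>lborel \<partial>lborel) *
    (\<integral>\<^sup>+z. Jdens z * indicator A z \<partial>lborel)"
proof -
  have [measurable]: "\<phi> \<in> borel_measurable (borel \<Otimes>\<^sub>M borel)" "A \<in> sets (borel \<Otimes>\<^sub>M borel)"
    "shape \<in> measurable borel (borel \<Otimes>\<^sub>M borel)" "Jdens \<in> borel_measurable (borel \<Otimes>\<^sub>M borel)"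
    using phi A shape_borel Jdens_borel unfolding borel_prod by auto
  define \<Psi> where "\<Psi> x = \<phi> (mean5 x, (norm (centred x))\<^sup>2) * indicator A (shape x)" for x
  have [measurable]: "\<Psi> \<in> borel_measurable borel"
    unfolding \<Psi>_def by measurable
  have "(\<integral>\<^sup>+x. \<Psi> x \<partial>lborel) = 120 * (\<integral>\<^sup>+x. \<Psi> x * indicator chamber x \<partial>lborel)"
    by (rule nn_integral_symmetric) (simp_all add: \<Psi>_def symmetric_standardise)
  also have "\<dots> = (\<integral>\<^sup>+p. \<Psi> (rootvec p) * rdens p \<partial>lborel)"
    by (rule nn_integral_chamber) measurable
  also have "\<dots> = (\<integral>\<^sup>+t. \<integral>\<^sup>+q. ennreal (5 * q^6) * indicator {0<..} q *
    (\<integral>\<^sup>+a. \<integral>\<^sup>+b. \<integral>\<^sup>+c. \<Psi> (rootvec (affine_psums t q a b c)) * rdens (affine_psums t q a b c)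
      \<partial>lborel \<partial>lborel \<partial>lborel) \<partial>lborel \<partial>lborel)"
  proof (rule nn_integral_affine_psums)
    fix p :: "real^5" assume p: "p $ 1 \<le> (p $ 0)\<^sup>2 / 5"
    \<comment> \<open>The inequality says that the squared norm of the centred vector is at most 0.
      All coordinates would then be equal, which the chamber excludes.\<close>
    have "p \<notin> psums ` chamber"
    proof
      assume "p \<in> psums ` chamber"
      then obtain x where x: "x \<in> chamber" "p = psums x" by auto
      have m: "psum 1 x = 5 * mean5 x" by (rule psum_1)
      have "(norm (centred x))\<^sup>2 = psum 2 x - (psum 1 x)\<^sup>2 / 5"
        unfolding norm_psum m
        by (simp add: centred_def psum_5 mean5_def sum_5 power2_eq_square field_simps)
      hence "(norm (centred x))\<^sup>2 \<le> 0" using p x by (simp add: psums_def)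
      hence "centred x = 0" by simp
      hence "x $ 0 = mean5 x" "x $ 1 = mean5 x" by (simp_all add: centred_def vec_eq_iff)
      thus False using x(1) by (simp add: chamber_def)
    qed
    thus "\<Psi> (rootvec p) * rdens p = 0" by (simp add: rdens_def)
  qed measurable
  also have "\<dots> = (\<integral>\<^sup>+t. \<integral>\<^sup>+q. ennreal (5 * q) * indicator {0<..} q * \<phi> (t, q) *
    (\<integral>\<^sup>+z. Jdens z * indicator A z \<partial>lborel) \<partial>lborel \<partial>lborel)"
  proof (intro nn_integral_cong)
    fix t q :: real
    show "ennreal (5 * q^6) * indicator {0<..} q * (\<integral>\<^sup>+a. \<integral>\<^sup>+b. \<integral>\<^sup>+c. \<Psi> (rootvec (affine_psums t q a b c)) *
        rdens (affine_psums t q a b c) \<partial>lborel \<partial>lborel \<partial>lborel) =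
      ennreal (5 * q) * indicator {0<..} q * \<phi> (t, q) * (\<integral>\<^sup>+z. Jdens z * indicator A z \<partial>lborel)"
    proof (cases "q > 0")
      case q: True
      have eq: "\<Psi> (rootvec (affine_psums t q a b c)) * rdens (affine_psums t q a b c) =
        ennreal (1 / q^5) * \<phi> (t, q) * (indicator A (a, b) * rdens (vec5 0 1 a b c))" for a b c
      proof (cases "vec5 0 1 a b c \<in> psums ` chamber")
        case True
        define x where "x = rootvec (vec5 0 1 a b c)"
        have x: "psums x = vec5 0 1 a b c" using True rootvec_psums by (auto simp: x_def)
        show ?thesis
          unfolding affine_psums_mem_iff(2)[OF q True] \<Psi>_def x_def[symmetric]
            standardise_affine[OF q x] rdens_affine_psums[OF q] by (simp add: mult_ac)
      next
        case False
        thus ?thesis using affine_psums_mem_iff(1)[OF q] by (simp add: rdens_def)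
      qed
      have "(\<integral>\<^sup>+a. \<integral>\<^sup>+b. \<integral>\<^sup>+c. \<Psi> (rootvec (affine_psums t q a b c)) *
          rdens (affine_psums t q a b c) \<partial>lborel \<partial>lborel \<partial>lborel) =
        ennreal (1 / q^5) * \<phi> (t, q) * (\<integral>\<^sup>+a. \<integral>\<^sup>+b. Jdens (a, b) * indicator A (a, b) \<partial>lborel \<partial>lborel)"
      proof -
        define k where "k = ennreal (1 / q^5) * \<phi> (t, q)"
        show ?thesis
          unfolding eq Jdens_def k_def[symmetric]
          by (simp add: nn_integral_cmult nn_integral_multc mult.commute[of "indicator A z" for z])
      qed
      also have "(\<integral>\<^sup>+a. \<integral>\<^sup>+b. Jdens (a, b) * indicator A (a, b) \<partial>lborel \<partial>lborel) =
        (\<integral>\<^sup>+z. Jdens z * indicator A z \<partial>lborel)"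
        by (intro nn_integral_lborel_pair[symmetric] borel_measurable_times_ennreal Jdens_borel
            borel_measurable_indicator A)
      finally have "ennreal (5 * q^6) * (\<integral>\<^sup>+a. \<integral>\<^sup>+b. \<integral>\<^sup>+c. \<Psi> (rootvec (affine_psums t q a b c)) *
          rdens (affine_psums t q a b c) \<partial>lborel \<partial>lborel \<partial>lborel) =
        (ennreal (5 * q^6) * ennreal (1 / q^5)) * \<phi> (t, q) * (\<integral>\<^sup>+z. Jdens z * indicator A z \<partial>lborel)"
        by (simp only: mult.assoc)
      also have "ennreal (5 * q^6) * ennreal (1 / q^5) = ennreal (5 * q^6 * (1 / q^5))"
        using q by (intro ennreal_mult[symmetric]) auto
      also have "5 * q^6 * (1 / q^5) = 5 * q" using q by (simp add: power_numeral_reduce)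
      finally show ?thesis using q by simp
    qed simp
  qed
  also have "\<dots> = (\<integral>\<^sup>+t. \<integral>\<^sup>+q. ennreal (5 * q) * indicator {0<..} q * \<phi> (t, q) \<partial>lborel \<partial>lborel) *
    (\<integral>\<^sup>+z. Jdens z * indicator A z \<partial>lborel)"
    by (simp add: nn_integral_multc)
  finally show ?thesis by (simp add: \<Psi>_def)
qed

subsection \<open>The law of the shape\<close>

definition weight :: "(real \<times> real \<Rightarrow> ennreal) \<Rightarrow> ennreal" where
  "weight \<phi> = (\<integral>\<^sup>+t. \<integral>\<^sup>+q. ennreal (5 * q) * indicator {0<..} q * \<phi> (t, q) \<partial>lborel \<partial>lborel)"

definition spherical :: "(real \<times> real \<Rightarrow> ennreal) \<Rightarrow> (real^5) measure" where
  "spherical \<phi> = density lborel (\<lambda>x. \<phi> (mean5 x, (norm (centred x))\<^sup>2))"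

lemma sets_spherical [simp, measurable_cong]: "sets (spherical \<phi>) = sets borel"
  by (simp add: spherical_def)

lemma distr_spherical_shape:
  assumes phi: "\<phi> \<in> borel_measurable borel"
  shows "distr (spherical \<phi>) borel shape = density lborel (\<lambda>z. weight \<phi> * Jdens z)"
proof (rule measure_eqI)
  have [measurable]: "\<phi> \<in> borel_measurable (borel \<Otimes>\<^sub>M borel)" using phi by (simp add: borel_prod)
  fix A assume "A \<in> sets (distr (spherical \<phi>) borel shape)"
  hence A: "A \<in> sets borel" by simp
  have SA: "shape -` A \<in> sets borel" using measurable_sets[OF shape_borel A] by simp
  have "emeasure (distr (spherical \<phi>) borel shape) A = emeasure (spherical \<phi>) (shape -` A)"
    using A by (subst emeasure_distr) (auto simp: spherical_def)
  also have "\<dots> = (\<integral>\<^sup>+x. \<phi> (mean5 x, (norm (centred x))\<^sup>2) * indicator (shape -` A) x \<partial>lborel)"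
    unfolding spherical_def using SA by (subst emeasure_density) auto
  also have "\<dots> = (\<integral>\<^sup>+x. \<phi> (mean5 x, (norm (centred x))\<^sup>2) * indicator A (shape x) \<partial>lborel)"
    by (simp add: indicator_vimage)
  also have "\<dots> = weight \<phi> * (\<integral>\<^sup>+z. Jdens z * indicator A z \<partial>lborel)"
    unfolding weight_def by (rule nn_integral_shape[OF phi A])
  also have "\<dots> = (\<integral>\<^sup>+z. weight \<phi> * (Jdens z * indicator A z) \<partial>lborel)"
    by (intro nn_integral_cmult[symmetric]) (auto intro!: borel_measurable_times_ennreal Jdens_borel
      borel_measurable_indicator A)
  also have "\<dots> = emeasure (density lborel (\<lambda>z. weight \<phi> * Jdens z)) A"
    using A by (subst emeasure_density) (auto intro!: borel_measurable_times_ennreal Jdens_borel simp: mult_ac)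
  finally show "emeasure (distr (spherical \<phi>) borel shape) A = emeasure (density lborel (\<lambda>z. weight \<phi> * Jdens z)) A" .
qed simp

lemma weight_mult_Jdens:
  assumes phi: "\<phi> \<in> borel_measurable borel" and prob: "prob_space (spherical \<phi>)"
  shows "weight \<phi> * (\<integral>\<^sup>+z. Jdens z \<partial>lborel) = 1"
proof -
  have "prob_space (distr (spherical \<phi>) borel shape)"
    using prob shape_borel by (intro prob_space.prob_space_distr) (auto simp: spherical_def)
  hence "emeasure (density lborel (\<lambda>z. weight \<phi> * Jdens z)) UNIV = 1"
    unfolding distr_spherical_shape[OF phi] using prob_space.emeasure_space_1 by fastforce
  thus ?thesis
    by (subst (asm) emeasure_density)
      (auto intro!: borel_measurable_times_ennreal Jdens_borel simp: nn_integral_cmult Jdens_borel)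
qed

section \<open>Normal samples and the normalising constant\<close>

definition normal_weight :: "real \<Rightarrow> real \<Rightarrow> real \<times> real \<Rightarrow> ennreal" where
  "normal_weight \<mu> \<sigma> = (\<lambda>(t, q). ennreal ((1 / sqrt (2 * pi * \<sigma>\<^sup>2)) ^ 5 * exp (- (q + 5 * (t - \<mu>)\<^sup>2) / (2 * \<sigma>\<^sup>2))))"

lemma normal_weight_borel: "normal_weight \<mu> \<sigma> \<in> borel_measurable borel"
  unfolding normal_weight_def borel_prod[symmetric] by measurable

text \<open>The sum of squares about \<mu> splits into the squared norm of the centred sample and
  five times the squared deviation of the mean.\<close>

lemma prod_normal_density:
  "(\<Prod>i\<in>UNIV. ennreal (normal_density \<mu> \<sigma> (x $ i))) = normal_weight \<mu> \<sigma> (mean5 x, (norm (centred x))\<^sup>2)"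
proof -
  have m: "x$0 + x$1 + x$2 + x$3 + x$4 = 5 * mean5 x" by (simp add: mean5_def sum_5)
  have "(norm (centred x))\<^sup>2 + 5 * (mean5 x - \<mu>)\<^sup>2 = (x$0 - \<mu>)\<^sup>2 + (x$1 - \<mu>)\<^sup>2 + (x$2 - \<mu>)\<^sup>2 + (x$3 - \<mu>)\<^sup>2 + (x$4 - \<mu>)\<^sup>2"
    unfolding norm_psum psum_5 using m by (simp add: centred_def) algebra
  hence e: "exp (- ((norm (centred x))\<^sup>2 + 5 * (mean5 x - \<mu>)\<^sup>2) / (2 * \<sigma>\<^sup>2)) =
    exp (- (x$0 - \<mu>)\<^sup>2 / (2 * \<sigma>\<^sup>2)) * exp (- (x$1 - \<mu>)\<^sup>2 / (2 * \<sigma>\<^sup>2)) * exp (- (x$2 - \<mu>)\<^sup>2 / (2 * \<sigma>\<^sup>2)) *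
    exp (- (x$3 - \<mu>)\<^sup>2 / (2 * \<sigma>\<^sup>2)) * exp (- (x$4 - \<mu>)\<^sup>2 / (2 * \<sigma>\<^sup>2))"
    unfolding exp_add[symmetric] by (simp add: add_divide_distrib diff_divide_distrib algebra_simps)
  have "(\<Prod>i\<in>UNIV. ennreal (normal_density \<mu> \<sigma> (x $ i))) = ennreal (\<Prod>i\<in>UNIV. normal_density \<mu> \<sigma> (x $ i))"
    by (intro prod_ennreal) simp
  also have "(\<Prod>i\<in>UNIV. normal_density \<mu> \<sigma> (x $ i)) =
    (1 / sqrt (2 * pi * \<sigma>\<^sup>2)) ^ 5 * exp (- ((norm (centred x))\<^sup>2 + 5 * (mean5 x - \<mu>)\<^sup>2) / (2 * \<sigma>\<^sup>2))"
    unfolding prod_5 normal_density_def e by (simp add: power_numeral_reduce mult_ac)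
  finally show ?thesis by (simp add: normal_weight_def)
qed

lemma spherical_normal: "spherical (normal_weight \<mu> \<sigma>) = density lborel (\<lambda>x. \<Prod>i\<in>UNIV. ennreal (normal_density \<mu> \<sigma> (x $ i)))"
  by (simp add: spherical_def prod_normal_density)

lemma nn_integral_normal_density:
  assumes "\<sigma> > 0"
  shows "(\<integral>\<^sup>+x. ennreal (normal_density \<mu> \<sigma> x) \<partial>lborel) = 1"
  using prob_space.emeasure_space_1[OF prob_space_normal_density[OF assms, of \<mu>]]
  by (subst (asm) emeasure_density) auto

lemma prob_space_spherical_normal:
  assumes "\<sigma> > 0"
  shows "prob_space (spherical (normal_weight \<mu> \<sigma>))"
proof
  have "emeasure (spherical (normal_weight \<mu> \<sigma>)) UNIV = (\<integral>\<^sup>+x. (\<Prod>i\<in>UNIV. ennreal (normal_density \<mu> \<sigma> (x $ i))) \<partial>(lborel :: (real^5) measure))"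
    unfolding spherical_normal by (subst emeasure_density) auto
  also have "\<dots> = (\<integral>\<^sup>+x. (\<Prod>b\<in>Basis. ennreal (normal_density \<mu> \<sigma> (x \<bullet> b))) \<partial>(lborel :: (real^5) measure))"
    by (simp add: Basis_vec_def UNION_singleton_eq_range prod.reindex inj_on_def axis_eq_axis inner_axis)
  also have "\<dots> = (\<Prod>b\<in>(Basis :: (real^5) set). (\<integral>\<^sup>+x. ennreal (normal_density \<mu> \<sigma> x) \<partial>lborel))"
    by (rule nn_integral_lborel_prod) auto
  also have "(\<integral>\<^sup>+x. ennreal (normal_density \<mu> \<sigma> x) \<partial>lborel) = 1"
    by (rule nn_integral_normal_density[OF assms])
  finally show "emeasure (spherical (normal_weight \<mu> \<sigma>)) (space (spherical (normal_weight \<mu> \<sigma>))) = 1"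
    by (simp add: spherical_def)
qed

text \<open>
  Every probability density that depends only on mean and norm gives the same law of the shape, so
  its weight can be computed from any one of them. For the standard normal density it is an integral
  of a normal density and a gamma density, which avoids the volume of \<open>cylinder5\<close>.
\<close>

lemma weight_standard_normal: "weight (normal_weight 0 1) = ennreal (sqrt 5 / pi\<^sup>2)"
proof -
  \<comment> \<open>The two densities are the laws of the sample mean, with variance 1/5, and of the
    squared norm, chi-squared with four degrees of freedom. The constant is 5 over
    \<open>(2 * pi)\<close> to the power 5/2, divided by their leading constants
    \<open>sqrt 5 / sqrt (2 * pi)\<close> and 1/4.\<close>
  have pt: "ennreal (5 * q) * indicator {0<..} q * normal_weight 0 1 (t, q) =
    ennreal (sqrt 5 / pi\<^sup>2) * (ennreal (normal_density 0 (1 / sqrt 5) t) * ennreal (erlang_density 1 (1/2) q))" for t q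
  proof (cases "q > 0")
    case True
    define r where "r = sqrt (2 * pi)"
    have r: "r > 0" "r ^ 2 = 2 * pi" by (auto simp: r_def)
    have r4: "r ^ 4 = 4 * pi\<^sup>2"
    proof -
      have "r ^ 4 = (r ^ 2) ^ 2" by simp
      thus ?thesis by (simp add: r(2) power_mult_distrib)
    qed
    have nd: "normal_density 0 (1 / sqrt 5) t = sqrt 5 / r * exp (- (5 * t\<^sup>2) / 2)"
      by (simp add: normal_density_def r_def power_divide real_sqrt_divide real_sqrt_mult field_simps)
    have ed: "erlang_density 1 (1/2) q = q * exp (- q / 2) / 4"
      using True by (simp add: erlang_density_def power2_eq_square)
    have "5 * q * ((1 / r) ^ 5 * exp (- (q + 5 * t\<^sup>2) / 2)) = 5 * q / (r ^ 4 * r) * (exp (- (5 * t\<^sup>2) / 2) * exp (- q / 2))"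
      by (simp add: exp_add[symmetric] power_numeral_reduce add_divide_distrib power_divide field_simps)
    also have "\<dots> = (sqrt 5 * sqrt 5) * q / (4 * pi\<^sup>2 * r) * (exp (- (5 * t\<^sup>2) / 2) * exp (- q / 2))"
      unfolding r4 by simp
    also have "\<dots> = sqrt 5 / pi\<^sup>2 * (normal_density 0 (1 / sqrt 5) t * erlang_density 1 (1/2) q)"
      unfolding nd ed by (simp only: times_divide_eq_left times_divide_eq_right divide_divide_eq_left mult_ac)
    finally have "5 * q * ((1 / r) ^ 5 * exp (- (q + 5 * t\<^sup>2) / 2)) =
      sqrt 5 / pi\<^sup>2 * (normal_density 0 (1 / sqrt 5) t * erlang_density 1 (1/2) q)" .
    thus ?thesis
      using True by (simp add: normal_weight_def ennreal_mult[symmetric] r_def)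
  next
    case False
    have "erlang_density 1 (1/2) q = 0" using False by (cases "q = 0") (auto simp: erlang_density_def)
    thus ?thesis using False by simp
  qed
  have n: "(\<integral>\<^sup>+t. ennreal (normal_density 0 (1 / sqrt 5) t) \<partial>lborel) = 1"
    by (rule nn_integral_normal_density) simp
  have e: "(\<integral>\<^sup>+q. ennreal (erlang_density 1 (1/2) q) \<partial>lborel) = 1"
  proof -
    have "prob_space (density lborel (\<lambda>x. ennreal (erlang_density 1 (1/2) x)))"
      by (rule prob_space_erlang_density) simp
    from prob_space.emeasure_space_1[OF this] show ?thesis
      by (subst (asm) emeasure_density) auto
  qed
  show ?thesis
    unfolding weight_def pt using e by (simp add: nn_integral_cmult n)
qed

lemma nn_integral_Jdens: "(\<integral>\<^sup>+z. Jdens z \<partial>lborel) = ennreal (pi\<^sup>2 / sqrt 5)"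
proof -
  define I where "I = (\<integral>\<^sup>+z. Jdens z \<partial>lborel)"
  have *: "ennreal (sqrt 5 / pi\<^sup>2) * I = 1"
    using weight_mult_Jdens[OF normal_weight_borel prob_space_spherical_normal[of 1 0]]
    by (simp add: weight_standard_normal I_def)
  have "I = ennreal (pi\<^sup>2 / sqrt 5) * (ennreal (sqrt 5 / pi\<^sup>2) * I)"
    by (simp add: mult.assoc[symmetric] ennreal_mult[symmetric])
  thus ?thesis unfolding * by (simp add: I_def)
qed

lemma weight_prob:
  assumes phi: "\<phi> \<in> borel_measurable borel" and prob: "prob_space (spherical \<phi>)"
  shows "weight \<phi> = ennreal (sqrt 5 / pi\<^sup>2)"
proof -
  have "weight \<phi> = (weight \<phi> * ennreal (pi\<^sup>2 / sqrt 5)) * ennreal (sqrt 5 / pi\<^sup>2)"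
    by (simp add: mult.assoc ennreal_mult[symmetric])
  thus ?thesis using weight_mult_Jdens[OF assms] by (simp add: nn_integral_Jdens)
qed

text \<open>This is the version of the density to which all pointwise statements refer. The fibre
  integral diverges for instance where the two local minima of \<open>R\<close> have the same value
  below both maxima; \<open>enn2real\<close> assigns 0 there. The points of divergence form a null
  set because \<open>Jdens\<close> has finite total integral.\<close>

definition shape_density :: "real \<times> real \<Rightarrow> real" where
  "shape_density z = sqrt 5 / pi\<^sup>2 * enn2real (Jdens z)"

lemma shape_density_nonneg: "shape_density z \<ge> 0"
  by (simp add: shape_density_def)

lemma shape_density_borel: "shape_density \<in> borel_measurable borel"
  unfolding shape_density_def using Jdens_borel by measurable

lemma distr_spherical_shape_density:
  assumes phi: "\<phi> \<in> borel_measurable borel" and prob: "prob_space (spherical \<phi>)"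
  shows "distr (spherical \<phi>) borel shape = density lborel (\<lambda>z. ennreal (shape_density z))"
proof -
  have "AE z in lborel. Jdens z \<noteq> \<infinity>"
    using nn_integral_Jdens Jdens_borel by (intro nn_integral_PInf_AE) auto
  hence "AE z in lborel. weight \<phi> * Jdens z = ennreal (shape_density z)"
  proof eventually_elim
    fix z assume "Jdens z \<noteq> \<infinity>"
    hence "Jdens z = ennreal (enn2real (Jdens z))" by (simp add: less_top)
    thus "weight \<phi> * Jdens z = ennreal (shape_density z)"
      unfolding weight_prob[OF assms] shape_density_def by (metis divide_nonneg_nonneg enn2real_nonneg ennreal_mult pi_ge_zero real_sqrt_ge_zero zero_le_numeral zero_le_power)
  qed
  thus ?thesis
    unfolding distr_spherical_shape[OF phi]
    by (intro density_cong) (auto intro!: borel_measurable_times_ennreal Jdens_borel measurable_compose[OF shape_density_borel])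
qed

lemma distr_uniform_Omega5:
  "distr uniform_Omega5 borel (\<lambda>u. (psum 3 u, psum 4 u)) = density lborel (\<lambda>z. ennreal (shape_density z))"
proof -
  \<comment> \<open>The cylinder is described by its mean lying in \<open>[-1, 1]\<close> and its
    squared norm being at most 1, so its uniform law has a density of the required form.\<close>
  define \<phi> :: "real \<times> real \<Rightarrow> ennreal" where
    "\<phi> z = indicator {-1..1} (fst z) * indicator {..1} (snd z) / emeasure lborel cylinder5" for z
  have phi: "\<phi> \<in> borel_measurable borel"
    unfolding \<phi>_def borel_prod[symmetric] by measurable
  have ind: "indicator cylinder5 x = (indicator {-1..1} (mean5 x) * indicator {..1} ((norm (centred x))\<^sup>2) :: ennreal)" for x
    using abs_square_le_1[of "norm (centred x)"] by (auto simp: cylinder5_def indicator_def abs_le_iff)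
  have u: "uniform_measure lborel cylinder5 = spherical \<phi>"
    unfolding uniform_measure_def spherical_def \<phi>_def ind by simp
  have "distr uniform_Omega5 borel (\<lambda>u. (psum 3 u, psum 4 u)) = distr (spherical \<phi>) borel shape"
    unfolding uniform_Omega5_def u
    by (subst distr_distr) (auto simp: comp_def shape_def[abs_def] borel_prod[symmetric] spherical_def)
  also have "\<dots> = density lborel (\<lambda>z. ennreal (shape_density z))"
    using phi prob_space_uniform_cylinder5 unfolding u by (rule distr_spherical_shape_density)
  finally show ?thesis .
qed

subsection \<open>Legendre's reduction of the fibre integral\<close>

text \<open>\<open>t\<close> is the Moebius map sending \<open>s = 0\<close> to \<open>r2\<close>
  and infinity to \<open>r1\<close>; \<kappa> is fixed by \<open>s = 1\<close> going to
  \<open>r3\<close>. The preimage of \<open>r4\<close> is then \<open>1 / m\<close>, so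
  \<open>m\<close> is a cross ratio of the four points.\<close>

lemma elliptic_substitution:
  fixes r1 r2 r3 r4 s :: real
  assumes r: "r1 < r2" "r2 < r3" "r3 < r4" and s: "0 < s" "s < 1"
  defines "\<kappa> \<equiv> (r3 - r2) / (r3 - r1)" and "m \<equiv> (r3 - r2) * (r4 - r1) / ((r3 - r1) * (r4 - r2))"
  defines "t \<equiv> (r2 - r1 * \<kappa> * s) / (1 - \<kappa> * s)"
  shows "(t - r1) * (t - r2) * (r3 - t) * (r4 - t) =
    (r2 - r1)^2 * (r3 - r2)^2 * (r4 - r2) * s * (1 - s) * (1 - m * s) / ((r3 - r1) * (1 - \<kappa> * s) ^ 4)"
proof -
  have d: "1 - \<kappa> * s > 0"
  proof -
    have "\<kappa> < 1" "\<kappa> > 0" using r by (auto simp: \<kappa>_def)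
    hence "\<kappa> * s < 1 * 1" using s by (intro mult_strict_mono) auto
    thus ?thesis by simp
  qed
  have k: "\<kappa> * (r3 - r1) = r3 - r2" using r by (simp add: \<kappa>_def)
  have m: "m * ((r3 - r1) * (r4 - r2)) = (r3 - r2) * (r4 - r1)" using r by (simp add: m_def)
  have 1: "t - r1 = (r2 - r1) / (1 - \<kappa> * s)" using d by (simp add: t_def field_simps)
  have 2: "t - r2 = \<kappa> * s * (r2 - r1) / (1 - \<kappa> * s)" using d by (simp add: t_def field_simps)
  have "r3 - t = (r3 - r2 - s * (\<kappa> * (r3 - r1))) / (1 - \<kappa> * s)" using d by (simp add: t_def field_simps)
  hence 3: "r3 - t = (r3 - r2) * (1 - s) / (1 - \<kappa> * s)" unfolding k by (simp add: algebra_simps)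
  have "r4 - t = ((r4 - r2) - (\<kappa> * s) * (r4 - r1)) / (1 - \<kappa> * s)" using d by (simp add: t_def field_simps)
  also have "\<kappa> * (r4 - r1) = m * (r4 - r2)" using r by (simp add: \<kappa>_def m_def)
  hence "(r4 - r2) - (\<kappa> * s) * (r4 - r1) = (r4 - r2) * (1 - m * s)" by algebra
  finally have 4: "r4 - t = (r4 - r2) * (1 - m * s) / (1 - \<kappa> * s)" .
  have "(t - r1) * (t - r2) * (r3 - t) * (r4 - t) =
    (r2 - r1)^2 * (\<kappa> * (r3 - r2)) * (r4 - r2) * s * (1 - s) * (1 - m * s) / (1 - \<kappa> * s) ^ 4"
    unfolding 1 2 3 4 by (simp add: power_numeral_reduce mult_ac)
  also have "\<kappa> * (r3 - r2) = (r3 - r2)^2 / (r3 - r1)" by (simp add: \<kappa>_def power2_eq_square)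
  finally show ?thesis by (simp add: mult_ac)
qed

text \<open>Extracts the perfect square from the radicand, leaving only the elliptic factor
  \<open>E\<close> and a constant under the root.\<close>

lemma square_factor:
  fixes x y z S C E Y D :: real
  assumes "Y \<noteq> 0"
  shows "x^2 * y^2 * z * S^2 * C^2 * E / (Y * D^4) = (x * y * S * C / (Y * D^2))^2 * (Y * z * E)"
  using assms by (simp add: power_mult_distrib power_divide power_mult[symmetric] power2_eq_square[of Y])

text \<open>The Moebius map composed with \<open>s = sin^2 \<phi>\<close>: then
  \<open>s * (1 - s)\<close> is a square, and the derivative of the substitution cancels everything
  outside the root up to the factor 2.\<close>

lemma ellipticK_fibre_integral:
  fixes r1 r2 r3 r4 :: real
  assumes r: "r1 < r2" "r2 < r3" "r3 < r4"
  shows "(\<integral>\<^sup>+c. ennreal (1 / sqrt ((c - r1) * (c - r2) * (r3 - c) * (r4 - c))) * indicator {r2..r3} c \<partial>lborel) =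
    ennreal (2 * ellipticK ((r3 - r2) * (r4 - r1) / ((r3 - r1) * (r4 - r2))) / sqrt ((r3 - r1) * (r4 - r2)))"
proof -
  define \<kappa> where "\<kappa> = (r3 - r2) / (r3 - r1)"
  define m where "m = (r3 - r2) * (r4 - r1) / ((r3 - r1) * (r4 - r2))"
  define f where "f c = 1 / sqrt ((c - r1) * (c - r2) * (r3 - c) * (r4 - c))" for c
  define g where "g \<phi> = (r2 - r1 * \<kappa> * (sin \<phi>)\<^sup>2) / (1 - \<kappa> * (sin \<phi>)\<^sup>2)" for \<phi>
  define g' where "g' \<phi> = 2 * \<kappa> * (r2 - r1) * sin \<phi> * cos \<phi> / (1 - \<kappa> * (sin \<phi>)\<^sup>2)\<^sup>2" for \<phi>
  have k: "0 < \<kappa>" "\<kappa> < 1" using r by (auto simp: \<kappa>_def)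
  \<comment> \<open>Shows \<open>m < 1\<close>, which keeps the integrand of the complete elliptic
    integral continuous up to \<open>pi/2\<close>.\<close>
  have "1 - m = (r2 - r1) * (r4 - r3) / ((r3 - r1) * (r4 - r2))"
  proof -
    have "(r2 - r1) * (r4 - r3) = (r3 - r1) * (r4 - r2) - (r3 - r2) * (r4 - r1)" by algebra
    thus ?thesis using r by (simp add: m_def diff_divide_distrib)
  qed
  hence m: "m < 1" "0 < m"
  proof -
    show "0 < m" using r by (simp add: m_def)
    have "0 < (r2 - r1) * (r4 - r3) / ((r3 - r1) * (r4 - r2))" using r by simp
    thus "m < 1" unfolding \<open>1 - m = _\<close>[symmetric] by simp
  qed
  have sin1: "(sin \<phi>)\<^sup>2 \<le> 1" for \<phi> :: real by (simp add: abs_square_le_1)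
  have d: "1 - x * (sin \<phi>)\<^sup>2 > 0" if "x < 1" for x \<phi> :: real
  proof (cases "x \<le> 0")
    case True
    hence "x * (sin \<phi>)\<^sup>2 \<le> 0" by (simp add: mult_le_0_iff)
    thus ?thesis by linarith
  next
    case False
    hence "x * (sin \<phi>)\<^sup>2 \<le> x * 1" using sin1 by (intro mult_left_mono) auto
    thus ?thesis using that by linarith
  qed
  have deriv: "(g has_real_derivative g' \<phi>) (at \<phi>)" for \<phi>
  proof -
    define S C where "S = sin \<phi>" and "C = cos \<phi>"
    have D: "1 - \<kappa> * S\<^sup>2 \<noteq> 0" using d[OF k(2), of \<phi>] by (simp add: S_def)
    have "(g has_real_derivative ((- (r1 * \<kappa> * (2 * S * C))) * (1 - \<kappa> * S\<^sup>2) -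
        (r2 - r1 * \<kappa> * S\<^sup>2) * (- (\<kappa> * (2 * S * C)))) / ((1 - \<kappa> * S\<^sup>2) * (1 - \<kappa> * S\<^sup>2))) (at \<phi>)"
      unfolding g_def using D by (auto intro!: derivative_eq_intros simp: S_def C_def)
    also have "(- (r1 * \<kappa> * (2 * S * C))) * (1 - \<kappa> * S\<^sup>2) -
        (r2 - r1 * \<kappa> * S\<^sup>2) * (- (\<kappa> * (2 * S * C))) = 2 * \<kappa> * (r2 - r1) * S * C"
      by algebra
    finally show ?thesis by (simp add: g'_def S_def C_def power2_eq_square)
  qed
  have g0: "g 0 = r2" by (simp add: g_def)
  have g1: "g (pi/2) = r3"
  proof -
    have "\<kappa> * (r3 - r1) = r3 - r2" using r by (simp add: \<kappa>_def)
    hence "r2 - r1 * \<kappa> = r3 * (1 - \<kappa>)" by algebra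
    thus ?thesis using k by (simp add: g_def)
  qed
  have "(\<integral>\<^sup>+c. ennreal (f c) * indicator {r2..r3} c \<partial>lborel) = (\<integral>\<^sup>+c. ennreal (f c) * indicator {g 0..g (pi/2)} c \<partial>lborel)"
    by (simp add: g0 g1)
  also have "\<dots> = (\<integral>\<^sup>+\<phi>. ennreal (f (g \<phi>)) * ennreal (g' \<phi>) * indicator {0..pi/2} \<phi> \<partial>lborel)"
  proof (rule nn_integral_substitution_aux)
    show "(\<lambda>c. ennreal (f c)) \<in> borel_measurable borel" unfolding f_def by measurable
    show "continuous_on {0..pi/2} g'"
      unfolding g'_def using d[OF k(2)] by (intro continuous_intros) (metis less_irrefl power_zero_numeral zero_eq_power2)
    show "g' x \<ge> 0" if "x \<in> {0..pi/2}" for x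
      unfolding g'_def using k r that by (auto intro!: divide_nonneg_nonneg mult_nonneg_nonneg sin_ge_zero cos_ge_zero)
  qed (use deriv in auto)
  also have "\<dots> = (\<integral>\<^sup>+\<phi>. ennreal (2 / sqrt ((r3 - r1) * (r4 - r2)) * (1 - m * (sin \<phi>)\<^sup>2) powr (- 1/2)) * indicator {0..pi/2} \<phi> \<partial>lborel)"
  proof (rule nn_integral_cong_AE)
    \<comment> \<open>At both endpoints the left integrand is 0, by division by zero and since
      \<open>g'\<close> vanishes, while the right one is positive; the identity holds only in
      between.\<close>
    have "AE \<phi> in lborel. \<phi> \<noteq> (0::real)" "AE \<phi> in lborel. \<phi> \<noteq> pi/2"
      by (rule AE_lborel_singleton)+
    thus "AE \<phi> in lborel. ennreal (f (g \<phi>)) * ennreal (g' \<phi>) * indicator {0..pi/2} \<phi> =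
      ennreal (2 / sqrt ((r3 - r1) * (r4 - r2)) * (1 - m * (sin \<phi>)\<^sup>2) powr (- 1/2)) * indicator {0..pi/2} \<phi>"
    proof eventually_elim
      fix \<phi> :: real assume ne: "\<phi> \<noteq> 0" "\<phi> \<noteq> pi/2"
      show "ennreal (f (g \<phi>)) * ennreal (g' \<phi>) * indicator {0..pi/2} \<phi> =
        ennreal (2 / sqrt ((r3 - r1) * (r4 - r2)) * (1 - m * (sin \<phi>)\<^sup>2) powr (- 1/2)) * indicator {0..pi/2} \<phi>"
      proof (cases "\<phi> \<in> {0..pi/2}")
        case True
        hence ph: "0 < \<phi>" "\<phi> < pi/2" using ne by auto
        define S C D E where "S = sin \<phi>" and "C = cos \<phi>" and "D = 1 - \<kappa> * S\<^sup>2" and "E = 1 - m * S\<^sup>2"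
        have S: "S > 0" using ph unfolding S_def by (intro sin_gt_zero) auto
        have C: "C > 0" using ph unfolding C_def by (intro cos_gt_zero) auto
        have SC: "1 - S\<^sup>2 = C\<^sup>2" unfolding S_def C_def by (simp add: cos_squared_eq)
        have D: "D > 0" and E: "E > 0" unfolding D_def E_def S_def using d k m by auto
        have s: "0 < S\<^sup>2" "S\<^sup>2 < 1" using S C SC zero_less_power[OF C, of 2] zero_less_power[OF S, of 2] by linarith+
        have "(g \<phi> - r1) * (g \<phi> - r2) * (r3 - g \<phi>) * (r4 - g \<phi>) =
          (r2 - r1)^2 * (r3 - r2)^2 * (r4 - r2) * S\<^sup>2 * (1 - S\<^sup>2) * E / ((r3 - r1) * D ^ 4)"
          using elliptic_substitution[OF r s] unfolding g_def S_def D_def E_def \<kappa>_def m_def .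
        also have "\<dots> = ((r2 - r1) * (r3 - r2) * S * C / ((r3 - r1) * D^2))^2 * ((r3 - r1) * (r4 - r2) * E)"
          unfolding SC using r by (intro square_factor) simp
        finally have "sqrt ((g \<phi> - r1) * (g \<phi> - r2) * (r3 - g \<phi>) * (r4 - g \<phi>)) =
          (r2 - r1) * (r3 - r2) * S * C / ((r3 - r1) * D^2) * (sqrt ((r3 - r1) * (r4 - r2)) * sqrt E)"
          using r S C D by (simp add: real_sqrt_mult)
        moreover have "g' \<phi> = 2 * ((r2 - r1) * (r3 - r2) * S * C / ((r3 - r1) * D^2))"
          unfolding g'_def S_def[symmetric] C_def[symmetric] D_def[symmetric] by (simp add: \<kappa>_def mult_ac)
        moreover have "(r2 - r1) * (r3 - r2) * S * C / ((r3 - r1) * D^2) \<noteq> 0"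
          using r S C D by simp
        ultimately have "f (g \<phi>) * g' \<phi> = 2 / (sqrt ((r3 - r1) * (r4 - r2)) * sqrt E)"
          unfolding f_def by simp
        also have "\<dots> = 2 / sqrt ((r3 - r1) * (r4 - r2)) * E powr (- 1/2)"
          using E by (simp add: powr_minus_divide powr_half_sqrt)
        finally have "f (g \<phi>) * g' \<phi> = 2 / sqrt ((r3 - r1) * (r4 - r2)) * (1 - m * (sin \<phi>)\<^sup>2) powr (- 1/2)"
          by (simp add: E_def S_def)
        moreover have "g' \<phi> \<ge> 0"
          unfolding g'_def using k r S C by (simp add: S_def C_def)
        ultimately show ?thesis using True by (simp add: ennreal_mult''[symmetric])
      qed simp
    qed
  qed
  also have "\<dots> = ennreal (integral {0..pi/2} (\<lambda>\<phi>. 2 / sqrt ((r3 - r1) * (r4 - r2)) * (1 - m * (sin \<phi>)\<^sup>2) powr (- 1/2)))"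
  proof -
    have "continuous_on {0..pi/2} (\<lambda>\<phi>. 2 / sqrt ((r3 - r1) * (r4 - r2)) * (1 - m * (sin \<phi>)\<^sup>2) powr (- 1/2))"
      using d[OF m(1)] by (intro continuous_intros) (metis less_irrefl)+
    hence i: "(\<lambda>\<phi>. 2 / sqrt ((r3 - r1) * (r4 - r2)) * (1 - m * (sin \<phi>)\<^sup>2) powr (- 1/2)) integrable_on {0..pi/2}"
      by (rule integrable_continuous_real)
    show ?thesis
      using r by (intro nn_integral_has_integral_lebesgue' integrable_integral[OF i]) auto
  qed
  also have "integral {0..pi/2} (\<lambda>\<phi>. 2 / sqrt ((r3 - r1) * (r4 - r2)) * (1 - m * (sin \<phi>)\<^sup>2) powr (- 1/2)) =
    2 * ellipticK m / sqrt ((r3 - r1) * (r4 - r2))"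
    unfolding integral_mult_right ellipticK_def by simp
  finally show ?thesis unfolding f_def m_def .
qed

subsection \<open>Normal samples\<close>

lemma vec_lambda_5: "(\<chi> i. f i) = vec5 (f 0) (f 1) (f 2) (f 3) (f 4)"
  by (simp add: vec_eq_iff forall_5)

lemma distr_PiM_lborel_vec:
  "distr (\<Pi>\<^sub>M i\<in>UNIV. lborel) borel (\<lambda>f. \<chi> i. f i) = (lborel :: (real^5) measure)"
proof (rule lborel_eqI[symmetric])
  interpret product_sigma_finite "\<lambda>_::5. lborel :: real measure" by standard
  have m: "(\<lambda>f. \<chi> i. f i) \<in> measurable (\<Pi>\<^sub>M i\<in>(UNIV :: 5 set). lborel :: real measure) borel"
    unfolding vec_lambda_5 by measurable
  fix l u :: "real^5" assume le: "\<And>b. b \<in> Basis \<Longrightarrow> l \<bullet> b \<le> u \<bullet> b"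
  have le': "l $ i \<le> u $ i" for i using le[of "axis i 1"] by (simp add: inner_axis)
  have "(\<lambda>f. \<chi> i. f i) -` box l u \<inter> space (\<Pi>\<^sub>M i\<in>(UNIV :: 5 set). lborel :: real measure) = (\<Pi>\<^sub>E i\<in>UNIV. {l$i<..<u$i})"
    by (auto simp: mem_box_cart space_PiM PiE_UNIV_domain Pi_iff)
  hence "emeasure (distr (\<Pi>\<^sub>M i\<in>UNIV. lborel) borel (\<lambda>f. \<chi> i. f i)) (box l u) =
    emeasure (\<Pi>\<^sub>M i\<in>UNIV. lborel) (\<Pi>\<^sub>E i\<in>UNIV. {l$i<..<u$i})"
    using m by (simp add: emeasure_distr)
  also have "\<dots> = (\<Prod>i\<in>UNIV. emeasure lborel {l$i<..<u$i})"
    by (intro emeasure_PiM) auto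
  also have "\<dots> = (\<Prod>i\<in>UNIV. ennreal ((u - l) $ i))"
    using le' by simp
  also have "\<dots> = ennreal (\<Prod>i\<in>UNIV. (u - l) $ i)"
    using le' by (intro prod_ennreal) simp
  also have "(\<Prod>i\<in>UNIV. (u - l) $ i) = (\<Prod>b\<in>Basis. (u - l) \<bullet> b)"
    by (simp add: Basis_vec_def UNION_singleton_eq_range prod.reindex inj_on_def axis_eq_axis inner_axis)
  finally show "emeasure (distr (\<Pi>\<^sub>M i\<in>UNIV. lborel) borel (\<lambda>f. \<chi> i. f i)) (box l u) = (\<Prod>b\<in>Basis. (u - l) \<bullet> b)" .
qed simp

lemma PiM_density:
  fixes g :: "'i::finite \<Rightarrow> real \<Rightarrow> ennreal"
  assumes [measurable]: "\<And>i. g i \<in> borel_measurable borel"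
    and fin: "\<And>i. sigma_finite_measure (density lborel (g i))"
  shows "(\<Pi>\<^sub>M i\<in>UNIV. density lborel (g i)) = density (\<Pi>\<^sub>M i\<in>UNIV. lborel) (\<lambda>x. \<Prod>i\<in>UNIV. g i (x i))"
proof (rule product_sigma_finite.PiM_eqI[symmetric])
  show "product_sigma_finite (\<lambda>i. density lborel (g i))"
    using fin by (simp add: product_sigma_finite_def)
  interpret L: product_sigma_finite "\<lambda>_::'i. lborel :: real measure" by standard
  show "sets (density (\<Pi>\<^sub>M i\<in>UNIV. lborel) (\<lambda>x. \<Prod>i\<in>UNIV. g i (x i))) = sets (\<Pi>\<^sub>M i\<in>UNIV. density lborel (g i))"
    by (auto intro!: sets_PiM_cong)
  fix A :: "'i \<Rightarrow> real set" assume "\<And>i. i \<in> UNIV \<Longrightarrow> A i \<in> sets (density lborel (g i))"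
  hence A [measurable]: "A i \<in> sets borel" for i by simp
  have "emeasure (density (\<Pi>\<^sub>M i\<in>UNIV. lborel) (\<lambda>x. \<Prod>i\<in>UNIV. g i (x i))) (\<Pi>\<^sub>E i\<in>UNIV. A i) =
    (\<integral>\<^sup>+x. (\<Prod>i\<in>UNIV. g i (x i)) * indicator (\<Pi>\<^sub>E i\<in>UNIV. A i) x \<partial>(\<Pi>\<^sub>M i\<in>UNIV. lborel))"
    by (subst emeasure_density) (auto intro!: sets_PiM_I_finite)
  also have "\<dots> = (\<integral>\<^sup>+x. (\<Prod>i\<in>UNIV. g i (x i) * indicator (A i) (x i)) \<partial>(\<Pi>\<^sub>M i\<in>UNIV. lborel))"
    by (intro nn_integral_cong) (auto simp: prod.distrib indicator_def PiE_iff)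
  also have "\<dots> = (\<Prod>i\<in>UNIV. \<integral>\<^sup>+x. g i x * indicator (A i) x \<partial>lborel)"
    by (intro L.product_nn_integral_prod) auto
  also have "\<dots> = (\<Prod>i\<in>UNIV. emeasure (density lborel (g i)) (A i))"
    by (simp add: emeasure_density)
  finally show "emeasure (density (\<Pi>\<^sub>M i\<in>UNIV. lborel) (\<lambda>x. \<Prod>i\<in>UNIV. g i (x i))) (\<Pi>\<^sub>E i\<in>UNIV. A i) =
    (\<Prod>i\<in>UNIV. emeasure (density lborel (g i)) (A i))" .
qed simp

lemma distr_normal_sample:
  fixes X :: "5 \<Rightarrow> 'm \<Rightarrow> real"
  assumes M: "prob_space M" and \<sigma>: "\<sigma> > 0"
    and indep: "prob_space.indep_vars M (\<lambda>_. borel) X UNIV"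
    and X: "\<And>i. distributed M lborel (X i) (\<lambda>x. ennreal (normal_density \<mu> \<sigma> x))"
  shows "(\<lambda>\<omega>. \<chi> i. X i \<omega>) \<in> borel_measurable M"
    and "distr M borel (\<lambda>\<omega>. \<chi> i. X i \<omega>) = spherical (normal_weight \<mu> \<sigma>)"
proof -
  interpret prob_space M by fact
  let ?n = "\<lambda>x. ennreal (normal_density \<mu> \<sigma> x)"
  have rv [measurable]: "X i \<in> borel_measurable M" for i
    using X[of i] by (simp add: distributed_def)
  have d: "distr M borel (X i) = density lborel ?n" for i
    using X[of i] by (simp add: distributed_def cong: distr_cong)
  show Y: "(\<lambda>\<omega>. \<chi> i. X i \<omega>) \<in> borel_measurable M"
    unfolding vec_lambda_5 by measurable
  have "distr M (\<Pi>\<^sub>M i\<in>UNIV. borel) (\<lambda>\<omega>. \<lambda>i\<in>UNIV. X i \<omega>) = (\<Pi>\<^sub>M i\<in>UNIV. distr M borel (X i))"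
    using indep rv by (subst indep_vars_iff_distr_eq_PiM[symmetric]) auto
  also have "\<dots> = density (\<Pi>\<^sub>M i\<in>UNIV. lborel) (\<lambda>x. \<Prod>i\<in>UNIV. ?n (x i))"
    unfolding d using prob_space_normal_density[OF \<sigma>]
    by (intro PiM_density) (auto simp: prob_space_imp_sigma_finite)
  finally have joint: "distr M (\<Pi>\<^sub>M i\<in>UNIV. borel) (\<lambda>\<omega>. \<lambda>i\<in>UNIV. X i \<omega>) =
    density (\<Pi>\<^sub>M i\<in>UNIV. lborel) (\<lambda>x. \<Prod>i\<in>UNIV. ?n (x i))" .
  have V [measurable]: "(\<lambda>f. \<chi> i. f i) \<in> measurable (\<Pi>\<^sub>M i\<in>(UNIV :: 5 set). borel :: real measure) borel"
    unfolding vec_lambda_5 by measurable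
  have VL: "(\<lambda>f. \<chi> i. f i) \<in> measurable (\<Pi>\<^sub>M i\<in>(UNIV :: 5 set). lborel :: real measure) borel"
    unfolding vec_lambda_5 by measurable
  have "distr M borel (\<lambda>\<omega>. \<chi> i. X i \<omega>) =
    distr (distr M (\<Pi>\<^sub>M i\<in>UNIV. borel) (\<lambda>\<omega>. \<lambda>i\<in>UNIV. X i \<omega>)) borel (\<lambda>f. \<chi> i. f i)"
  proof -
    have R: "(\<lambda>\<omega>. \<lambda>i\<in>UNIV. X i \<omega>) \<in> measurable M (\<Pi>\<^sub>M i\<in>UNIV. borel)" by measurable
    show ?thesis unfolding distr_distr[OF V R] by (simp add: comp_def restrict_UNIV)
  qed
  also have "\<dots> = distr (density (\<Pi>\<^sub>M i\<in>UNIV. lborel) (\<lambda>f. \<Prod>i\<in>UNIV. ?n ((\<chi> i. f i) $ i))) borel (\<lambda>f. \<chi> i. f i)"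
    unfolding joint by simp
  also have "\<dots> = density (distr (\<Pi>\<^sub>M i\<in>UNIV. lborel) borel (\<lambda>f. \<chi> i. f i)) (\<lambda>x. \<Prod>i\<in>UNIV. ?n (x $ i))"
    using VL by (intro density_distr[symmetric]) auto
  also have "\<dots> = spherical (normal_weight \<mu> \<sigma>)"
    by (simp add: distr_PiM_lborel_vec spherical_normal)
  finally show "distr M borel (\<lambda>\<omega>. \<chi> i. X i \<omega>) = spherical (normal_weight \<mu> \<sigma>)" .
qed

text \<open>With \<open>n\<close> the norm of the centred sample, the second moment is
  \<open>n^2 / 5\<close>; its powers 3/2 and 2, together with the division by 5 in the other
  moments, give the factors \<open>sqrt 5\<close> and 5.\<close>

lemma skewness_kurtosis_shape:
  "(skewness5 x, kurtosis5 x) = (sqrt 5 * fst (shape x), 5 * snd (shape x))"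
proof -
  define n where "n = norm (centred x)"
  have m: "sample_moment r x = psum r (centred x) / 5" for r
    by (simp add: sample_moment_def psum_def centred_def)
  have s: "psum r (sgn (centred x)) = psum r (centred x) / n ^ r" for r
    by (simp add: psum_5 sgn_div_norm n_def power_mult_distrib power_inverse divide_inverse algebra_simps)
  have m2: "sample_moment 2 x = n\<^sup>2 / 5" by (simp add: m n_def norm_psum)
  show ?thesis
  proof (cases "n = 0")
    \<comment> \<open>For a constant sample both sides are 0 by the conventions for division by zero
      and \<open>sgn 0\<close>.\<close>
    case True
    thus ?thesis
      by (simp add: skewness5_def kurtosis5_def m2 shape_def s)
  next
    case False
    hence n: "n > 0" by (simp add: n_def)
    have "(n\<^sup>2 / 5) powr (3/2) = sqrt (n\<^sup>2 / 5) ^ 3"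
      using n by (simp add: powr_half_sqrt[symmetric] powr_power)
    also have "sqrt (n\<^sup>2 / 5) = n / sqrt 5" using n by (simp add: real_sqrt_divide)
    finally have p: "(n\<^sup>2 / 5) powr (3/2) = n ^ 3 / (5 * sqrt 5)"
      by (simp add: power_divide power3_eq_cube)
    have "skewness5 x = sqrt 5 * (psum 3 (centred x) / n ^ 3)"
      unfolding skewness5_def m2 p by (simp add: m)
    moreover have "kurtosis5 x = 5 * (psum 4 (centred x) / n ^ 4)"
      unfolding kurtosis5_def m2 by (simp add: m power_divide power2_eq_square power4_eq_xxxx)
    ultimately show ?thesis by (simp add: shape_def s)
  qed
qed

text \<open>The factor \<open>5 powr (- 3/2)\<close> is the reciprocal Jacobian of scaling the two
  coordinates by \<open>sqrt 5\<close> and 5.\<close>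

lemma five_powr: "sqrt 5 * (5 * 5 powr (- 3/2)) = (1::real)"
proof -
  have "5 powr (3/2 :: real) = 5 powr 1 * 5 powr (1/2)"
    by (simp only: powr_add[symmetric]) simp
  hence "5 powr (- 3/2 :: real) = 1 / (5 * sqrt 5)"
    by (simp add: powr_minus_divide powr_half_sqrt)
  thus ?thesis by simp
qed

lemma distr_scale_density:
  fixes f :: "real \<times> real \<Rightarrow> real"
  assumes f: "f \<in> borel_measurable borel" and nn: "\<And>z. f z \<ge> 0"
  shows "distr (density lborel (\<lambda>z. ennreal (f z))) lborel (\<lambda>z. (sqrt 5 * fst z, 5 * snd z)) =
    density lborel (\<lambda>(s, k). ennreal (5 powr (- 3/2) * f (s / sqrt 5, k / 5)))" (is "distr ?D lborel ?T = density lborel ?g")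
proof -
  define g T K where "g = ?g" and "T = ?T" and "K = (5 :: real) powr (- 3/2)"
  have gv: "g (s, k) = ennreal (K * f (s / sqrt 5, k / 5))" for s k by (simp add: g_def K_def)
  have Tv: "T (a, b) = (sqrt 5 * a, 5 * b)" for a b by (simp add: T_def)
  have fm [measurable]: "f \<in> borel_measurable (borel \<Otimes>\<^sub>M borel)" using f by (simp add: borel_prod)
  have T: "T \<in> measurable borel borel" unfolding T_def borel_prod[symmetric] by measurable
  have g: "g \<in> borel_measurable borel" unfolding g_def borel_prod[symmetric] by measurable
  have c: "sqrt 5 * (5 * (K * x)) = x" for x
    using five_powr unfolding K_def[symmetric] by (simp only: mult.assoc[symmetric] mult_1_left)
  have K: "K \<ge> 0" by (simp add: K_def)
  have "distr ?D lborel T = density lborel g"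
  proof (rule measure_eqI)
    fix A assume "A \<in> sets (distr ?D lborel T)"
    hence A: "A \<in> sets borel" by simp
    define h where "h = (indicator A :: real \<times> real \<Rightarrow> ennreal)"
    have h: "h \<in> borel_measurable borel" unfolding h_def using A by (rule borel_measurable_indicator)
    hence [measurable]: "h \<in> borel_measurable (borel \<Otimes>\<^sub>M borel)" by (simp add: borel_prod)
    have hT: "(\<lambda>z. h (T z)) \<in> borel_measurable borel" using T h by (rule measurable_compose)
    have "emeasure (density lborel g) A = (\<integral>\<^sup>+z. g z * h z \<partial>lborel)"
      unfolding h_def using A g by (intro emeasure_density) simp_all
    also have "\<dots> = (\<integral>\<^sup>+s. \<integral>\<^sup>+k. g (s, k) * h (s, k) \<partial>lborel \<partial>lborel)"
      by (rule nn_integral_lborel_pair[of "\<lambda>z. g z * h z"]) (intro borel_measurable_times_ennreal g h)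
    also have "\<dots> = ennreal (sqrt 5) * (\<integral>\<^sup>+a. \<integral>\<^sup>+k. ennreal (K * f (a, k / 5)) * h (sqrt 5 * a, k) \<partial>lborel \<partial>lborel)"
      unfolding gv by (subst nn_integral_real_affine[where c = "sqrt 5" and t = 0]) auto
    also have "(\<lambda>a. \<integral>\<^sup>+k. ennreal (K * f (a, k / 5)) * h (sqrt 5 * a, k) \<partial>lborel) =
      (\<lambda>a. ennreal 5 * (\<integral>\<^sup>+b. ennreal (K * f (a, b)) * h (T (a, b)) \<partial>lborel))"
      unfolding Tv by (rule ext, subst nn_integral_real_affine[where c = 5 and t = 0]) auto
    also have "ennreal (sqrt 5) * (\<integral>\<^sup>+a. ennreal 5 * (\<integral>\<^sup>+b. ennreal (K * f (a, b)) * h (T (a, b)) \<partial>lborel) \<partial>lborel) =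
      (\<integral>\<^sup>+a. \<integral>\<^sup>+b. ennreal (sqrt 5) * (ennreal 5 * (ennreal (K * f (a, b)) * h (T (a, b)))) \<partial>lborel \<partial>lborel)"
      unfolding Tv by (simp add: nn_integral_cmult)
    also have "\<dots> = (\<integral>\<^sup>+a. \<integral>\<^sup>+b. ennreal (f (a, b)) * h (T (a, b)) \<partial>lborel \<partial>lborel)"
    proof (intro nn_integral_cong)
      fix a b
      have "ennreal (sqrt 5) * (ennreal 5 * ennreal (K * f (a, b))) = ennreal (sqrt 5 * (5 * (K * f (a, b))))"
        using nn K by (simp add: ennreal_mult)
      thus "ennreal (sqrt 5) * (ennreal 5 * (ennreal (K * f (a, b)) * h (T (a, b)))) = ennreal (f (a, b)) * h (T (a, b))"
        unfolding c by (simp only: mult.assoc[symmetric])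
    qed
    also have "\<dots> = (\<integral>\<^sup>+z. ennreal (f z) * h (T z) \<partial>lborel)"
      using f hT by (intro nn_integral_lborel_pair[of "\<lambda>z. ennreal (f z) * h (T z)", symmetric]
        borel_measurable_times_ennreal) auto
    also have "\<dots> = (\<integral>\<^sup>+z. h (T z) \<partial>?D)"
      using f hT by (intro nn_integral_density[symmetric]) auto
    also have "\<dots> = (\<integral>\<^sup>+z. h z \<partial>distr ?D lborel T)"
      using T h by (intro nn_integral_distr[symmetric]) auto
    also have "\<dots> = emeasure (distr ?D lborel T) A"
      unfolding h_def using A by (intro nn_integral_indicator) simp
    finally show "emeasure (distr ?D lborel T) A = emeasure (density lborel g) A" ..
  qed simp
  thus ?thesis unfolding T_def g_def .
qed

lemma distributed_skewness_kurtosis: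
  fixes X :: "5 \<Rightarrow> 'm \<Rightarrow> real"
  assumes "prob_space M" "\<sigma> > 0" "prob_space.indep_vars M (\<lambda>_. borel) X UNIV"
    "\<And>i. distributed M lborel (X i) (\<lambda>x. ennreal (normal_density \<mu> \<sigma> x))"
  shows "distributed M lborel (\<lambda>\<omega>. (skewness5 (\<chi> i. X i \<omega>), kurtosis5 (\<chi> i. X i \<omega>)))
    (\<lambda>(s, k). ennreal (5 powr (- 3/2) * shape_density (s / sqrt 5, k / 5)))"
proof -
  define Y where "Y = (\<lambda>\<omega>. \<chi> i. X i \<omega>)"
  define T where "T = (\<lambda>z :: real \<times> real. (sqrt 5 * fst z, 5 * snd z))"
  define g where "g = (\<lambda>(s, k). ennreal (5 powr (- 3/2) * shape_density (s / sqrt 5, k / 5)))"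
  have Y: "Y \<in> borel_measurable M" "distr M borel Y = spherical (normal_weight \<mu> \<sigma>)"
    unfolding Y_def by (rule distr_normal_sample[OF assms])+
  have T: "T \<in> measurable borel lborel"
    unfolding T_def measurable_lborel1 borel_prod[symmetric] by measurable
  have fm [measurable]: "shape_density \<in> borel_measurable (borel \<Otimes>\<^sub>M borel)"
    using shape_density_borel by (simp add: borel_prod)
  have "g \<in> borel_measurable borel"
    unfolding g_def borel_prod[symmetric] by measurable
  hence g: "g \<in> borel_measurable lborel" by (simp only: measurable_lborel2)
  have sY: "shape \<circ> Y \<in> borel_measurable M"
    using Y(1) shape_borel by (rule measurable_comp)
  have "distr M lborel (T \<circ> (shape \<circ> Y)) = distr (distr (distr M borel Y) borel shape) lborel T"
    unfolding distr_distr[OF shape_borel Y(1)] distr_distr[OF T sY] ..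
  also have "\<dots> = distr (density lborel (\<lambda>z. ennreal (shape_density z))) lborel T"
    unfolding Y(2) distr_spherical_shape_density[OF normal_weight_borel prob_space_spherical_normal[OF assms(2)]] ..
  also have "\<dots> = density lborel g"
    unfolding T_def g_def by (rule distr_scale_density[OF shape_density_borel shape_density_nonneg])
  finally have "distributed M lborel (T \<circ> (shape \<circ> Y)) g"
    using g measurable_comp[OF sY T] by (simp only: distributed_def simp_thms)
  moreover have "T \<circ> (shape \<circ> Y) = (\<lambda>\<omega>. (skewness5 (\<chi> i. X i \<omega>), kurtosis5 (\<chi> i. X i \<omega>)))"
    by (simp only: skewness_kurtosis_shape o_def T_def Y_def)
  ultimately show ?thesis by (simp only: g_def)
qed

subsection \<open>The support\<close>

definition shape_region :: "(real \<times> real) set" where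
  "shape_region = (\<lambda>u. (psum 3 u, psum 4 u)) ` Omega5"

lemma continuous_on_psum [continuous_intros]: "continuous_on S (psum r)"
  unfolding psum_def by (intro continuous_intros)

lemma compact_shape_region: "compact shape_region"
proof -
  have "closed Omega5"
    unfolding Omega5_def by (intro closed_Collect_conj closed_Collect_eq continuous_intros)
  moreover have "norm u \<le> 1" if "u \<in> Omega5" for u
    using Omega5_mean_norm(2)[OF that] by simp
  ultimately have "compact Omega5"
    by (meson bounded_iff compact_eq_bounded_closed)
  thus ?thesis unfolding shape_region_def by (intro compact_continuous_image continuous_intros)
qed

lemma shape_Omega5: "u \<in> Omega5 \<Longrightarrow> r > 0 \<Longrightarrow> shape (r *\<^sub>R u) = (psum 3 u, psum 4 u)"
proof -
  assume u: "u \<in> Omega5" and r: "r > 0"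
  have "centred (r *\<^sub>R u) = r *\<^sub>R u" using Omega5_mean_norm(1)[OF u]
    by (simp add: linear_cmul[OF linear_centred]) (simp add: centred_eq)
  thus ?thesis using r Omega5_mean_norm(2)[OF u] by (simp add: shape_def sgn_div_norm)
qed

lemma emeasure_law_p34: "A \<in> sets borel \<Longrightarrow> emeasure law_p34 A = emeasure (uniform_measure lborel cylinder5) (shape -` A)"
  unfolding law_p34_def uniform_Omega5_def
  by (subst distr_distr) (auto simp: emeasure_distr comp_def shape_def[abs_def] borel_prod[symmetric])

lemma emeasure_lborel_open_pos:
  fixes W :: "'a::euclidean_space set"
  assumes "open W" "W \<noteq> {}"
  shows "emeasure lborel W > 0"
proof (rule ccontr)
  assume "\<not> emeasure lborel W > 0"
  hence "W \<in> null_sets lborel" using assms by (intro null_setsI) auto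
  hence "negligible W" by (simp add: negligible_iff_null_sets null_sets_completionI)
  thus False using open_not_negligible assms by blast
qed

text \<open>The region is closed and carries full mass, so it contains the support. Conversely
  \<open>shape\<close> is continuous off the axis of the cylinder, so every neighbourhood of a point
  of the region has a preimage containing a nonempty open part of the cylinder.\<close>

lemma msupport_law_p34: "msupport law_p34 = shape_region"
proof (rule antisym)
  show "msupport law_p34 \<subseteq> shape_region"
  proof
    fix x assume x: "x \<in> msupport law_p34"
    show "x \<in> shape_region"
    proof (rule ccontr)
      assume "x \<notin> shape_region"
      have op: "open (- shape_region)" using compact_shape_region by (simp add: compact_imp_closed open_Compl)
      hence pos: "emeasure law_p34 (- shape_region) > 0"
        using x \<open>x \<notin> shape_region\<close> by (auto simp: msupport_def)
      have m: "(\<lambda>u. (psum 3 u, psum 4 u)) \<in> borel_measurable borel"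
        unfolding borel_prod[symmetric] by measurable
      have "AE u in uniform_Omega5. (psum 3 u, psum 4 u) \<in> shape_region"
        using AE_uniform_Omega5 by eventually_elim (auto simp: shape_region_def)
      hence "AE z in law_p34. z \<in> shape_region"
        unfolding law_p34_def using m compact_shape_region
        by (subst AE_distr_iff) (auto simp: borel_compact)
      hence "emeasure law_p34 {z \<in> space law_p34. z \<notin> shape_region} = 0"
        using op by (subst (asm) AE_iff_measurable[OF _ refl]) (auto simp: law_p34_def Compl_eq)
      moreover have "{z \<in> space law_p34. z \<notin> shape_region} = - shape_region"
        by (auto simp: law_p34_def)
      ultimately show False using pos by simp
    qed
  qed
next
  show "shape_region \<subseteq> msupport law_p34"
  proof
    fix x assume "x \<in> shape_region"
    then obtain u where u: "u \<in> Omega5" "x = (psum 3 u, psum 4 u)" by (auto simp: shape_region_def)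
    have "emeasure law_p34 V > 0" if V: "open V" "x \<in> V" for V
    proof -
      \<comment> \<open>The interior of the cylinder without its axis, where \<open>sgn\<close> is
        continuous along \<open>centred\<close>.\<close>
      define U where "U = {x. norm (centred x) < 1 \<and> \<bar>mean5 x\<bar> < 1 \<and> centred x \<noteq> 0}"
      define W where "W = U \<inter> shape -` V"
      have "open U"
        unfolding U_def by (intro open_Collect_conj open_Collect_less open_Collect_neq continuous_intros)
      moreover have "continuous_on U shape"
        unfolding shape_def[abs_def] psum_def U_def by (intro continuous_intros) auto
      ultimately have "open W" unfolding W_def using V(1) by (simp add: continuous_open_preimage)
      \<comment> \<open>Halving moves the unit vector \<open>u\<close> from the surface into the
        interior; \<open>shape\<close> ignores positive scalings.\<close>
      moreover have "(1/2) *\<^sub>R u \<in> W"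
      proof -
        note m = Omega5_mean_norm(1)[OF u(1)] and n = Omega5_mean_norm(2)[OF u(1)]
        have c: "centred ((1/2) *\<^sub>R u) = (1/2) *\<^sub>R u"
          using m by (simp add: linear_cmul[OF linear_centred]) (simp add: centred_eq)
        have "mean5 ((1/2) *\<^sub>R u) = 0" using m by (simp add: linear_cmul[OF linear_mean5])
        moreover have "u \<noteq> 0" using n by auto
        ultimately have "(1/2) *\<^sub>R u \<in> U" using n unfolding U_def mem_Collect_eq c by simp
        thus ?thesis using V(2) u shape_Omega5[OF u(1), of "1/2"] by (simp add: W_def)
      qed
      ultimately have W: "emeasure lborel W > 0" by (intro emeasure_lborel_open_pos) auto
      have Wb: "W \<in> sets borel" using \<open>open W\<close> by simp
      have sV: "shape -` V \<in> sets borel" using V(1) by (intro measurable_sets_borel[OF shape_borel]) simp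
      have "emeasure (uniform_measure lborel cylinder5) W = emeasure lborel (cylinder5 \<inter> W) / emeasure lborel cylinder5"
        using Wb by (intro emeasure_uniform_measure) auto
      also have "cylinder5 \<inter> W = W" by (auto simp: W_def U_def cylinder5_def)
      also have "emeasure lborel W / emeasure lborel cylinder5 > 0"
        using W emeasure_cylinder5_finite by (simp add: ennreal_zero_less_divide top.not_eq_extremum)
      finally have "0 < emeasure (uniform_measure lborel cylinder5) W" .
      also have "\<dots> \<le> emeasure (uniform_measure lborel cylinder5) (shape -` V)"
        using sV by (intro emeasure_mono) (auto simp: W_def)
      finally show ?thesis using V(1) by (simp add: emeasure_law_p34)
    qed
    thus "x \<in> msupport law_p34" by (auto simp: msupport_def)
  qed
qed

subsection \<open>Critical points of the quintic\<close>

lemma linprod_mset_eq: "mset us = mset vs \<Longrightarrow> linprod us = linprod vs"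
  unfolding linprod_def by (metis mset_map prod_mset_prod_list)

lemma poly_P5: "poly (P5 a b c) z = poly (Rpoly a b) z - (c / 5 - a / 6)"
  by (simp add: P5_def)

lemma poly_Rpoly: "poly (Rpoly a b) z = z^5 - z^3 / 2 - a * z^2 / 3 + (1 - 2 * b) * z / 8"
  by (simp add: Rpoly_def power_numeral_reduce algebra_simps)

lemma pderiv_P5: "pderiv (P5 a b c) = pderiv (Rpoly a b)"
  by (simp add: P5_def pderiv_diff pderiv_pCons)

lemma degree_P5: "degree (P5 a b c) = 5" and lead_coeff_P5: "lead_coeff (P5 a b c) = 1"
  by (simp_all add: P5_eq)

lemma pderiv_Rpoly: "pderiv (Rpoly a b) = [:(1 - 2 * b) / 8, - 2 * a / 3, - 3 / 2, 0, 5:]"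
  by (simp add: Rpoly_def pderiv_pCons)

lemma proots_pderiv_Rpoly_iff:
  "proots (pderiv (Rpoly a b)) = {#w1, w2, w3, w4#} \<longleftrightarrow> pderiv (Rpoly a b) = smult 5 (linprod [w1, w2, w3, w4])"
proof
  assume eq: "proots (pderiv (Rpoly a b)) = {#w1, w2, w3, w4#}"
  have "pderiv (Rpoly a b) = smult (lead_coeff (pderiv (Rpoly a b))) (linprod [w1, w2, w3, w4])"
    by (rule linprod_eqI) (simp_all add: eq, simp_all add: pderiv_Rpoly)
  thus "pderiv (Rpoly a b) = smult 5 (linprod [w1, w2, w3, w4])" by (simp add: pderiv_Rpoly)
next
  assume eq: "pderiv (Rpoly a b) = smult 5 (linprod [w1, w2, w3, w4])"
  have "proots (pderiv (Rpoly a b)) = mset [w1, w2, w3, w4]"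
    unfolding eq by (metis proots_linprod proots_smult zero_neq_numeral)
  thus "proots (pderiv (Rpoly a b)) = {#w1, w2, w3, w4#}" by simp
qed

lemma shape_region_quintic:
  "(a, b) \<in> shape_region \<longleftrightarrow> (\<exists>c u1 u2 u3 u4 u5. u1 \<le> u2 \<and> u2 \<le> u3 \<and> u3 \<le> u4 \<and> u4 \<le> u5 \<and>
    P5 a b c = linprod [u1, u2, u3, u4, u5])" (is "_ \<longleftrightarrow> ?R")
proof
  assume "(a, b) \<in> shape_region"
  then obtain u where u: "u \<in> Omega5" "psum 3 u = a" "psum 4 u = b" by (auto simp: shape_region_def)
  have P: "P5 a b (psum 5 u) = linprod [u$0, u$1, u$2, u$3, u$4]"
    unfolding P5_eq_linprod_iff using u psum_5[of 1 u] by (auto simp: Omega5_def psum_5)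
  define us where "us = sort [u$0, u$1, u$2, u$3, u$4]"
  have ms: "mset us = mset [u$0, u$1, u$2, u$3, u$4]" unfolding us_def by (rule mset_sort)
  have "length us = 5" unfolding us_def by simp
  then obtain u1 u2 u3 u4 u5 where us: "us = [u1, u2, u3, u4, u5]"
    by (auto simp: numeral_eq_Suc length_Suc_conv)
  have "sorted us" unfolding us_def by (rule sorted_sort)
  moreover have "P5 a b (psum 5 u) = linprod us" unfolding P by (rule linprod_mset_eq[OF ms[symmetric]])
  ultimately have "u1 \<le> u2 \<and> u2 \<le> u3 \<and> u3 \<le> u4 \<and> u4 \<le> u5 \<and> P5 a b (psum 5 u) = linprod [u1, u2, u3, u4, u5]"
    unfolding us by simp
  thus ?R by (intro exI)
next
  assume ?R
  then obtain c u1 u2 u3 u4 u5 where "P5 a b c = linprod [u1, u2, u3, u4, u5]" by auto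
  hence "vec5 u1 u2 u3 u4 u5 \<in> Omega5 \<and> psum 3 (vec5 u1 u2 u3 u4 u5) = a \<and> psum 4 (vec5 u1 u2 u3 u4 u5) = b"
    unfolding P5_eq_linprod_iff by (simp add: Omega5_def psum_5)
  thus "(a, b) \<in> shape_region" unfolding shape_region_def by force
qed

text \<open>Eliminates the unknown fifth power sum: by \<open>rolle_quintic\<close> and its converse
  a suitable level exists exactly if no critical value with even index exceeds one with odd
  index.\<close>

lemma shape_region_critical:
  "(a, b) \<in> shape_region \<longleftrightarrow> (\<exists>w1 w2 w3 w4. pderiv (Rpoly a b) = smult 5 (linprod [w1, w2, w3, w4]) \<and>
    w1 \<le> w2 \<and> w2 \<le> w3 \<and> w3 \<le> w4 \<and>
    max (poly (Rpoly a b) w2) (poly (Rpoly a b) w4) \<le> min (poly (Rpoly a b) w1) (poly (Rpoly a b) w3))"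
    (is "_ \<longleftrightarrow> ?R")
proof
  assume "(a, b) \<in> shape_region"
  then obtain c u1 u2 u3 u4 u5 where u: "u1 \<le> u2" "u2 \<le> u3" "u3 \<le> u4" "u4 \<le> u5"
    and P: "P5 a b c = linprod [u1, u2, u3, u4, u5]" unfolding shape_region_quintic by auto
  obtain w1 w2 w3 w4 where w: "u1 \<le> w1" "w1 \<le> u2" "u2 \<le> w2" "w2 \<le> u3" "u3 \<le> w3" "w3 \<le> u4" "u4 \<le> w4" "w4 \<le> u5"
    and d: "pderiv (P5 a b c) = smult 5 (linprod [w1, w2, w3, w4])"
    using rolle_quintic[OF u] unfolding P by metis
  have "poly (P5 a b c) w1 \<ge> 0" "poly (P5 a b c) w2 \<le> 0" "poly (P5 a b c) w3 \<ge> 0" "poly (P5 a b c) w4 \<le> 0"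
    unfolding P using w u by (auto simp: zero_le_mult_iff mult_le_0_iff)
  hence "pderiv (Rpoly a b) = smult 5 (linprod [w1, w2, w3, w4]) \<and> w1 \<le> w2 \<and> w2 \<le> w3 \<and> w3 \<le> w4 \<and>
    max (poly (Rpoly a b) w2) (poly (Rpoly a b) w4) \<le> min (poly (Rpoly a b) w1) (poly (Rpoly a b) w3)"
    using w d unfolding poly_P5 pderiv_P5 by auto
  thus ?R by (intro exI)
next
  assume ?R
  then obtain w1 w2 w3 w4 where d: "pderiv (Rpoly a b) = smult 5 (linprod [w1, w2, w3, w4])"
    and w: "w1 \<le> w2" "w2 \<le> w3" "w3 \<le> w4"
    and v: "max (poly (Rpoly a b) w2) (poly (Rpoly a b) w4) \<le> min (poly (Rpoly a b) w1) (poly (Rpoly a b) w3)"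
    by auto
  \<comment> \<open>The lowest admissible level; any other level up to the smaller of the values at
    \<open>w1\<close> and \<open>w3\<close> would serve as well.\<close>
  define c where "c = 5 * (max (poly (Rpoly a b) w2) (poly (Rpoly a b) w4) + a / 6)"
  have c: "c / 5 - a / 6 = max (poly (Rpoly a b) w2) (poly (Rpoly a b) w4)" by (simp add: c_def add_divide_distrib)
  have v': "poly (P5 a b c) w1 \<ge> 0" "poly (P5 a b c) w2 \<le> 0" "poly (P5 a b c) w3 \<ge> 0" "poly (P5 a b c) w4 \<le> 0"
    using v unfolding poly_P5 c by auto
  obtain u1 u2 u3 u4 u5 where "u1 \<le> w1" "w1 \<le> u2" "u2 \<le> w2" "w2 \<le> u3" "u3 \<le> w3" "w3 \<le> u4" "u4 \<le> w4" "w4 \<le> u5"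
    "P5 a b c = linprod [u1, u2, u3, u4, u5]"
    by (rule quintic_of_critical_values[OF degree_P5 lead_coeff_P5 d[folded pderiv_P5[of a b c]] w v'])
  hence "u1 \<le> u2 \<and> u2 \<le> u3 \<and> u3 \<le> u4 \<and> u4 \<le> u5 \<and> P5 a b c = linprod [u1, u2, u3, u4, u5]"
    by (auto intro: order_trans)
  thus "(a, b) \<in> shape_region" unfolding shape_region_quintic by (intro exI)
qed

lemma linprod4_inject:
  fixes w1 :: real
  assumes "smult 5 (linprod [w1, w2, w3, w4]) = smult 5 (linprod [z1, z2, z3, z4])"
    and "w1 \<le> w2" "w2 \<le> w3" "w3 \<le> w4" "z1 \<le> z2" "z2 \<le> z3" "z3 \<le> z4"
  shows "w1 = z1 \<and> w2 = z2 \<and> w3 = z3 \<and> w4 = z4"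
proof -
  have "mset [w1, w2, w3, w4] = mset [z1, z2, z3, z4]"
    using assms(1) by (metis proots_linprod proots_smult zero_neq_numeral)
  moreover have "sorted [w1, w2, w3, w4]" "sorted [z1, z2, z3, z4]" using assms by simp_all
  ultimately have "[w1, w2, w3, w4] = [z1, z2, z3, z4]" by (metis properties_for_sort)
  thus ?thesis by simp
qed

text \<open>The value is exactly 0 at the given point, because the integrand of the fibre integral
  vanishes for every \<open>c\<close>.\<close>

lemma shape_density_outside:
  assumes "(a, b) \<notin> shape_region"
  shows "shape_density (a, b) = 0"
proof -
  have "rdens (vec5 0 1 a b c) = 0" for c
  proof -
    have "vec5 0 1 a b c \<notin> psums ` chamber"
    proof
      assume "vec5 0 1 a b c \<in> psums ` chamber"
      then obtain x where x: "psums x = vec5 0 1 a b c" by auto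
      have "psum 1 x = 0" "psum 2 x = 1" "psum 3 x = a" "psum 4 x = b"
        using x unfolding psums_eq_vec5_iff by blast+
      hence "x \<in> Omega5" "(a, b) = (psum 3 x, psum 4 x)" unfolding Omega5_def by blast+
      thus False using assms by (auto simp: shape_region_def)
    qed
    thus ?thesis by (simp add: rdens_def)
  qed
  thus ?thesis by (simp add: shape_density_def Jdens_def)
qed

section \<open>Monotonicity and extrema between simple critical points\<close>

lemma sign_quartic:
  fixes w1 :: real
  assumes d: "pderiv p = smult 5 (linprod [w1, w2, w3, w4])" and w: "w1 < w2" "w2 < w3" "w3 < w4"
  shows "z \<le> w1 \<Longrightarrow> poly (pderiv p) z \<ge> 0"
    "w1 \<le> z \<Longrightarrow> z \<le> w2 \<Longrightarrow> poly (pderiv p) z \<le> 0"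
    "w2 \<le> z \<Longrightarrow> z \<le> w3 \<Longrightarrow> poly (pderiv p) z \<ge> 0"
    "w3 \<le> z \<Longrightarrow> z \<le> w4 \<Longrightarrow> poly (pderiv p) z \<le> 0"
    "w4 \<le> z \<Longrightarrow> poly (pderiv p) z \<ge> 0"
  unfolding d using w by (auto simp: zero_le_mult_iff mult_le_0_iff)

lemma poly_mono_on:
  fixes p :: "real poly"
  assumes "\<And>z. l \<le> z \<Longrightarrow> z \<le> u \<Longrightarrow> poly (pderiv p) z \<ge> 0" and "l \<le> x" "x \<le> y" "y \<le> u"
  shows "poly p x \<le> poly p y"
proof (cases "x = y")
  case False
  hence "x < y" using assms by simp
  from poly_MVT[OF this, of p] obtain z where z: "x < z" "z < y" "poly p y - poly p x = (y - x) * poly (pderiv p) z"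
    by auto
  have "(y - x) * poly (pderiv p) z \<ge> 0" using assms z \<open>x < y\<close> by (intro mult_nonneg_nonneg) auto
  thus ?thesis using z by simp
qed simp

lemma poly_antimono_on:
  fixes p :: "real poly"
  assumes "\<And>z. l \<le> z \<Longrightarrow> z \<le> u \<Longrightarrow> poly (pderiv p) z \<le> 0" and "l \<le> x" "x \<le> y" "y \<le> u"
  shows "poly p y \<le> poly p x"
  using poly_mono_on[of l u "- p" x y] assms by (simp add: pderiv_minus)

lemma critical_extrema:
  fixes w1 :: real
  assumes d: "pderiv p = smult 5 (linprod [w1, w2, w3, w4])" and w: "w1 < w2" "w2 < w3" "w3 < w4"
  shows "z \<le> w2 \<Longrightarrow> poly p z \<le> poly p w1"
    "w1 \<le> z \<Longrightarrow> z \<le> w3 \<Longrightarrow> poly p z \<ge> poly p w2"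
    "w2 \<le> z \<Longrightarrow> z \<le> w4 \<Longrightarrow> poly p z \<le> poly p w3"
    "w3 \<le> z \<Longrightarrow> poly p z \<ge> poly p w4"
proof -
  note s = sign_quartic[OF d w]
  show "poly p z \<le> poly p w1" if "z \<le> w2"
    using poly_mono_on[of z w1 p z w1] poly_antimono_on[of w1 w2 p w1 z] s that by (cases "z \<le> w1") auto
  show "poly p z \<ge> poly p w2" if "w1 \<le> z" "z \<le> w3"
    using poly_mono_on[of w2 w3 p w2 z] poly_antimono_on[of w1 w2 p z w2] s that by (cases "z \<le> w2") auto
  show "poly p z \<le> poly p w3" if "w2 \<le> z" "z \<le> w4"
    using poly_mono_on[of w2 w3 p z w3] poly_antimono_on[of w3 w4 p w3 z] s that by (cases "z \<le> w3") auto
  show "poly p z \<ge> poly p w4" if "w3 \<le> z"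
    using poly_mono_on[of w4 z p w4 z] poly_antimono_on[of w3 w4 p z w4] s that by (cases "z \<le> w4") auto
qed

lemma critical_values_strict:
  fixes w1 :: real
  assumes d: "pderiv p = smult 5 (linprod [w1, w2, w3, w4])" and w: "w1 < w2" "w2 < w3" "w3 < w4"
  shows "poly p w2 < poly p w1" "poly p w2 < poly p w3" "poly p w4 < poly p w3"
proof -
  have s: "poly (pderiv p) z = 5 * ((z - w1) * ((z - w2) * ((z - w3) * (z - w4))))" for z
    unfolding d by simp
  have n: "poly (pderiv p) z < 0" if "w1 < z" "z < w2" for z
    unfolding s using w that by (simp add: mult_less_0_iff zero_less_mult_iff)
  have q: "poly (pderiv p) z > 0" if "w2 < z" "z < w3" for z
    unfolding s using w that by (simp add: mult_less_0_iff zero_less_mult_iff)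
  have t: "poly (pderiv p) z < 0" if "w3 < z" "z < w4" for z
    unfolding s using w that by (simp add: mult_less_0_iff zero_less_mult_iff)
  show "poly p w2 < poly p w1"
  proof -
    obtain z where "w1 < z" "z < w2" "poly p w2 - poly p w1 = (w2 - w1) * poly (pderiv p) z"
      using poly_MVT[OF w(1), of p] by auto
    moreover have "(w2 - w1) * poly (pderiv p) z < 0" using n calculation w by (simp add: mult_less_0_iff)
    ultimately show ?thesis by linarith
  qed
  show "poly p w2 < poly p w3"
  proof -
    obtain z where "w2 < z" "z < w3" "poly p w3 - poly p w2 = (w3 - w2) * poly (pderiv p) z"
      using poly_MVT[OF w(2), of p] by auto
    moreover have "(w3 - w2) * poly (pderiv p) z > 0" using q calculation w by simp
    ultimately show ?thesis by linarith
  qed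
  show "poly p w4 < poly p w3"
  proof -
    obtain z where "w3 < z" "z < w4" "poly p w4 - poly p w3 = (w4 - w3) * poly (pderiv p) z"
      using poly_MVT[OF w(3), of p] by auto
    moreover have "(w4 - w3) * poly (pderiv p) z < 0" using t calculation w by (simp add: mult_less_0_iff)
    ultimately show ?thesis by linarith
  qed
qed

text \<open>Signed length of the interval of admissible levels. For increasingly ordered critical
  points, positive, zero and negative values mark the interior, the boundary and the complement of
  the region.\<close>

definition critical_gap :: "real \<Rightarrow> real \<Rightarrow> real \<Rightarrow> real \<Rightarrow> real \<Rightarrow> real \<Rightarrow> real" where
  "critical_gap a b w1 w2 w3 w4 = min (poly (Rpoly a b) w1) (poly (Rpoly a b) w3) - max (poly (Rpoly a b) w2) (poly (Rpoly a b) w4)"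

text \<open>Neighbouring critical points lie on opposite sides of the gap, so a coincidence would
  give them a common value and leave no room between.\<close>

lemma positive_gap_strict:
  assumes "critical_gap a b w1 w2 w3 w4 > 0" "w1 \<le> w2" "w2 \<le> w3" "w3 \<le> w4"
  shows "w1 < w2" "w2 < w3" "w3 < w4"
  using assms unfolding critical_gap_def by (auto simp: order_less_le)

lemma distinct_roots_proots:
  fixes p :: "'a::idom poly"
  assumes "p \<noteq> 0" "distinct us" "set us \<subseteq> {x. poly p x = 0}"
  shows "mset us \<subseteq># proots p"
proof (rule mset_subset_eqI)
  fix x
  show "count (mset us) x \<le> count (proots p) x"
  proof (cases "x \<in> set us")
    case True
    hence "count (mset us) x = 1" using assms(2) by (simp add: distinct_count_atmost_1)
    moreover have "order x p \<noteq> 0" using True assms by (auto simp: order_root)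
    ultimately show ?thesis using assms(1) by simp
  next
    case False
    hence "x \<notin># mset us" by simp
    thus ?thesis by (simp only: not_in_iff zero_le)
  qed
qed

text \<open>For a level strictly inside the gap, the quintic alternates in sign at six points: the
  critical points and one guard on either side. With the points held fixed this is an open condition
  on \<open>(a, b)\<close>, and it forces five distinct real roots.\<close>

lemma positive_gap_interior:
  assumes d: "pderiv (Rpoly a b) = smult 5 (linprod [w1, w2, w3, w4])"
    and w: "w1 \<le> w2" "w2 \<le> w3" "w3 \<le> w4" and gap: "critical_gap a b w1 w2 w3 w4 > 0"
  shows "(a, b) \<in> interior shape_region"
proof -
  note ws = positive_gap_strict[OF gap w]
  obtain k where k: "max (poly (Rpoly a b) w2) (poly (Rpoly a b) w4) < k"
    "k < min (poly (Rpoly a b) w1) (poly (Rpoly a b) w3)"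
    using gap dense unfolding critical_gap_def by (metis diff_gt_0_iff_gt)
  have v: "poly (Rpoly a b) w1 > k" "poly (Rpoly a b) w2 < k" "poly (Rpoly a b) w3 > k" "poly (Rpoly a b) w4 < k"
    using k by simp_all
  \<comment> \<open>Fibre parameter that keeps the level \<open>k\<close> fixed when the first
    coordinate moves.\<close>
  define c where "c = (\<lambda>x. 5 * (k + x / 6))"
  have c: "poly (P5 x y (c x)) z = poly (Rpoly x y) z - k" for x y z
    by (simp add: poly_P5 c_def add_divide_distrib)
  obtain w0 where w0: "w0 \<le> w1" "poly (Rpoly a b) w0 < k"
    using monic_quintic_unbounded(1)[OF degree_P5 lead_coeff_P5, of w1 a b "c a"] unfolding c by auto
  obtain w5 where w5: "w5 \<ge> w4" "poly (Rpoly a b) w5 > k"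
    using monic_quintic_unbounded(2)[OF degree_P5 lead_coeff_P5, of w4 a b "c a"] unfolding c by auto
  define U where "U = {z. poly (Rpoly (fst z) (snd z)) w0 < k \<and> poly (Rpoly (fst z) (snd z)) w1 > k \<and>
    poly (Rpoly (fst z) (snd z)) w2 < k \<and> poly (Rpoly (fst z) (snd z)) w3 > k \<and>
    poly (Rpoly (fst z) (snd z)) w4 < k \<and> poly (Rpoly (fst z) (snd z)) w5 > k}"
  have "open U"
    unfolding U_def poly_Rpoly by (intro open_Collect_conj open_Collect_less continuous_intros) auto
  moreover have "(a, b) \<in> U" using v w0 w5 by (simp add: U_def)
  moreover have "U \<subseteq> shape_region"
  proof
    fix z assume z: "z \<in> U"
    obtain x y where xy: "z = (x, y)" by (cases z)
    define p where "p = P5 x y (c x)"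
    have s: "poly p w0 < 0" "poly p w1 > 0" "poly p w2 < 0" "poly p w3 > 0" "poly p w4 < 0" "poly p w5 > 0"
      using z unfolding p_def c U_def xy by auto
    have "w0 < w1" "w4 < w5" using w0 w5 s by (auto simp: order_less_le)
    obtain u1 where u1: "w0 < u1" "u1 < w1" "poly p u1 = 0" using poly_IVT_pos[OF \<open>w0 < w1\<close> s(1,2)] by auto
    obtain u2 where u2: "w1 < u2" "u2 < w2" "poly p u2 = 0" using poly_IVT_neg[OF ws(1) s(2,3)] by auto
    obtain u3 where u3: "w2 < u3" "u3 < w3" "poly p u3 = 0" using poly_IVT_pos[OF ws(2) s(3,4)] by auto
    obtain u4 where u4: "w3 < u4" "u4 < w4" "poly p u4 = 0" using poly_IVT_neg[OF ws(3) s(4,5)] by auto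
    obtain u5 where u5: "w4 < u5" "u5 < w5" "poly p u5 = 0" using poly_IVT_pos[OF \<open>w4 < w5\<close> s(5,6)] by auto
    have p0: "p \<noteq> 0" using s by auto
    have "distinct [u1, u2, u3, u4, u5]" using u1 u2 u3 u4 u5 by auto
    moreover have "set [u1, u2, u3, u4, u5] \<subseteq> {x. poly p x = 0}" using u1 u2 u3 u4 u5 by auto
    ultimately have "mset [u1, u2, u3, u4, u5] \<subseteq># proots p"
      by (rule distinct_roots_proots[OF p0])
    moreover have "length [u1, u2, u3, u4, u5] = degree p" by (simp add: p_def degree_P5)
    ultimately have "P5 x y (c x) = linprod [u1, u2, u3, u4, u5]"
      using linprod_eqI[OF p0] unfolding p_def lead_coeff_P5 smult_1_left by blast
    hence "u1 \<le> u2 \<and> u2 \<le> u3 \<and> u3 \<le> u4 \<and> u4 \<le> u5 \<and> P5 x y (c x) = linprod [u1, u2, u3, u4, u5]"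
      using u1 u2 u3 u4 u5 by simp
    thus "z \<in> shape_region" unfolding xy shape_region_quintic by (intro exI)
  qed
  ultimately show ?thesis by (auto simp: interior_def)
qed

section \<open>Perturbation at points of zero gap\<close>

lemma poly_quartic_derivatives:
  fixes w1 :: real
  assumes d: "pderiv p = smult 5 (linprod [w1, w2, w3, w4])"
  shows "poly (pderiv (pderiv p)) z = 5 * ((z - w2) * (z - w3) * (z - w4) + (z - w1) * (z - w3) * (z - w4) +
     (z - w1) * (z - w2) * (z - w4) + (z - w1) * (z - w2) * (z - w3))"
   and "poly (pderiv (pderiv (pderiv p))) z = 10 * ((z - w1) * (z - w2) + (z - w1) * (z - w3) + (z - w1) * (z - w4) +
     (z - w2) * (z - w3) + (z - w2) * (z - w4) + (z - w3) * (z - w4))"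
  unfolding d linprod_Cons pderiv_smult pderiv_mult pderiv_add
  by (simp_all add: pderiv_pCons algebra_simps)

text \<open>Laguerre's inequality for the quartic \<open>f = p'\<close>. In the elementary symmetric
  functions of the differences \<open>z - w\<close>, twice the product of the second and the fourth
  is the square of the third minus the sum of the squared triple products. The third vanishes where
  \<open>f'\<close> does.\<close>

lemma laguerre_quartic:
  fixes w1 :: real
  assumes d: "pderiv p = smult 5 (linprod [w1, w2, w3, w4])"
    and z: "poly (pderiv (pderiv p)) z = 0" and n: "poly (pderiv p) z \<noteq> 0"
  shows "poly (pderiv p) z * poly (pderiv (pderiv (pderiv p))) z < 0"
proof -
  define x1 x2 x3 x4 where "x1 = z - w1" and "x2 = z - w2" and "x3 = z - w3" and "x4 = z - w4"
  have e3: "x2 * x3 * x4 + x1 * x3 * x4 + x1 * x2 * x4 + x1 * x2 * x3 = 0"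
    using z unfolding poly_quartic_derivatives(1)[OF d] by (simp add: x1_def x2_def x3_def x4_def)
  have p1: "poly (pderiv p) z = 5 * (x1 * x2 * x3 * x4)"
    unfolding d by (simp add: x1_def x2_def x3_def x4_def)
  have p3: "poly (pderiv (pderiv (pderiv p))) z = 10 * (x1 * x2 + x1 * x3 + x1 * x4 + x2 * x3 + x2 * x4 + x3 * x4)"
    unfolding poly_quartic_derivatives(2)[OF d] by (simp add: x1_def x2_def x3_def x4_def)
  have "poly (pderiv p) z * poly (pderiv (pderiv (pderiv p))) z = 25 * ((x2 * x3 * x4 + x1 * x3 * x4 + x1 * x2 * x4 + x1 * x2 * x3)^2
     - ((x2 * x3 * x4)^2 + (x1 * x3 * x4)^2 + (x1 * x2 * x4)^2 + (x1 * x2 * x3)^2))"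
    unfolding p1 p3 by algebra
  also have "\<dots> < 0"
  proof -
    have "x1 \<noteq> 0" "x2 \<noteq> 0" "x3 \<noteq> 0" "x4 \<noteq> 0" using n p1 by auto
    hence "(x2 * x3 * x4)^2 > 0" by simp
    hence "(x2 * x3 * x4)^2 + (x1 * x3 * x4)^2 + (x1 * x2 * x4)^2 + (x1 * x2 * x3)^2 > 0"
      by (smt (verit) zero_le_power2)
    thus ?thesis unfolding e3 by simp
  qed
  finally show ?thesis .
qed

lemma sum4_neg: "p < 0 \<Longrightarrow> q < 0 \<Longrightarrow> r < 0 \<Longrightarrow> t < 0 \<Longrightarrow> 5 * (p + q + r + t) < (0 :: real)"
  and sum4_pos: "p > 0 \<Longrightarrow> q > 0 \<Longrightarrow> r > 0 \<Longrightarrow> t > 0 \<Longrightarrow> 5 * (p + q + r + t) > (0 :: real)"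
  by simp_all

text \<open>
  Lowering \<open>b\<close> by \<open>4\<delta>\<close> adds \<open>\<delta> z\<close> to \<open>R\<close>. At a double zero of \<open>R'\<close> the sign of \<open>\<delta>\<close> can be chosen so that
  the Laguerre inequality fails. If all zeros are simple, the gap vanishes only because \<open>v\<^sub>1 = v\<^sub>4\<close>,
  and adding an increasing function makes the first local maximum fall below the last local minimum.
\<close>

lemma zero_gap_not_interior:
  assumes d: "pderiv (Rpoly a b) = smult 5 (linprod [w1, w2, w3, w4])"
    and w: "w1 \<le> w2" "w2 \<le> w3" "w3 \<le> w4" and gap: "critical_gap a b w1 w2 w3 w4 = 0"
  shows "(a, b) \<notin> interior shape_region"
proof
  assume "(a, b) \<in> interior shape_region"
  then obtain e where e: "e > 0" "ball (a, b) e \<subseteq> shape_region" by (auto simp: mem_interior)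
  have near: "(a, b - 4 * \<delta>) \<in> shape_region" if "\<bar>4 * \<delta>\<bar> < e" for \<delta>
  proof (rule subsetD[OF e(2)])
    have "dist (a, b) (a, b - 4 * \<delta>) = \<bar>4 * \<delta>\<bar>"
      by (simp only: dist_Pair_Pair dist_self zero_power2 add_0_left real_sqrt_abs abs_of_nonneg zero_le_dist)
        (simp add: dist_real_def)
    thus "(a, b - 4 * \<delta>) \<in> ball (a, b) e" using that by simp
  qed
  have shift: "pderiv (Rpoly a (b - 4 * \<delta>)) = pderiv (Rpoly a b) + [:\<delta>:]" for \<delta>
    by (simp add: pderiv_Rpoly field_simps)
  have shift2: "pderiv (pderiv (Rpoly a (b - 4 * \<delta>))) = pderiv (pderiv (Rpoly a b))" for \<delta>
    unfolding shift by (simp add: pderiv_add pderiv_pCons)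
  have shift0: "poly (Rpoly a (b - 4 * \<delta>)) z = poly (Rpoly a b) z + \<delta> * z" for \<delta> z
    by (simp add: poly_Rpoly field_simps)
  show False
  proof (cases "w1 = w2 \<or> w2 = w3 \<or> w3 = w4")
    case True
    then obtain w where w1: "poly (pderiv (Rpoly a b)) w = 0" and w2: "poly (pderiv (pderiv (Rpoly a b))) w = 0"
      unfolding poly_quartic_derivatives[OF d] unfolding d by force
    \<comment> \<open>At the double zero the perturbed derivative has value \<delta> and unchanged
      second derivative. Giving \<delta> the sign of the latter makes their product nonnegative,
      against Laguerre. The size \<open>e / 8\<close> moves \<open>b\<close> by
      \<open>e / 2\<close>, within the ball.\<close>
    define \<delta> where "\<delta> = (if poly (pderiv (pderiv (pderiv (Rpoly a b)))) w \<ge> 0 then e / 8 else - e / 8)"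
    have "(a, b - 4 * \<delta>) \<in> shape_region" using e by (intro near) (auto simp: \<delta>_def)
    then obtain z1 z2 z3 z4 where z: "pderiv (Rpoly a (b - 4 * \<delta>)) = smult 5 (linprod [z1, z2, z3, z4])"
      unfolding shape_region_critical by blast
    have q: "poly (pderiv (Rpoly a (b - 4 * \<delta>))) w = \<delta>" unfolding shift by (simp add: w1)
    have "\<delta> * poly (pderiv (pderiv (pderiv (Rpoly a b)))) w < 0"
      using laguerre_quartic[OF z, of w] e unfolding q shift2 w2 by (simp add: \<delta>_def split: if_splits)
    thus False using e by (auto simp: \<delta>_def mult_less_0_iff split: if_splits)
  next
    case False
    hence ws: "w1 < w2" "w2 < w3" "w3 < w4" using w by auto
    note ext = critical_extrema[OF d ws] and str = critical_values_strict[OF d ws] and sg = sign_quartic[OF d ws]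
    have v: "poly (Rpoly a b) w1 = poly (Rpoly a b) w4"
      using gap str unfolding critical_gap_def by linarith
    define \<delta> where "\<delta> = e / 8"
    have \<delta>: "\<delta> > 0" using e by (simp add: \<delta>_def)
    have "(a, b - 4 * \<delta>) \<in> shape_region" using e by (intro near) (auto simp: \<delta>_def)
    then obtain z1 z2 z3 z4 where z: "pderiv (Rpoly a (b - 4 * \<delta>)) = smult 5 (linprod [z1, z2, z3, z4])"
      and zs: "z1 \<le> z2" "z2 \<le> z3" "z3 \<le> z4"
      and zv: "max (poly (Rpoly a (b - 4 * \<delta>)) z2) (poly (Rpoly a (b - 4 * \<delta>)) z4) \<le>
        min (poly (Rpoly a (b - 4 * \<delta>)) z1) (poly (Rpoly a (b - 4 * \<delta>)) z3)"
      unfolding shape_region_critical by blast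
    \<comment> \<open>At a zero of \<open>R' + \<delta>\<close> the old derivative equals
      \<open>- \<delta>\<close>, so the new critical points lie in the two intervals where
      \<open>R\<close> decreases.\<close>
    have loc: "w1 < x \<and> x < w2 \<or> w3 < x \<and> x < w4" if "x \<in> {z1, z2, z3, z4}" for x
    proof -
      have "poly (pderiv (Rpoly a (b - 4 * \<delta>))) x = 0" unfolding z using that by auto
      hence "poly (pderiv (Rpoly a b)) x < 0" using \<delta> unfolding shift by simp
      thus ?thesis using sg[of x] ws by (smt (verit))
    qed
    have inflection: "\<exists>y. x1 < y \<and> y < x2 \<and> poly (pderiv (pderiv (Rpoly a (b - 4 * \<delta>)))) y = 0"
      if "x1 < x2" "poly (pderiv (Rpoly a b)) x1 = 0" "poly (pderiv (Rpoly a b)) x2 = 0" for x1 x2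
      unfolding shift2 using rolle_or_double[of x1 x2 "pderiv (Rpoly a b)"] that by auto
    \<comment> \<open>Otherwise all four new critical points lie to the right of \<open>w3\<close>.
      But \<open>R''\<close> has a zero between \<open>w1\<close> and \<open>w2\<close>, to the left
      of all of them, where the four triple products forming it are all negative. The argument for
      \<open>z4\<close> is the mirror image.\<close>
    have z1: "w1 < z1 \<and> z1 < w2"
    proof (rule ccontr)
      assume "\<not> (w1 < z1 \<and> z1 < w2)"
      hence "z1 > w3" using loc[of z1] by auto
      obtain y where y: "w1 < y" "y < w2" "poly (pderiv (pderiv (Rpoly a (b - 4 * \<delta>)))) y = 0"
        using inflection[OF ws(1)] unfolding d by auto
      have neg: "(y - p) * (y - q) * (y - r) < 0" if "y < p" "y < q" "y < r" for p q r
        using that by (simp add: mult_less_0_iff zero_less_mult_iff)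
      have "y < z1" "y < z2" "y < z3" "y < z4" using y \<open>z1 > w3\<close> zs ws by auto
      note s = neg[OF this(2,3,4)] neg[OF this(1,3,4)] neg[OF this(1,2,4)] neg[OF this(1,2,3)]
      from sum4_neg[OF s] show False using y(3) unfolding poly_quartic_derivatives[OF z] by (metis less_irrefl)
    qed
    have z4: "w3 < z4 \<and> z4 < w4"
    proof (rule ccontr)
      assume "\<not> (w3 < z4 \<and> z4 < w4)"
      hence "z4 < w2" using loc[of z4] by auto
      obtain y where y: "w3 < y" "y < w4" "poly (pderiv (pderiv (Rpoly a (b - 4 * \<delta>)))) y = 0"
        using inflection[OF ws(3)] unfolding d by auto
      have pos: "(y - p) * (y - q) * (y - r) > 0" if "p < y" "q < y" "r < y" for p q r
        using that by simp
      have "z1 < y" "z2 < y" "z3 < y" "z4 < y" using y \<open>z4 < w2\<close> zs ws by auto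
      note s = pos[OF this(2,3,4)] pos[OF this(1,3,4)] pos[OF this(1,2,4)] pos[OF this(1,2,3)]
      from sum4_pos[OF s] show False using y(3) unfolding poly_quartic_derivatives[OF z] by (metis less_irrefl)
    qed
    \<comment> \<open>The new value at \<open>z1\<close> is at most
      \<open>v1 + \<delta> * z1\<close>, that at \<open>z4\<close> at least
      \<open>v4 + \<delta> * z4\<close>; with \<open>v1 = v4\<close> and \<open>z1 < z4\<close> the
      required order is violated.\<close>
    have "poly (Rpoly a b) z1 \<le> poly (Rpoly a b) w1" using ext(1) z1 by simp
    moreover have "poly (Rpoly a b) z4 \<ge> poly (Rpoly a b) w4" using ext(4) z4 by simp
    moreover have "\<delta> * z1 < \<delta> * z4" using \<delta> z1 z4 ws by simp
    ultimately show False using zv v unfolding shift0 by linarith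
  qed
qed

lemma frontier_shape_region:
  "frontier shape_region = {(a, b). \<exists>w1 w2 w3 w4. pderiv (Rpoly a b) = smult 5 (linprod [w1, w2, w3, w4]) \<and>
    w1 \<le> w2 \<and> w2 \<le> w3 \<and> w3 \<le> w4 \<and> critical_gap a b w1 w2 w3 w4 = 0}" (is "_ = ?E")
proof -
  have "frontier shape_region = shape_region - interior shape_region"
    using compact_shape_region by (simp add: frontier_def compact_imp_closed)
  also have "\<dots> = ?E"
  proof (intro set_eqI iffI)
    fix z assume z: "z \<in> shape_region - interior shape_region"
    obtain a b where ab: "z = (a, b)" by (cases z)
    obtain w1 w2 w3 w4 where *: "pderiv (Rpoly a b) = smult 5 (linprod [w1, w2, w3, w4])"
      "w1 \<le> w2" "w2 \<le> w3" "w3 \<le> w4" "critical_gap a b w1 w2 w3 w4 \<ge> 0"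
      using z unfolding ab shape_region_critical critical_gap_def Diff_iff by auto
    have "\<not> critical_gap a b w1 w2 w3 w4 > 0" using positive_gap_interior[OF *(1-4)] z ab by auto
    hence "critical_gap a b w1 w2 w3 w4 = 0" using *(5) by simp
    thus "z \<in> ?E" unfolding ab using * by blast
  next
    fix z assume "z \<in> ?E"
    then obtain a b w1 w2 w3 w4 where *: "z = (a, b)" "pderiv (Rpoly a b) = smult 5 (linprod [w1, w2, w3, w4])"
      "w1 \<le> w2" "w2 \<le> w3" "w3 \<le> w4" "critical_gap a b w1 w2 w3 w4 = 0" by auto
    have "pderiv (Rpoly a b) = smult 5 (linprod [w1, w2, w3, w4]) \<and> w1 \<le> w2 \<and> w2 \<le> w3 \<and> w3 \<le> w4 \<and>
      max (poly (Rpoly a b) w2) (poly (Rpoly a b) w4) \<le> min (poly (Rpoly a b) w1) (poly (Rpoly a b) w3)"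
      using *(2-6) by (simp add: critical_gap_def)
    hence "(a, b) \<in> shape_region" unfolding shape_region_critical by (intro exI)
    thus "z \<in> shape_region - interior shape_region" using zero_gap_not_interior[OF *(2-6)] *(1) by simp
  qed
  finally show ?thesis .
qed

section \<open>Two curves covering the boundary\<close>

lemma double_tangency_roots:
  assumes d: "pderiv (Rpoly a b) = smult 5 (linprod [w1, w2, w3, w4])" and w: "w1 < w2" "w2 < w3" "w3 < w4"
    and v: "poly (Rpoly a b) w1 = poly (Rpoly a b) w4"
  obtains c e where "P5 a b c = linprod [w1, w1, e, w4, w4]"
proof -
  define c where "c = 5 * (poly (Rpoly a b) w1 + a / 6)"
  define p where "p = P5 a b c"
  have p: "poly p z = poly (Rpoly a b) z - poly (Rpoly a b) w1" for z by (simp add: p_def poly_P5 c_def add_divide_distrib)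
  have d': "pderiv p = smult 5 (linprod [w1, w2, w3, w4])" by (simp add: p_def pderiv_P5 d)
  note str = critical_values_strict[OF d w]
  have deg: "degree p = 5" "lead_coeff p = 1" unfolding p_def by (rule degree_P5 lead_coeff_P5)+
  have pv: "poly p w1 \<ge> 0" "poly p w2 \<le> 0" "poly p w3 \<ge> 0" "poly p w4 \<le> 0"
    using str v unfolding p by auto
  obtain u1 u2 u3 u4 u5 where u: "u1 \<le> w1" "w1 \<le> u2" "u2 \<le> w2" "w2 \<le> u3" "u3 \<le> w3" "w3 \<le> u4" "u4 \<le> w4" "w4 \<le> u5"
    and P: "p = linprod [u1, u2, u3, u4, u5]"
    by (rule quintic_of_critical_values[OF deg d' less_imp_le[OF w(1)] less_imp_le[OF w(2)] less_imp_le[OF w(3)] pv])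
  have p0: "p \<noteq> 0" unfolding P by (rule linprod_nonzero)
  \<comment> \<open>A root that is also a critical point has multiplicity at least two. Interlacing
    leaves only \<open>u1\<close>, \<open>u2\<close> available at \<open>w1\<close> and only
    \<open>u4\<close>, \<open>u5\<close> at \<open>w4\<close>.\<close>
  have ord: "count (mset [u1, u2, u3, u4, u5]) x \<ge> 2" if "x = w1 \<or> x = w4" for x
  proof -
    have r: "poly p x = 0" "poly (pderiv p) x = 0" using that v unfolding p d' by auto
    have "pderiv p \<noteq> 0" unfolding d' by (simp add: linprod_nonzero)
    hence "order x (pderiv p) \<ge> 1" using r by (simp add: order_root Suc_leI)
    hence "order x p \<ge> 2" using order_pderiv[OF p0 r(1)] by simp
    thus ?thesis using count_proots[OF p0, of x] unfolding P proots_linprod by simp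
  qed
  have "u1 = w1 \<and> u2 = w1" using ord[of w1] u w by (simp split: if_splits)
  moreover have "u4 = w4 \<and> u5 = w4" using ord[of w4] u w by (simp split: if_splits)
  ultimately show ?thesis using that[of c u3] P by (simp add: p_def)
qed

text \<open>A boundary point has a double critical point \<open>w\<close> or a quintic with two
  double roots. In the first case \<open>R'(w) = R''(w) = 0\<close> is solved for \<open>a\<close>
  and \<open>b\<close>, which occur linearly. In the second, the vanishing sum fixes the simple root
  and the unit square sum puts the double roots on an ellipse, parametrised by an angle. Inclusion
  in these smooth curves is what nullness requires.\<close>

lemma frontier_shape_region_curves:
  "frontier shape_region \<subseteq> range (\<lambda>w. ((60 * w^3 - 9 * w) / 2, 1 / 2 + 4 * (5 * w^4 - 3 / 2 * w^2 - (20 * w^3 - 3 * w) * w))) \<union>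
    range (\<lambda>\<theta>. let s = cos \<theta> / sqrt 5; x = (s + sin \<theta>) / 2; y = (s - sin \<theta>) / 2 in
      (2 * x^3 + 2 * y^3 + (- 2 * s)^3, 2 * x^4 + 2 * y^4 + (- 2 * s)^4))"
proof
  fix z assume "z \<in> frontier shape_region"
  then obtain a b w1 w2 w3 w4 where ab: "z = (a, b)" and d: "pderiv (Rpoly a b) = smult 5 (linprod [w1, w2, w3, w4])"
      and w: "w1 \<le> w2" "w2 \<le> w3" "w3 \<le> w4" and gap: "critical_gap a b w1 w2 w3 w4 = 0"
    unfolding frontier_shape_region by auto
  show "z \<in> range (\<lambda>w. ((60 * w^3 - 9 * w) / 2, 1 / 2 + 4 * (5 * w^4 - 3 / 2 * w^2 - (20 * w^3 - 3 * w) * w))) \<union>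
    range (\<lambda>\<theta>. let s = cos \<theta> / sqrt 5; x = (s + sin \<theta>) / 2; y = (s - sin \<theta>) / 2 in
      (2 * x^3 + 2 * y^3 + (- 2 * s)^3, 2 * x^4 + 2 * y^4 + (- 2 * s)^4))"
  proof (cases "w1 = w2 \<or> w2 = w3 \<or> w3 = w4")
    case True
    then obtain w where r: "poly (pderiv (Rpoly a b)) w = 0" "poly (pderiv (pderiv (Rpoly a b))) w = 0"
      unfolding poly_quartic_derivatives[OF d] unfolding d by force
    have 2: "20 * w^3 - 3 * w - 2 * a / 3 = 0"
      using r(2) unfolding pderiv_Rpoly by (simp add: pderiv_pCons power_numeral_reduce algebra_simps)
    have 1: "(1 - 2 * b) / 8 - 2 * a / 3 * w - 3 / 2 * w^2 + 5 * w^4 = 0"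
      using r(1) unfolding pderiv_Rpoly by (simp add: power_numeral_reduce algebra_simps)
    have a: "2 * a / 3 = 20 * w^3 - 3 * w" using 2 by simp
    have "(1 - 2 * b) / 8 - (20 * w^3 - 3 * w) * w - 3 / 2 * w^2 + 5 * w^4 = 0"
      using 1 unfolding a .
    hence "a = (60 * w^3 - 9 * w) / 2" "b = 1 / 2 + 4 * (5 * w^4 - 3 / 2 * w^2 - (20 * w^3 - 3 * w) * w)"
      using a by (simp_all add: diff_divide_distrib)
    thus ?thesis unfolding ab by blast
  next
    case False
    hence ws: "w1 < w2" "w2 < w3" "w3 < w4" using w by auto
    have "poly (Rpoly a b) w1 = poly (Rpoly a b) w4"
      using gap critical_values_strict[OF d ws] unfolding critical_gap_def by linarith
    then obtain c e where "P5 a b c = linprod [w1, w1, e, w4, w4]" using double_tangency_roots[OF d ws] by metis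
    hence p: "2 * w1 + e + 2 * w4 = 0" "2 * w1^2 + e^2 + 2 * w4^2 = 1" "a = 2 * w1^3 + e^3 + 2 * w4^3"
      "b = 2 * w1^4 + e^4 + 2 * w4^4" unfolding P5_eq_linprod_iff by auto
    \<comment> \<open>Substituting \<open>e = - 2 * (w1 + w4)\<close> diagonalises the square sum in
      the sum and the difference of the double roots.\<close>
    have "(sqrt 5 * (w1 + w4))^2 + (w1 - w4)^2 = 1"
    proof -
      have "e = - 2 * (w1 + w4)" using p(1) by simp
      thus ?thesis using p(2) by (simp add: power_mult_distrib) algebra
    qed
    then obtain \<theta> where \<theta>: "sqrt 5 * (w1 + w4) = cos \<theta>" "w1 - w4 = sin \<theta>"
      using sincos_total_2pi by metis
    have s: "cos \<theta> / sqrt 5 = w1 + w4" using \<theta>(1)[symmetric] by simp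
    have e: "e = - 2 * (w1 + w4)" using p(1) by simp
    have "z = (let s = cos \<theta> / sqrt 5; x = (s + sin \<theta>) / 2; y = (s - sin \<theta>) / 2 in
      (2 * x^3 + 2 * y^3 + (- 2 * s)^3, 2 * x^4 + 2 * y^4 + (- 2 * s)^4))"
      unfolding ab Let_def s \<theta>(2)[symmetric] p(3,4) e by (simp add: add_ac)
    thus ?thesis by blast
  qed
qed

lemma frontier_shape_region_null: "frontier shape_region \<in> null_sets lborel"
proof -
  have "negligible (frontier shape_region)"
  proof (rule negligible_subset[OF negligible_Un frontier_shape_region_curves])
    show "negligible (range (\<lambda>w::real. ((60 * w^3 - 9 * w) / 2,
      1 / 2 + 4 * (5 * w^4 - 3 / 2 * w^2 - (20 * w^3 - 3 * w) * w))))"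
      by (rule negligible_differentiable_image_lowdim)
        (simp, auto simp: differentiable_on_def differentiable_def intro!: derivative_eq_intros exI)
    show "negligible (range (\<lambda>\<theta>::real. let s = cos \<theta> / sqrt 5; x = (s + sin \<theta>) / 2; y = (s - sin \<theta>) / 2 in
      (2 * x^3 + 2 * y^3 + (- 2 * s)^3, 2 * x^4 + 2 * y^4 + (- 2 * s)^4)))"
      unfolding Let_def
      by (rule negligible_differentiable_image_lowdim)
        (simp, auto simp: differentiable_on_def differentiable_def intro!: derivative_eq_intros exI)
  qed
  moreover have "closed (frontier shape_region)" by (rule frontier_closed)
  ultimately show ?thesis by (simp add: negligible_iff_null_sets null_sets_def)
qed

subsection \<open>Fibres over the region\<close>

text \<open>The derivative does not depend on \<open>c\<close>, so the critical points produced by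
  Rolle are, in increasing order, the given ones.\<close>

lemma fibre_iff:
  assumes d: "pderiv (Rpoly a b) = smult 5 (linprod [w1, w2, w3, w4])"
    and w: "w1 \<le> w2" "w2 \<le> w3" "w3 \<le> w4"
  shows "(\<exists>us. P5 a b c = linprod us) \<longleftrightarrow>
    max (poly (Rpoly a b) w2) (poly (Rpoly a b) w4) \<le> c / 5 - a / 6 \<and>
    c / 5 - a / 6 \<le> min (poly (Rpoly a b) w1) (poly (Rpoly a b) w3)" (is "?L \<longleftrightarrow> ?R")
proof
  assume ?L
  then obtain vs where vs: "P5 a b c = linprod vs" by auto
  define us where "us = sort vs"
  have P: "P5 a b c = linprod us" unfolding vs us_def by (rule linprod_mset_eq) simp
  have "length us = 5" using degree_P5[of a b c] unfolding P degree_linprod .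
  then obtain u1 u2 u3 u4 u5 where us: "us = [u1, u2, u3, u4, u5]"
    by (auto simp: numeral_eq_Suc length_Suc_conv)
  have "sorted us" unfolding us_def by (rule sorted_sort)
  hence u: "u1 \<le> u2" "u2 \<le> u3" "u3 \<le> u4" "u4 \<le> u5" unfolding us by simp_all
  obtain z1 z2 z3 z4 where z: "u1 \<le> z1" "z1 \<le> u2" "u2 \<le> z2" "z2 \<le> u3" "u3 \<le> z3" "z3 \<le> u4" "u4 \<le> z4" "z4 \<le> u5"
    and dz: "pderiv (P5 a b c) = smult 5 (linprod [z1, z2, z3, z4])"
    using rolle_quintic[OF u] unfolding P us by metis
  have "z1 \<le> z2" "z2 \<le> z3" "z3 \<le> z4" using z by auto
  with dz d w have "w1 = z1 \<and> w2 = z2 \<and> w3 = z3 \<and> w4 = z4"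
    unfolding pderiv_P5 by (intro linprod4_inject) simp_all
  hence "poly (P5 a b c) w1 \<ge> 0" "poly (P5 a b c) w2 \<le> 0" "poly (P5 a b c) w3 \<ge> 0" "poly (P5 a b c) w4 \<le> 0"
    unfolding P us using z u by (auto simp: zero_le_mult_iff mult_le_0_iff)
  thus ?R unfolding poly_P5 by simp
next
  assume ?R
  hence v: "poly (P5 a b c) w1 \<ge> 0" "poly (P5 a b c) w2 \<le> 0" "poly (P5 a b c) w3 \<ge> 0" "poly (P5 a b c) w4 \<le> 0"
    unfolding poly_P5 by simp_all
  obtain u1 u2 u3 u4 u5 where "P5 a b c = linprod [u1, u2, u3, u4, u5]"
    by (rule quintic_of_critical_values[OF degree_P5 lead_coeff_P5 d[folded pderiv_P5[of a b c]] w v])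
  thus ?L by (rule exI)
qed

text \<open>At a strict level no critical point is a root, so interlacing becomes strict and the
  roots form a point of the chamber, where \<open>vdm\<close> squared is the discriminant.\<close>

lemma strict_fibre:
  assumes d: "pderiv (Rpoly a b) = smult 5 (linprod [w1, w2, w3, w4])"
    and w: "w1 \<le> w2" "w2 \<le> w3" "w3 \<le> w4"
    and v: "max (poly (Rpoly a b) w2) (poly (Rpoly a b) w4) < c / 5 - a / 6"
      "c / 5 - a / 6 < min (poly (Rpoly a b) w1) (poly (Rpoly a b) w3)"
  obtains x where "x \<in> chamber" "psums x = vec5 0 1 a b c"
    "(vdm x)\<^sup>2 = 5^5 * (poly (P5 a b c) w1 * poly (P5 a b c) w2 * poly (P5 a b c) w3 * poly (P5 a b c) w4)"
proof -
  have v': "poly (P5 a b c) w1 > 0" "poly (P5 a b c) w2 < 0" "poly (P5 a b c) w3 > 0" "poly (P5 a b c) w4 < 0"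
    using v unfolding poly_P5 by simp_all
  have d': "pderiv (P5 a b c) = smult 5 (linprod [w1, w2, w3, w4])" using d by (simp only: pderiv_P5)
  obtain u1 u2 u3 u4 u5 where u: "u1 \<le> w1" "w1 \<le> u2" "u2 \<le> w2" "w2 \<le> u3" "u3 \<le> w3" "w3 \<le> u4" "u4 \<le> w4" "w4 \<le> u5"
    and P: "P5 a b c = linprod [u1, u2, u3, u4, u5]"
    by (rule quintic_of_critical_values[OF degree_P5 lead_coeff_P5 d' w less_imp_le[OF v'(1)]
      less_imp_le[OF v'(2)] less_imp_le[OF v'(3)] less_imp_le[OF v'(4)]])
  have ne: "z \<notin> {u1, u2, u3, u4, u5}" if "z \<in> {w1, w2, w3, w4}" for z
  proof
    assume "z \<in> {u1, u2, u3, u4, u5}"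
    hence "poly (P5 a b c) z = 0" unfolding P by auto
    thus False using v' that by auto
  qed
  define x where "x = vec5 u1 u2 u3 u4 u5"
  have n: "u1 \<noteq> w1" "w1 \<noteq> u2" "u2 \<noteq> w2" "w2 \<noteq> u3" "u3 \<noteq> w3" "w3 \<noteq> u4" "u4 \<noteq> w4" "w4 \<noteq> u5"
    using ne by blast+
  have "u1 < u2" "u2 < u3" "u3 < u4" "u4 < u5"
    using le_neq_trans[OF u(1) n(1)] le_neq_trans[OF u(3) n(3)] le_neq_trans[OF u(5) n(5)] le_neq_trans[OF u(7) n(7)]
      u(2,4,6,8) by (simp_all only: less_le_trans)
  hence "x \<in> chamber" by (simp add: chamber_def x_def)
  moreover have "psums x = vec5 0 1 a b c"
    using P unfolding P5_eq_linprod_iff psums_def psum_5 x_def by simp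
  moreover have "(vdm x)\<^sup>2 = (u1 - u2)^2 * (u1 - u3)^2 * (u1 - u4)^2 * (u1 - u5)^2 * (u2 - u3)^2 * (u2 - u4)^2 *
      (u2 - u5)^2 * (u3 - u4)^2 * (u3 - u5)^2 * (u4 - u5)^2"
    by (simp add: vdm_def x_def power_mult_distrib power2_commute mult_ac)
  ultimately show ?thesis
    using that[of x] discriminant_critical_values[OF P d'] by simp
qed

text \<open>The gap places both minima below both maxima, but not which minimum or maximum is lower;
  hence \<open>min\<close> and \<open>max\<close>. As four numbers \<open>r\<close> form the set,
  the four values are distinct, and two strictly sorted lists with the same elements agree.\<close>

lemma sorted_critical_values:
  fixes v1 v2 v3 v4 r1 r2 r3 r4 a :: real
  assumes gap: "max v2 v4 < min v1 v3"
    and r: "{r1, r2, r3, r4} = (\<lambda>v. 5 * (v + a / 6)) ` {v1, v2, v3, v4}" "r1 < r2" "r2 < r3" "r3 < r4"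
  shows "r2 = 5 * (max v2 v4 + a / 6)" "r3 = 5 * (min v1 v3 + a / 6)"
    and "(c - r1) * (c - r2) * (c - r3) * (c - r4) =
      (c - 5 * (v1 + a / 6)) * (c - 5 * (v2 + a / 6)) * (c - 5 * (v3 + a / 6)) * (c - 5 * (v4 + a / 6))"
proof -
  define f where "f v = 5 * (v + a / 6)" for v
  have rs: "set [r1, r2, r3, r4] = {f v1, f v2, f v3, f v4}" using r(1) by (simp add: f_def)
  have "card (set [r1, r2, r3, r4]) = 4" using r by (subst distinct_card) auto
  hence c4: "card {f v1, f v2, f v3, f v4} = 4" unfolding rs .
  have c3: "card {x, y, z} \<le> 3" for x y z :: real by (simp add: card_insert_if)
  have ne1: "v1 \<noteq> v3"
  proof
    assume "v1 = v3"
    hence "{f v1, f v2, f v3, f v4} = {f v1, f v2, f v4}" by auto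
    hence "card {f v1, f v2, f v3, f v4} \<le> 3" using c3 by (rule ssubst)
    thus False using c4 by linarith
  qed
  have ne2: "v2 \<noteq> v4"
  proof
    assume "v2 = v4"
    hence "{f v1, f v2, f v3, f v4} = {f v1, f v2, f v3}" by auto
    hence "card {f v1, f v2, f v3, f v4} \<le> 3" using c3 by (rule ssubst)
    thus False using c4 by linarith
  qed
  have mono: "f x < f y" if "x < y" for x y using that by (simp add: f_def)
  have "min v2 v4 < max v2 v4" "min v1 v3 < max v1 v3"
    using ne1 ne2 by (simp_all add: min_def max_def)
  note fs = mono[OF this(1)] mono[OF gap] mono[OF this(2)]
  have s: "sorted_wrt (<) [f (min v2 v4), f (max v2 v4), f (min v1 v3), f (max v1 v3)]"
    using fs by (simp add: less_trans[OF fs(1) fs(2)] less_trans[OF fs(2) fs(3)]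
      less_trans[OF less_trans[OF fs(1) fs(2)] fs(3)])
  have "{f (min v2 v4), f (max v2 v4)} = {f v2, f v4}" "{f (min v1 v3), f (max v1 v3)} = {f v1, f v3}"
    by (simp_all add: min_def max_def insert_commute)
  hence "{f (min v2 v4), f (max v2 v4)} \<union> {f (min v1 v3), f (max v1 v3)} = {f v2, f v4} \<union> {f v1, f v3}"
    by (rule arg_cong2)
  hence st: "set [f (min v2 v4), f (max v2 v4), f (min v1 v3), f (max v1 v3)] = set [r1, r2, r3, r4]"
    unfolding rs by (simp add: insert_commute)
  have r': "sorted_wrt (<) [r1, r2, r3, r4]"
    using r(2-4) less_trans[OF r(2,3)] less_trans[OF r(3,4)] less_trans[OF less_trans[OF r(2,3)] r(4)] by simp
  have "[r1, r2, r3, r4] = [f (min v2 v4), f (max v2 v4), f (min v1 v3), f (max v1 v3)]"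
    by (rule strict_sorted_equal[OF s r' st[symmetric]])
  hence *: "r1 = f (min v2 v4)" "r2 = f (max v2 v4)" "r3 = f (min v1 v3)" "r4 = f (max v1 v3)" by simp_all
  show "r2 = 5 * (max v2 v4 + a / 6)" "r3 = 5 * (min v1 v3 + a / 6)" using * by (simp_all add: f_def)
  show "(c - r1) * (c - r2) * (c - r3) * (c - r4) =
      (c - 5 * (v1 + a / 6)) * (c - 5 * (v2 + a / 6)) * (c - 5 * (v3 + a / 6)) * (c - 5 * (v4 + a / 6))"
    unfolding * f_def by (simp add: min_def max_def mult_ac)
qed

text \<open>Origin of the leading 5 of the discriminant in \<open>c\<close>: passing from a critical
  value of \<open>P5\<close> to \<open>c - r\<close> costs a factor -5, four times, out of
  \<open>5^5\<close>.\<close>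

lemma critical_product:
  "5^5 * ((v1 - (c / 5 - a / 6)) * (v2 - (c / 5 - a / 6)) * (v3 - (c / 5 - a / 6)) * (v4 - (c / 5 - a / 6))) =
    5 * ((c - 5 * (v1 + a / 6)) * (c - 5 * (v2 + a / 6)) * (c - 5 * (v3 + a / 6)) * (c - 5 * (v4 + a / 6)) :: real)"
proof -
  have e: "c - 5 * (v + a / 6) = - 5 * (v - (c / 5 - a / 6))" for v by (simp add: field_simps)
  have "5^5 * (x1 * x2 * x3 * x4) = 5 * ((- 5 * x1) * (- 5 * x2) * (- 5 * x3) * (- 5 * x4))" for x1 x2 x3 x4 :: real
    by simp
  thus ?thesis unfolding e .
qed

lemma scaled_value_bounds:
  fixes m :: real
  shows "5 * (m + a / 6) < c \<longleftrightarrow> m < c / 5 - a / 6" "c < 5 * (m + a / 6) \<longleftrightarrow> c / 5 - a / 6 < m"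
    "5 * (m + a / 6) \<le> c \<longleftrightarrow> m \<le> c / 5 - a / 6" "c \<le> 5 * (m + a / 6) \<longleftrightarrow> c / 5 - a / 6 \<le> m"
  by (simp_all add: field_simps)

text \<open>Strictly inside the fibre the integrand is the reciprocal root of the discriminant;
  outside it vanishes since the quintic is not real-rooted. The leading 5 splits off as
  \<open>1 / sqrt 5\<close>.\<close>

lemma Jdens_generic:
  assumes d: "pderiv (Rpoly a b) = smult 5 (linprod [w1, w2, w3, w4])"
    and w: "w1 < w2" "w2 < w3" "w3 < w4"
    and v: "v1 = poly (Rpoly a b) w1" "v2 = poly (Rpoly a b) w2" "v3 = poly (Rpoly a b) w3" "v4 = poly (Rpoly a b) w4"
    and gap: "max v2 v4 < min v1 v3"
    and r: "{r1, r2, r3, r4} = (\<lambda>v. 5 * (v + a / 6)) ` {v1, v2, v3, v4}" "r1 < r2" "r2 < r3" "r3 < r4"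
  shows "Jdens (a, b) = ennreal (2 * ellipticK ((r3 - r2) * (r4 - r1) / ((r3 - r1) * (r4 - r2))) /
      sqrt ((r3 - r1) * (r4 - r2)) / sqrt 5)"
proof -
  note sv = sorted_critical_values[OF gap r]
  note w' = less_imp_le[OF w(1)] less_imp_le[OF w(2)] less_imp_le[OF w(3)]
  have pt: "rdens (vec5 0 1 a b c) = ennreal (1 / sqrt 5) *
      (ennreal (1 / sqrt ((c - r1) * (c - r2) * (r3 - c) * (r4 - c))) * indicator {r2..r3} c)"
    if c: "c \<noteq> r2" "c \<noteq> r3" for c
  proof (cases "r2 < c \<and> c < r3")
    case True
    have m: "max v2 v4 < c / 5 - a / 6" "c / 5 - a / 6 < min v1 v3"
      using True unfolding sv(1,2) scaled_value_bounds by simp_all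
    obtain x where x: "x \<in> chamber" "psums x = vec5 0 1 a b c"
      and vd: "(vdm x)\<^sup>2 = 5^5 * (poly (P5 a b c) w1 * poly (P5 a b c) w2 * poly (P5 a b c) w3 * poly (P5 a b c) w4)"
      by (rule strict_fibre[OF d w' m[unfolded v]])
    have "(vdm x)\<^sup>2 = 5 * ((c - r1) * (c - r2) * (c - r3) * (c - r4))"
      unfolding vd poly_P5 v[symmetric] critical_product sv(3) ..
    also have "\<dots> = 5 * ((c - r1) * (c - r2) * (r3 - c) * (r4 - c))" by algebra
    finally have "sqrt (5 * ((c - r1) * (c - r2) * (r3 - c) * (r4 - c))) = vdm x"
      using less_imp_le[OF vdm_pos[OF x(1)]] by (rule real_sqrt_unique)
    note sq = this[symmetric]
    hence vx: "1 / vdm x = 1 / sqrt 5 * (1 / sqrt ((c - r1) * (c - r2) * (r3 - c) * (r4 - c)))"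
      by (simp only: sq real_sqrt_mult[of 5] divide_divide_eq_left times_divide_times_eq mult_1_left)
    have nn: "0 \<le> 1 / sqrt ((c - r1) * (c - r2) * (r3 - c) * (r4 - c))"
      using True r by (intro divide_nonneg_nonneg real_sqrt_ge_zero mult_nonneg_nonneg) auto
    have "rdens (vec5 0 1 a b c) = ennreal (1 / vdm x)"
      unfolding x(2)[symmetric] rdens_def using x(1) by (simp add: rootvec_psums)
    also have "\<dots> = ennreal (1 / sqrt 5) * ennreal (1 / sqrt ((c - r1) * (c - r2) * (r3 - c) * (r4 - c)))"
      unfolding vx using nn by (intro ennreal_mult) simp_all
    finally show ?thesis using True by simp
  next
    case False
    have "vec5 0 1 a b c \<notin> psums ` chamber"
    proof
      assume "vec5 0 1 a b c \<in> psums ` chamber"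
      then obtain x where x: "psums x = vec5 0 1 a b c" by auto
      have "psum 1 x = 0" "psum 2 x = 1" "psum 3 x = a" "psum 4 x = b" "psum 5 x = c"
        using x unfolding psums_eq_vec5_iff by blast+
      hence "P5 a b c = linprod [x$0, x$1, x$2, x$3, x$4]"
        unfolding P5_eq_linprod_iff psum_5 by simp
      hence "max v2 v4 \<le> c / 5 - a / 6 \<and> c / 5 - a / 6 \<le> min v1 v3"
        using fibre_iff[OF d w', of c] unfolding v by blast
      hence "r2 \<le> c \<and> c \<le> r3" unfolding sv(1,2) scaled_value_bounds .
      thus False using False c by auto
    qed
    moreover have "c \<notin> {r2..r3}" using False c by auto
    ultimately show ?thesis by (simp add: rdens_def)
  qed
  have "AE c in lborel. rdens (vec5 0 1 a b c) = ennreal (1 / sqrt 5) *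
      (ennreal (1 / sqrt ((c - r1) * (c - r2) * (r3 - c) * (r4 - c))) * indicator {r2..r3} c)"
    using AE_lborel_singleton[of r2] AE_lborel_singleton[of r3] by eventually_elim (rule pt)
  hence "Jdens (a, b) = (\<integral>\<^sup>+c. ennreal (1 / sqrt 5) *
      (ennreal (1 / sqrt ((c - r1) * (c - r2) * (r3 - c) * (r4 - c))) * indicator {r2..r3} c) \<partial>lborel)"
    unfolding Jdens_def by (simp only: prod.case) (rule nn_integral_cong_AE)
  also have "\<dots> = ennreal (1 / sqrt 5) *
      (\<integral>\<^sup>+c. ennreal (1 / sqrt ((c - r1) * (c - r2) * (r3 - c) * (r4 - c))) * indicator {r2..r3} c \<partial>lborel)"
    by (intro nn_integral_cmult) measurable
  also have "\<dots> = ennreal (1 / sqrt 5) * ennreal (2 * ellipticK ((r3 - r2) * (r4 - r1) / ((r3 - r1) * (r4 - r2))) /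
      sqrt ((r3 - r1) * (r4 - r2)))"
    unfolding ellipticK_fibre_integral[OF r(2-4)] ..
  also have "\<dots> = ennreal (2 * ellipticK ((r3 - r2) * (r4 - r1) / ((r3 - r1) * (r4 - r2))) /
      sqrt ((r3 - r1) * (r4 - r2)) / sqrt 5)"
    by (simp add: ennreal_mult'[symmetric] mult.commute)
  finally show ?thesis .
qed

text \<open>Holds for every \<open>m\<close>: a non-integrable integrand has integral 0 by
  convention.\<close>

lemma ellipticK_nonneg: "ellipticK m \<ge> 0"
  unfolding ellipticK_def
  by (cases "(\<lambda>\<phi>. (1 - m * (sin \<phi>)\<^sup>2) powr (- 1/2)) integrable_on {0..pi/2}")
    (auto intro: integral_nonneg simp: not_integrable_integral)

section \<open>Complex roots: discriminant and real-rootedness\<close>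

lemma map_poly_linprod: "map_poly complex_of_real (linprod us) = linprod (map complex_of_real us)"
proof (induction us)
  case (Cons u us)
  have "map_poly complex_of_real ([:- u, 1:] * linprod us) = map_poly complex_of_real [:- u, 1:] * map_poly complex_of_real (linprod us)"
    by (simp only: poly_eq_iff coeff_map_poly of_real_0 coeff_mult of_real_sum of_real_mult simp_thms)
  thus ?case using Cons by (simp add: linprod_Cons map_poly_pCons del: mult_pCons_left)
qed simp

lemma prod_pairs_5:
  fixes f :: "nat \<Rightarrow> nat \<Rightarrow> 'a::comm_monoid_mult"
  shows "(\<Prod>j<5. \<Prod>i<j. f i j) = f 0 1 * f 0 2 * f 0 3 * f 0 4 * f 1 2 * f 1 3 * f 1 4 * f 2 3 * f 2 4 * f 3 4"
  by (simp add: eval_nat_numeral lessThan_Suc mult_ac)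

text \<open>The critical-value formula is used over the complex numbers, so it covers every real
  \<open>c\<close>, also those for which \<open>P5\<close> has non-real roots; only the critical
  points are real.\<close>

lemma disc_generic:
  assumes d: "pderiv (Rpoly a b) = smult 5 (linprod [w1, w2, w3, w4])"
  shows "disc (map_poly complex_of_real (P5 a b c)) = complex_of_real
    (5^5 * (poly (P5 a b c) w1 * poly (P5 a b c) w2 * poly (P5 a b c) w3 * poly (P5 a b c) w4))"
proof -
  define p where "p = map_poly complex_of_real (P5 a b c)"
  have pe: "poly p (complex_of_real z) = complex_of_real (poly (P5 a b c) z)" for z
    by (simp add: p_def P5_eq map_poly_pCons)
  have deg: "degree p = 5" unfolding p_def by (simp add: degree_map_poly degree_P5)
  have lc: "lead_coeff p = 1"
    using lead_coeff_P5[of a b c] unfolding deg by (simp add: p_def coeff_map_poly degree_P5)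
  define us where "us = (SOME us. mset us = proots p)"
  have us: "mset us = proots p" unfolding us_def by (rule someI_ex) (rule ex_mset)
  have len: "length us = degree p" using us size_proots_complex[of p] by (metis size_mset)
  have p0: "p \<noteq> 0" using deg by auto
  have P: "p = linprod us" using linprod_eqI[OF p0 _ len] us unfolding lc by simp
  obtain u1 u2 u3 u4 u5 where us5: "us = [u1, u2, u3, u4, u5]"
    using len deg by (auto simp: numeral_eq_Suc length_Suc_conv)
  have "pderiv p = map_poly complex_of_real (pderiv (P5 a b c))"
    by (simp add: p_def poly_eq_iff coeff_pderiv coeff_map_poly)
  also have "\<dots> = smult 5 (linprod (map complex_of_real [w1, w2, w3, w4]))"
    unfolding pderiv_P5 d map_poly_linprod[symmetric] by (simp add: poly_eq_iff coeff_map_poly)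
  finally have d': "pderiv p = smult 5 (linprod [complex_of_real w1, complex_of_real w2, complex_of_real w3, complex_of_real w4])"
    by simp
  have "disc p = (u1 - u2)^2 * (u1 - u3)^2 * (u1 - u4)^2 * (u1 - u5)^2 * (u2 - u3)^2 * (u2 - u4)^2 *
      (u2 - u5)^2 * (u3 - u4)^2 * (u3 - u5)^2 * (u4 - u5)^2"
    unfolding disc_def us_def[symmetric] Let_def len deg prod_pairs_5 by (simp add: us5)
  also have "\<dots> = 5^5 * (poly p (of_real w1) * poly p (of_real w2) * poly p (of_real w3) * poly p (of_real w4))"
    by (rule discriminant_critical_values[OF P[unfolded us5] d'])
  also have "\<dots> = complex_of_real
    (5^5 * (poly (P5 a b c) w1 * poly (P5 a b c) w2 * poly (P5 a b c) w3 * poly (P5 a b c) w4))"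
    unfolding pe by (simp only: of_real_mult of_real_power of_real_numeral)
  finally show ?thesis unfolding p_def .
qed

lemma all_roots_real_iff:
  "(\<forall>z. poly (map_poly complex_of_real (P5 a b c)) z = 0 \<longrightarrow> z \<in> \<real>) \<longleftrightarrow> (\<exists>us. P5 a b c = linprod us)"
proof
  define p where "p = map_poly complex_of_real (P5 a b c)"
  have deg: "degree p = 5" unfolding p_def by (simp add: degree_map_poly degree_P5)
  have lc: "lead_coeff p = 1"
    using lead_coeff_P5[of a b c] unfolding deg by (simp add: p_def coeff_map_poly degree_P5)
  have p0: "p \<noteq> 0" using deg by auto
  assume real: "\<forall>z. poly (map_poly complex_of_real (P5 a b c)) z = 0 \<longrightarrow> z \<in> \<real>"
  obtain us where us: "mset us = proots p" using ex_mset by blast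
  have len: "length us = degree p" using us size_proots_complex[of p] by (metis size_mset)
  have "z \<in> \<real>" if "z \<in> set us" for z
  proof -
    have "z \<in># proots p" using that us by (metis set_mset_mset)
    thus ?thesis using real p0 by (simp add: p_def)
  qed
  hence "map (\<lambda>z. complex_of_real (Re z)) us = us" by (intro map_idI) (simp add: of_real_Re)
  hence "us = map complex_of_real (map Re us)" by (simp add: comp_def)
  moreover have "p = linprod us" using linprod_eqI[OF p0 _ len] us unfolding lc by simp
  ultimately have "p = map_poly complex_of_real (linprod (map Re us))" unfolding map_poly_linprod by simp
  hence "P5 a b c = linprod (map Re us)"
    unfolding p_def by (simp add: poly_eq_iff coeff_map_poly)
  thus "\<exists>us. P5 a b c = linprod us" by blast
next
  assume "\<exists>us. P5 a b c = linprod us"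
  then obtain us where us: "P5 a b c = linprod us" by auto
  have "z \<in> \<real>" if "poly (linprod (map complex_of_real us)) z = 0" for z
    using that by (induction us) auto
  thus "\<forall>z. poly (map_poly complex_of_real (P5 a b c)) z = 0 \<longrightarrow> z \<in> \<real>"
    unfolding us map_poly_linprod by blast
qed

lemma eventually_extrema:
  fixes w1 :: real
  assumes d: "pderiv p = smult 5 (linprod [w1, w2, w3, w4])" and w: "w1 < w2" "w2 < w3" "w3 < w4"
  shows "\<forall>\<^sub>F z in nhds w1. poly p z \<le> poly p w1" "\<forall>\<^sub>F z in nhds w2. poly p z \<ge> poly p w2"
    "\<forall>\<^sub>F z in nhds w3. poly p z \<le> poly p w3" "\<forall>\<^sub>F z in nhds w4. poly p z \<ge> poly p w4"
proof -
  note ext = critical_extrema[OF d w]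
  have "\<forall>\<^sub>F z in nhds w1. z \<in> {..<w2}" using w by (intro eventually_nhds_in_open) auto
  thus "\<forall>\<^sub>F z in nhds w1. poly p z \<le> poly p w1" by eventually_elim (auto intro: ext)
  have "\<forall>\<^sub>F z in nhds w2. z \<in> {w1<..<w3}" using w by (intro eventually_nhds_in_open) auto
  thus "\<forall>\<^sub>F z in nhds w2. poly p z \<ge> poly p w2" by eventually_elim (auto intro: ext)
  have "\<forall>\<^sub>F z in nhds w3. z \<in> {w2<..<w4}" using w by (intro eventually_nhds_in_open) auto
  thus "\<forall>\<^sub>F z in nhds w3. poly p z \<le> poly p w3" by eventually_elim (auto intro: ext)
  have "\<forall>\<^sub>F z in nhds w4. z \<in> {w3<..}" using w by (intro eventually_nhds_in_open) auto
  thus "\<forall>\<^sub>F z in nhds w4. poly p z \<ge> poly p w4" by eventually_elim (auto intro: ext)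
qed

lemma generic_shape:
  assumes d: "pderiv (Rpoly a b) = smult 5 (linprod [w1, w2, w3, w4])"
    and w: "w1 < w2" "w2 < w3" "w3 < w4"
    and v: "v1 = poly (Rpoly a b) w1" "v2 = poly (Rpoly a b) w2" "v3 = poly (Rpoly a b) w3" "v4 = poly (Rpoly a b) w4"
    and gap: "max v2 v4 < min v1 v3"
    and r: "{r1, r2, r3, r4} = (\<lambda>v. 5 * (v + a / 6)) ` {v1, v2, v3, v4}" "r1 < r2" "r2 < r3" "r3 < r4"
  shows "(a, b) \<in> interior shape_region"
    and "disc (map_poly complex_of_real (P5 a b c)) =
      complex_of_real (5 * ((c - r1) * (c - r2) * (c - r3) * (c - r4)))"
    and "{c. \<forall>z. poly (map_poly complex_of_real (P5 a b c)) z = 0 \<longrightarrow> z \<in> \<real>} = {r2..r3}"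
    and "shape_density (a, b) = 2 * ellipticK ((r3 - r2) * (r4 - r1) / ((r3 - r1) * (r4 - r2))) /
      (pi\<^sup>2 * sqrt ((r3 - r1) * (r4 - r2)))"
proof -
  note w' = less_imp_le[OF w(1)] less_imp_le[OF w(2)] less_imp_le[OF w(3)]
  note sv = sorted_critical_values[OF gap r]
  show "(a, b) \<in> interior shape_region"
    by (rule positive_gap_interior[OF d w']) (use gap in \<open>simp add: critical_gap_def v\<close>)
  show "disc (map_poly complex_of_real (P5 a b c)) =
      complex_of_real (5 * ((c - r1) * (c - r2) * (c - r3) * (c - r4)))"
    unfolding disc_generic[OF d] poly_P5 v[symmetric] critical_product sv(3) ..
  show "{c. \<forall>z. poly (map_poly complex_of_real (P5 a b c)) z = 0 \<longrightarrow> z \<in> \<real>} = {r2..r3}"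
    unfolding all_roots_real_iff fibre_iff[OF d w'] v[symmetric] sv(1,2) atLeastAtMost_def atLeast_def atMost_def
      scaled_value_bounds by auto
  define K where "K = 2 * ellipticK ((r3 - r2) * (r4 - r1) / ((r3 - r1) * (r4 - r2))) / sqrt ((r3 - r1) * (r4 - r2))"
  have "K \<ge> 0" unfolding K_def using r ellipticK_nonneg
    by (intro divide_nonneg_nonneg real_sqrt_ge_zero mult_nonneg_nonneg) auto
  moreover have "Jdens (a, b) = ennreal (K / sqrt 5)"
    unfolding K_def by (rule Jdens_generic[OF d w v gap r])
  \<comment> \<open>The \<open>sqrt 5\<close> of the normalising constant cancels the one from the
    discriminant.\<close>
  ultimately have "shape_density (a, b) = K / pi\<^sup>2"
    by (simp add: shape_density_def)
  thus "shape_density (a, b) = 2 * ellipticK ((r3 - r2) * (r4 - r1) / ((r3 - r1) * (r4 - r2))) /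
      (pi\<^sup>2 * sqrt ((r3 - r1) * (r4 - r2)))"
    by (simp add: K_def mult.commute)
qed

lemma distributed_shape: "distributed uniform_Omega5 lborel (\<lambda>u. (psum 3 u, psum 4 u)) (\<lambda>x. ennreal (shape_density x))"
proof -
  have m: "(\<lambda>u. (psum 3 u, psum 4 u)) \<in> measurable uniform_Omega5 borel"
    unfolding borel_prod[symmetric] by measurable
  have "distr uniform_Omega5 lborel (\<lambda>u. (psum 3 u, psum 4 u)) = distr uniform_Omega5 borel (\<lambda>u. (psum 3 u, psum 4 u))"
    by (rule distr_cong) simp_all
  thus ?thesis
    using m shape_density_borel by (simp add: distributed_def distr_uniform_Omega5)
qed

theorem theorem5:
  shows "\<exists>f5 :: real \<times> real \<Rightarrow> real.
    (\<forall>x. f5 x \<ge> 0) \<and>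
    distributed uniform_Omega5 lborel (\<lambda>u. (psum 3 u, psum 4 u)) (\<lambda>x. ennreal (f5 x)) \<and>
    (\<forall>a b w1 w2 w3 w4 v1 v2 v3 v4 r1 r2 r3 r4.
       proots (pderiv (Rpoly a b)) = {#w1, w2, w3, w4#} \<and> w1 < w2 \<and> w2 < w3 \<and> w3 < w4 \<and>
       v1 = poly (Rpoly a b) w1 \<and> v2 = poly (Rpoly a b) w2 \<and>
       v3 = poly (Rpoly a b) w3 \<and> v4 = poly (Rpoly a b) w4 \<longrightarrow>
       (\<forall>\<^sub>F z in nhds w1. poly (Rpoly a b) z \<le> v1) \<and> (\<forall>\<^sub>F z in nhds w2. poly (Rpoly a b) z \<ge> v2) \<and>
       (\<forall>\<^sub>F z in nhds w3. poly (Rpoly a b) z \<le> v3) \<and> (\<forall>\<^sub>F z in nhds w4. poly (Rpoly a b) z \<ge> v4) \<and>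
       (max v2 v4 < min v1 v3 \<and>
        {r1, r2, r3, r4} = (\<lambda>v. 5 * (v + a / 6)) ` {v1, v2, v3, v4} \<and>
        r1 < r2 \<and> r2 < r3 \<and> r3 < r4 \<longrightarrow>
        (a, b) \<in> interior (msupport law_p34) \<and>
        (\<forall>c. disc (map_poly complex_of_real (P5 a b c)) =
               complex_of_real (5 * ((c - r1) * (c - r2) * (c - r3) * (c - r4)))) \<and>
        {c. \<forall>z. poly (map_poly complex_of_real (P5 a b c)) z = 0 \<longrightarrow> z \<in> \<real>} = {r2..r3} \<and>
        f5 (a, b) =
          2 * ellipticK ((r3 - r2) * (r4 - r1) / ((r3 - r1) * (r4 - r2))) /
          (pi\<^sup>2 * sqrt ((r3 - r1) * (r4 - r2))))) \<and>
    (\<forall>a b. size (proots (pderiv (Rpoly a b))) < 4 \<longrightarrow>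
       (a, b) \<notin> msupport law_p34 \<and> f5 (a, b) = 0) \<and>
    (\<forall>a b w1 w2 w3 w4.
       proots (pderiv (Rpoly a b)) = {#w1, w2, w3, w4#} \<and> w1 \<le> w2 \<and> w2 \<le> w3 \<and> w3 \<le> w4 \<and>
       max (poly (Rpoly a b) w2) (poly (Rpoly a b) w4) >
         min (poly (Rpoly a b) w1) (poly (Rpoly a b) w3) \<longrightarrow>
       (a, b) \<notin> msupport law_p34 \<and> f5 (a, b) = 0) \<and>
    frontier (msupport law_p34) =
      {(a, b). \<exists>w1 w2 w3 w4.
         proots (pderiv (Rpoly a b)) = {#w1, w2, w3, w4#} \<and> w1 \<le> w2 \<and> w2 \<le> w3 \<and> w3 \<le> w4 \<and>
         max (poly (Rpoly a b) w2) (poly (Rpoly a b) w4) =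
           min (poly (Rpoly a b) w1) (poly (Rpoly a b) w3)} \<and>
    frontier (msupport law_p34) \<in> null_sets lborel \<and>
    (\<forall>(M :: 'm measure) (X :: 5 \<Rightarrow> 'm \<Rightarrow> real) \<mu> \<sigma>.
       prob_space M \<and> \<sigma> > 0 \<and>
       prob_space.indep_vars M (\<lambda>_. borel) X UNIV \<and>
       (\<forall>i. distributed M lborel (X i) (\<lambda>x. ennreal (normal_density \<mu> \<sigma> x))) \<longrightarrow>
       distributed M lborel
         (\<lambda>\<omega>. (skewness5 (\<chi> i. X i \<omega>), kurtosis5 (\<chi> i. X i \<omega>)))
         (\<lambda>(s, k). ennreal (5 powr (- 3/2) * f5 (s / sqrt 5, k / 5))))"
proof (rule exI[of _ shape_density], intro conjI, goal_cases)
  case 1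
  show ?case by (simp add: shape_density_nonneg)
next
  case 2
  show ?case by (rule distributed_shape)
next
  case 3
  show ?case
  proof (intro allI impI, elim conjE, goal_cases)
    case (1 a b w1 w2 w3 w4 v1 v2 v3 v4 r1 r2 r3 r4)
    note d = 1(1)[unfolded proots_pderiv_Rpoly_iff] and w = 1(2-4) and v = 1(5-8)
    note ext = eventually_extrema[OF d w, folded v]
    note generic = generic_shape[OF d w v]
    show ?case
      unfolding msupport_law_p34 by (intro conjI impI allI ext; elim conjE; rule generic; assumption)
  qed
next
  case 4
  show ?case
  proof (intro allI impI, goal_cases)
    case (1 a b)
    have "(a, b) \<notin> shape_region"
    proof
      assume "(a, b) \<in> shape_region"
      then obtain w1 w2 w3 w4 where "pderiv (Rpoly a b) = smult 5 (linprod [w1, w2, w3, w4])"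
        unfolding shape_region_critical by blast
      hence "proots (pderiv (Rpoly a b)) = {#w1, w2, w3, w4#}"
        by (rule proots_pderiv_Rpoly_iff[THEN iffD2])
      thus False using 1 by simp
    qed
    thus ?case by (simp add: msupport_law_p34 shape_density_outside)
  qed
next
  case 5
  show ?case
  proof (intro allI impI, elim conjE, goal_cases)
    case (1 a b w1 w2 w3 w4)
    note d = 1(1)[unfolded proots_pderiv_Rpoly_iff] and w = 1(2-4)
    have "(a, b) \<notin> shape_region"
    proof
      assume "(a, b) \<in> shape_region"
      then obtain z1 z2 z3 z4 where z: "pderiv (Rpoly a b) = smult 5 (linprod [z1, z2, z3, z4])"
        "z1 \<le> z2" "z2 \<le> z3" "z3 \<le> z4"
        and gap: "max (poly (Rpoly a b) z2) (poly (Rpoly a b) z4) \<le> min (poly (Rpoly a b) z1) (poly (Rpoly a b) z3)"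
        unfolding shape_region_critical by blast
      \<comment> \<open>The ordered zeros of \<open>R'\<close> are unique, so the criterion for the
        region applies to the given critical points.\<close>
      have "w1 = z1 \<and> w2 = z2 \<and> w3 = z3 \<and> w4 = z4"
        by (rule linprod4_inject[OF trans[OF d[symmetric] z(1)] w z(2-4)])
      thus False using gap 1(5) by (metis leD)
    qed
    thus ?case by (simp add: msupport_law_p34 shape_density_outside)
  qed
next
  case 6
  show ?case
    unfolding msupport_law_p34 frontier_shape_region critical_gap_def proots_pderiv_Rpoly_iff right_minus_eq
    by (simp only: eq_commute[of "min _ _" "max _ _"])
next
  case 7
  show ?case unfolding msupport_law_p34 by (rule frontier_shape_region_null)
next
  case 8
  show ?case by (blast intro: distributed_skewness_kurtosis)
qed

end
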